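(* Let $k,\ell$ be fixed integers with $k/2<\ell<k$, and let $n\to\infty$ range over multiples of $\ell$. Let $p=p(n)\in(0,1]$ and $\epsilon=\epsilon(n)$ satisfy $\epsilon<1$ and $\epsilon^5 n^{1/2}p^2/\log^3 n\to\infty$. Let $H=([n],\mathcal E)$ be a $k$-uniform hypergraph with $m$ edges, where $p=m/\binom{n}{k}$, satisfying: (P_a) $d_H(S)\ge\lceil(1-\epsilon)\binom{n-2(k-\ell)}{2\ell-k}p\rceil$ for all $S\in\binom{[n]}{2(k-\ell)}$; (P_b) $d_H(S)\ge\lceil(1-\epsilon)\binom{n-2\ell+k}{2(k-\ell)}p\rceil$ for all $S\in\binom{[n]}{2\ell-k}$; (P_c) $d_H(S)\le\lfloor(1+\epsilon)\binom{n-2k+2\ell-1}{2\ell-k-1}p\rfloor$ for all $S\in\binom{[n]}{2(k-\ell)+1}$; (P_d) $d_H(S)\le\lfloor(1+\epsilon)\binom{n-2\ell+k-1}{2(k-\ell)-1}p\rfloor$ for all $S\in\binom{[n]}{2\ell-k+1}$; (P_e) $|N_H(S_1)\cap N_H(S_2)|\le\lfloor(1+\epsilon)\binom{n-2(2\ell-k)}{2(k-\ell)}p^2\rfloor$ for all disjoint $S_1,S_2\in\binom{[n]}{2\ell-k}$; (P_f) $|N_H(S_1)\cap N_H(S_2)|\le\lfloor(1+\epsilon)\binom{n}{2\ell-k}p^2\rfloor$ for all $S_1,S_2\in\binom{[n]}{2(k-\ell)}$ with $|S_1\cap S_2|\in\{0,k-\ell\}$. Then, for $n$ sufficiently large, $H$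 contains a collection of at least $(1-2\epsilon^{1/3})m/\nu_\ell$ pairwise edge-disjoint type $\ell$ Hamilton cycles, where $\nu_\ell=n/\ell$.
   Context: For a $k$-uniform hypergraph $H=([n],\mathcal E)$ and $X\subseteq[n]$ with $|X|=a<k$, the neighbourhood is $N_H(X)=\{Y\in\binom{[n]}{k-a}: X\cup Y\in\mathcal E\}$ and the degree is $d_H(X)=|N_H(X)|$. For $1\le \ell\le k$ and $\ell\mid n$, a type $\ell$ Hamilton cycle in a $k$-uniform hypergraph on $n$ vertices is a collection of $\nu_\ell=n/\ell$ edges $E_1,\dots,E_{\nu_\ell}$ such that for some cyclic ordering of the vertex set every edge consists of $k$ consecutive vertices and for every pair of consecutive edges $E_{i-1},E_i$ (indices mod $\nu_\ell$) we have $|E_{i-1}\setminus E_i|=\ell$. *)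

theory Defs
  imports Complex_Main
begin

definition uniform_hypergraph :: "nat \<Rightarrow> nat \<Rightarrow> nat set set \<Rightarrow> bool" where
  "uniform_hypergraph n k E \<longleftrightarrow> (\<forall>e\<in>E. e \<subseteq> {0..<n} \<and> card e = k)"

definition nbhd :: "nat \<Rightarrow> nat \<Rightarrow> nat set set \<Rightarrow> nat set \<Rightarrow> nat set set" where
  "nbhd n k E X = {Y. Y \<subseteq> {0..<n} \<and> card Y = k - card X \<and> X \<union> Y \<in> E}"

definition deg :: "nat \<Rightarrow> nat \<Rightarrow> nat set set \<Rightarrow> nat set \<Rightarrow> nat" where
  "deg n k E X = card (nbhd n k E X)"

definition ham_cycle :: "nat \<Rightarrow> nat \<Rightarrow> nat \<Rightarrow> nat set set \<Rightarrow> nat set set \<Rightarrow> bool" where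
  "ham_cycle n k l E C \<longleftrightarrow> l dvd n \<and> C \<subseteq> E \<and>
     (\<exists>\<sigma> f. bij_betw \<sigma> {0..<n} {0..<n} \<and>
        inj_on f {0..<n div l} \<and> C = f ` {0..<n div l} \<and>
        (\<forall>i<n div l. \<exists>s<n. f i = \<sigma> ` {(s + j) mod n | j. j < k}) \<and>
        (\<forall>i<n div l. card (f ((i + n div l - 1) mod (n div l)) - f i) = l))"

end

theory Submission
  imports Defs "HOL-Analysis.Convex" "HOL-Combinatorics.Permutations" "HOL-Library.FuncSet"
    "HOL-Library.Disjoint_Sets"
begin

text \<open>
  Write \<open>a = k - l\<close> and \<open>N = n / l\<close>. An ordering of the vertices cuts them into joint blocks
  \<open>A\<^sub>0, \<dots>, A\<^sub>N\<^sub>-\<^sub>1\<close> of size \<open>a\<close> and inner blocks \<open>B\<^sub>0, \<dots>, B\<^sub>N\<^sub>-\<^sub>1\<close> of size \<open>l - a\<close>. In the bipartite graph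
  joining \<open>i\<close> to \<open>j\<close> when \<open>A\<^sub>i \<union> A\<^sub>i\<^sub>+\<^sub>1 \<union> B\<^sub>j\<close> is an edge of the hypergraph, every perfect matching is a type
  \<open>l\<close> Hamilton cycle. For a random ordering the degrees are at least about \<open>(1 - \<epsilon>) p N\<close> and the codegrees
  at most about \<open>(1 + \<epsilon>) p\<^sup>2 N\<close>, by a martingale bound for functions of a random permutation. Take so
  many random orderings that every hyperedge is covered about \<open>K \<approx> ln n / \<epsilon>\<^sup>2\<close> times, and hand each
  hyperedge to one of the orderings covering it at random; the bipartite graphs become edge-disjoint
  and stay pseudo-random with density \<open>d = p / K\<close>. In such a graph any two sets \<open>S\<close>, \<open>T\<close> with
  \<open>|S| + |T| \<ge> N\<close> span at least \<open>(1 - \<delta>) d |S| |T| \<ge> (1 - \<delta>) d N (|S| + |T| - N)\<close> edges, where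
  \<open>\<delta> = 1.9 \<epsilon>\<^sup>1\<^sup>/\<^sup>3\<close>, so there is a \<open>(1 - \<delta>) d N\<close>-regular spanning subgraph, which splits into
  perfect matchings.
\<close>

section \<open>Packing perfect matchings in bipartite graphs\<close>

text \<open>The binding requirement is codegree concentration after the split. A deviation of order
  \<open>\<epsilon> * d^2 * N\<close> must beat fluctuations of order
  \<open>sqrt (N * ln n)\<close>, so \<open>\<epsilon>^2 * d^4 * N\<close> has to exceed a multiple
  of \<open>ln n\<close>. A Chernoff bound of relative precision \<epsilon> over up to
  \<open>n^k\<close> hyperedges forces \<open>K\<close> to have order
  \<open>ln n / \<epsilon>^2\<close>. With \<open>d = p / K\<close> the requirement reads:
  \<open>\<epsilon>^10 * p^4 * n\<close> exceeds a multiple of \<open>(ln n)^5\<close>. The square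
  of the growth hypothesis supplies \<open>(ln n)^6\<close>.

  \<open>K\<close> does not affect the number of cycles: the number of orderings is proportional to
  \<open>K\<close>, the number of matchings per ordering to \<open>1 / K\<close>.

  The second moment argument loses a relative amount of order \<epsilon> to the power 1/2. With
  \<open>x\<close> the cube root of \<epsilon>, \<open>x^3 \<le> x^2 / 2\<close> for
  \<open>x \<le> 1/2\<close>, while for \<open>x \<ge> 1/2\<close> the claim is vacuous; this yields
  the constant 1.9, and the gap to 2 pays for roundings and for the surplus in \<open>K\<close>.

  Probabilities appear throughout as cardinalities: an event is bounded by counting bad
  permutations, colourings or sequences.\<close>

theorem hall_marriage:
  fixes A :: "'a \<Rightarrow> 'b set"
  assumes "finite X" and "\<And>x. x \<in> X \<Longrightarrow> finite (A x)"
    and "\<And>S. S \<subseteq> X \<Longrightarrow> card S \<le> card (\<Union>(A ` S))"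
  shows "\<exists>f. inj_on f X \<and> (\<forall>x\<in>X. f x \<in> A x)"
  using assms
proof (induction X arbitrary: A rule: finite_psubset_induct)
  case (psubset X)
  note fin = psubset.prems(1) and hall = psubset.prems(2)
  have finU: "finite (\<Union>(A ` S))" if "S \<subseteq> X" for S
    using that fin psubset.hyps by (meson finite_UN finite_subset subsetD)
  \<comment> \<open>Halmos-Vaughan dichotomy: a tight proper subset can be married off on its own
    and the rest still satisfies the condition on the remaining partners. If no proper subset is
    tight, each has a spare partner, so any single couple may be removed.\<close>
  consider "X = {}" | S where "S \<noteq> {}" "S \<subset> X" "card S = card (\<Union>(A ` S))"
    | "X \<noteq> {}" "\<And>S. S \<noteq> {} \<Longrightarrow> S \<subset> X \<Longrightarrow> card S < card (\<Union>(A ` S))"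
    using hall by (metis le_neq_implies_less psubset_imp_subset)
  then show ?case
  proof cases
    case 1
    then show ?thesis by simp
  next
    case (2 S)
    obtain f where f: "inj_on f S" "\<forall>x\<in>S. f x \<in> A x"
      using psubset.IH[of S A] 2 fin hall by (meson psubset_imp_subset subset_trans subsetD)
    define A' where "A' x = A x - \<Union>(A ` S)" for x
    have "\<exists>g. inj_on g (X - S) \<and> (\<forall>x\<in>X - S. g x \<in> A' x)"
    proof (rule psubset.IH)
      show "X - S \<subset> X" using 2 by auto
      show "finite (A' x)" if "x \<in> X - S" for x
        using that fin by (simp add: A'_def)
      show "card U \<le> card (\<Union>(A' ` U))" if U: "U \<subseteq> X - S" for U
      proof -
        have eq: "\<Union>(A ` (U \<union> S)) = \<Union>(A' ` U) \<union> \<Union>(A ` S)"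
          by (auto simp: A'_def)
        have disj: "\<Union>(A' ` U) \<inter> \<Union>(A ` S) = {}" by (auto simp: A'_def)
        have sub: "\<Union>(A' ` U) \<subseteq> \<Union>(A ` U)" by (auto simp: A'_def)
        have "card U + card S = card (U \<union> S)"
          using U 2 psubset.hyps
          by (metis Diff_disjoint card_Un_disjoint disjoint_iff finite_Diff finite_subset
              psubset_imp_subset subsetD inf.commute)
        also have "\<dots> \<le> card (\<Union>(A ` (U \<union> S)))"
          using U 2 by (intro hall) auto
        also have "\<dots> = card (\<Union>(A' ` U)) + card (\<Union>(A ` S))"
          unfolding eq using disj finite_subset[OF sub finU[of U]] finU[of S] U 2
          by (intro card_Un_disjoint) auto
        finally show ?thesis using 2 by simp
      qed
    qed
    then obtain g where g: "inj_on g (X - S)" "\<forall>x\<in>X - S. g x \<in> A' x" by blast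
    define h where "h x = (if x \<in> S then f x else g x)" for x
    have "inj_on h X"
    proof (rule inj_onI)
      fix x y assume xy: "x \<in> X" "y \<in> X" "h x = h y"
      show "x = y"
      proof (cases "x \<in> S"; cases "y \<in> S")
        assume "x \<in> S" "y \<in> S"
        then show ?thesis using f xy by (auto simp: h_def inj_on_def)
      next
        assume "x \<in> S" "y \<notin> S"
        moreover from this have "f x \<in> \<Union>(A ` S)" "g y \<notin> \<Union>(A ` S)"
          using f g xy by (auto simp: A'_def)
        ultimately show ?thesis using xy by (auto simp: h_def)
      next
        assume "x \<notin> S" "y \<in> S"
        moreover from this have "f y \<in> \<Union>(A ` S)" "g x \<notin> \<Union>(A ` S)"
          using f g xy by (auto simp: A'_def)
        ultimately show ?thesis using xy by (auto simp: h_def)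
      next
        assume "x \<notin> S" "y \<notin> S"
        then show ?thesis using g xy by (auto simp: h_def inj_on_def)
      qed
    qed
    moreover have "\<forall>x\<in>X. h x \<in> A x" using f g by (auto simp: h_def A'_def)
    ultimately show ?thesis by blast
  next
    case 3
    then obtain x where x: "x \<in> X" by blast
    have "card {x} \<le> card (\<Union>(A ` {x}))" using x by (intro hall) auto
    then obtain y where y: "y \<in> A x" using x fin by fastforce
    define A' where "A' z = A z - {y}" for z
    have "\<exists>g. inj_on g (X - {x}) \<and> (\<forall>z\<in>X - {x}. g z \<in> A' z)"
    proof (rule psubset.IH)
      show "X - {x} \<subset> X" using x by auto
      show "finite (A' z)" if "z \<in> X - {x}" for z
        using that fin by (simp add: A'_def)
      show "card U \<le> card (\<Union>(A' ` U))" if U: "U \<subseteq> X - {x}" for U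
      proof (cases "U = {}")
        case False
        have "card U < card (\<Union>(A ` U))" using 3(2)[OF False] U x by blast
        moreover have "\<Union>(A' ` U) = \<Union>(A ` U) - {y}" by (auto simp: A'_def)
        ultimately show ?thesis
          using card_Diff_singleton_if[of "\<Union>(A ` U)" y] by (auto split: if_splits)
      qed simp
    qed
    then obtain g where g: "inj_on g (X - {x})" "\<forall>z\<in>X - {x}. g z \<in> A' z" by blast
    have "inj_on (g(x := y)) X" using g by (auto simp: inj_on_def A'_def)
    moreover have "\<forall>z\<in>X. (g(x := y)) z \<in> A z" using g y by (auto simp: A'_def)
    ultimately show ?thesis by blast
  qed
qed

text \<open>Subdividing every edge turns the search for an r-factor into a marriage problem: the edge
  \<open>e\<close> lies outside the factor iff its left half is married to its right half.\<close>

lemma bipartite_factor_exists: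
  fixes G :: "('a \<times> 'b) set" and r :: nat
  assumes fin: "finite A" "finite B" and card_eq: "card A = card B" and G: "G \<subseteq> A \<times> B"
    and cond: "\<And>S T. S \<subseteq> A \<Longrightarrow> T \<subseteq> B \<Longrightarrow>
      r * (card S + card T) \<le> card (G \<inter> S \<times> T) + r * card B"
  shows "\<exists>F\<subseteq>G. (\<forall>a\<in>A. card {b. (a, b) \<in> F} = r) \<and> (\<forall>b\<in>B. card {a. (a, b) \<in> F} = r)"
proof -
  have finG: "finite G" using G fin finite_subset by blast
  \<comment> \<open>Each vertex gets \<open>r\<close> copies and each edge two halves. A copy of
    \<open>a\<close> selects an edge at \<open>a\<close> by marrying its right half; the left half
    of that edge must then marry a copy of its right endpoint. Hence exactly \<open>r\<close> edges
    are selected at each vertex.\<close>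
  define X :: "('a \<times> nat + 'a \<times> 'b) set" where "X = (A \<times> {..<r}) <+> G"
  define Y :: "('b \<times> nat + 'a \<times> 'b) set" where "Y = (B \<times> {..<r}) <+> G"
  define Nb :: "('a \<times> nat + 'a \<times> 'b) \<Rightarrow> ('b \<times> nat + 'a \<times> 'b) set" where
    "Nb x = (case x of Inl u \<Rightarrow> Inr ` {e \<in> G. fst e = fst u}
       | Inr e \<Rightarrow> insert (Inr e) (Inl ` ({snd e} \<times> {..<r})))" for x
  have finX: "finite X" and finY: "finite Y" using fin finG by (auto simp: X_def Y_def)
  have cardXY: "card X = card Y" using card_eq fin finG by (simp add: X_def Y_def card_Plus)
  have NbY: "Nb x \<subseteq> Y" if "x \<in> X" for x
    using that G by (auto simp: X_def Y_def Nb_def)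
  have "\<exists>f. inj_on f X \<and> (\<forall>x\<in>X. f x \<in> Nb x)"
  proof (rule hall_marriage[OF finX])
    show "finite (Nb x)" if "x \<in> X" for x using NbY[OF that] finY finite_subset by blast
    show "card U \<le> card (\<Union>(Nb ` U))" if U: "U \<subseteq> X" for U
    proof -
      define S where "S = fst ` (Inl -` U)"
      define F0 where "F0 = Inr -` U"
      define T' where "T' = snd ` F0"
      have F0G: "F0 \<subseteq> G" using U by (auto simp: F0_def X_def)
      have SA: "S \<subseteq> A" using U by (auto simp: S_def X_def)
      have TB: "T' \<subseteq> B" using F0G G by (auto simp: T'_def)
      have finF0: "finite F0" using F0G finG finite_subset by blast
      have finS: "finite S" using SA fin finite_subset by blast
      have finT: "finite T'" using TB fin finite_subset by blast
      have "U \<subseteq> (S \<times> {..<r}) <+> F0"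
      proof
        fix u assume u: "u \<in> U"
        show "u \<in> (S \<times> {..<r}) <+> F0"
        proof (cases u)
          case (Inl v)
          then show ?thesis using u U
            by (cases v) (force simp: S_def X_def image_iff)
        qed (use u in \<open>auto simp: F0_def\<close>)
      qed
      then have "card U \<le> card ((S \<times> {..<r}) <+> F0)"
        using finS finF0 by (intro card_mono) auto
      also have "\<dots> = r * card S + card F0" using finS finF0 by (simp add: card_Plus)
      finally have c1: "card U \<le> r * card S + card F0" .
      have sub: "(T' \<times> {..<r}) <+> (F0 \<union> G \<inter> S \<times> (B - T')) \<subseteq> \<Union>(Nb ` U)"
      proof
        fix y assume y: "y \<in> (T' \<times> {..<r}) <+> (F0 \<union> G \<inter> S \<times> (B - T'))"
        show "y \<in> \<Union>(Nb ` U)"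
        proof (cases y)
          case (Inl v)
          then obtain e where "e \<in> F0" "snd e = fst v" "snd v < r" using y by (auto simp: T'_def)
          then show ?thesis using Inl
            by (intro UN_I[of "Inr e"]) (auto simp: F0_def Nb_def image_iff prod_eq_iff)
        next
          case (Inr e)
          then consider "e \<in> F0" | "e \<in> G" "fst e \<in> S" using y by auto
          then show ?thesis
          proof cases
            case 1
            then show ?thesis using Inr by (intro UN_I[of "Inr e"]) (auto simp: F0_def Nb_def)
          next
            case 2
            then obtain u where "Inl u \<in> U" "fst u = fst e" by (auto simp: S_def)
            then show ?thesis using 2 Inr by (intro UN_I[of "Inl u"]) (auto simp: Nb_def)
          qed
        qed
      qed
      have disj: "F0 \<inter> (G \<inter> S \<times> (B - T')) = {}" by (force simp: T'_def)
      have "r * card T' + (card F0 + card (G \<inter> S \<times> (B - T')))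
        = card ((T' \<times> {..<r}) <+> (F0 \<union> G \<inter> S \<times> (B - T')))"
        using finT finF0 finG disj by (simp add: card_Plus card_Un_disjoint)
      also have "\<dots> \<le> card (\<Union>(Nb ` U))"
        using NbY U finY by (intro card_mono sub) (meson UN_least finite_subset subsetD)
      finally have c2: "r * card T' + (card F0 + card (G \<inter> S \<times> (B - T'))) \<le> card (\<Union>(Nb ` U))" .
      \<comment> \<open>The complement of \<open>T'\<close> turns the edge-count hypothesis into
        Hall's inequality: \<open>r * card (B - T') - r * card B\<close> becomes
        \<open>- r * card T'\<close>.\<close>
      have "r * (card S + card (B - T')) \<le> card (G \<inter> S \<times> (B - T')) + r * card B"
        by (rule cond) (use SA in auto)
      moreover have "card B = card (B - T') + card T'"
        using TB fin by (metis card_Diff_subset card_mono finT le_add_diff_inverse2)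
      ultimately have "r * card S \<le> card (G \<inter> S \<times> (B - T')) + r * card T'"
        by (simp add: algebra_simps)
      then show ?thesis using c1 c2 by linarith
    qed
  qed
  then obtain f where inj: "inj_on f X" and f: "\<And>x. x \<in> X \<Longrightarrow> f x \<in> Nb x" by blast
  \<comment> \<open>Surjectivity is needed on both summands: onto the edges for the degrees in
    \<open>A\<close>, onto the copies for the degrees in \<open>B\<close>.\<close>
  have img: "f ` X = Y"
    using finY inj cardXY f NbY by (intro card_subset_eq) (auto simp: card_image)
  define F where "F = {e \<in> G. f (Inr e) \<noteq> Inr e}"
  have "card {b. (a, b) \<in> F} = r" if a: "a \<in> A" for a
  proof -
    have "Inr ` (Pair a ` {b. (a, b) \<in> F}) = f ` Inl ` ({a} \<times> {..<r})"
    proof (intro equalityI subsetI)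
      fix y :: "'b \<times> nat + 'a \<times> 'b" assume "y \<in> Inr ` (Pair a ` {b. (a, b) \<in> F})"
      then obtain b where b: "y = Inr (a, b)" "(a, b) \<in> F" by auto
      then have "y \<in> f ` X" using img by (auto simp: F_def Y_def)
      then obtain x where x: "x \<in> X" "f x = y" by auto
      show "y \<in> f ` Inl ` ({a} \<times> {..<r})"
      proof (cases x)
        case (Inl u)
        then have "x \<in> Inl ` ({a} \<times> {..<r})" using x f[OF x(1)] b
          by (cases u) (auto simp: X_def Nb_def)
        then show ?thesis using x by blast
      next
        case (Inr e)
        then show ?thesis using x f[OF x(1)] b by (auto simp: Nb_def F_def)
      qed
    next
      fix y assume "y \<in> f ` Inl ` ({a} \<times> {..<r})"
      then obtain i where i: "i < r" "y = f (Inl (a, i))" by auto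
      then have X: "Inl (a, i) \<in> X" using a by (auto simp: X_def)
      then obtain e where e: "e \<in> G" "fst e = a" "y = Inr e" using f[OF X] i by (auto simp: Nb_def)
      have "Inr e \<in> X" using e by (auto simp: X_def)
      then have "f (Inr e) \<noteq> Inr e" using inj X i e by (auto simp: inj_on_def)
      then show "y \<in> Inr ` (Pair a ` {b. (a, b) \<in> F})" using e by (cases e) (auto simp: F_def)
    qed
    then have "card (Inr ` (Pair a ` {b. (a, b) \<in> F}) :: ('b \<times> nat + 'a \<times> 'b) set)
       = card (f ` Inl ` ({a} \<times> {..<r}))" by simp
    moreover have "card (f ` Inl ` ({a} \<times> {..<r})) = r"
    proof (subst card_image)
      show "inj_on f (Inl ` ({a} \<times> {..<r}))"
        using a by (intro inj_on_subset[OF inj]) (auto simp: X_def)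
    qed (simp add: card_image)
    ultimately show ?thesis by (simp add: card_image inj_on_def)
  qed
  moreover have "card {a. (a, b) \<in> F} = r" if b: "b \<in> B" for b
  proof -
    have "f ` Inr ` ((\<lambda>a. (a, b)) ` {a. (a, b) \<in> F}) = Inl ` ({b} \<times> {..<r})"
    proof (intro equalityI subsetI)
      fix y assume "y \<in> f ` Inr ` ((\<lambda>a. (a, b)) ` {a. (a, b) \<in> F})"
      then obtain a where a: "(a, b) \<in> F" "y = f (Inr (a, b))" by auto
      then have "Inr (a, b) \<in> X" by (auto simp: X_def F_def)
      from f[OF this] show "y \<in> Inl ` ({b} \<times> {..<r})" using a by (auto simp: Nb_def F_def)
    next
      fix y :: "'b \<times> nat + 'a \<times> 'b" assume y: "y \<in> Inl ` ({b} \<times> {..<r})"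
      then have "y \<in> f ` X" using img b by (auto simp: Y_def)
      then obtain x where x: "x \<in> X" "f x = y" by auto
      show "y \<in> f ` Inr ` ((\<lambda>a. (a, b)) ` {a. (a, b) \<in> F})"
      proof (cases x)
        case (Inl u)
        then show ?thesis using x f[OF x(1)] y by (auto simp: Nb_def)
      next
        case (Inr e)
        then show ?thesis using x f[OF x(1)] y
          by (cases e) (auto simp: Nb_def F_def X_def image_iff)
      qed
    qed
    then have "card (f ` Inr ` ((\<lambda>a. (a, b)) ` {a. (a, b) \<in> F}))
       = card (Inl ` ({b} \<times> {..<r}) :: ('b \<times> nat + 'a \<times> 'b) set)" by simp
    moreover have "card (f ` Inr ` ((\<lambda>a. (a, b)) ` {a. (a, b) \<in> F})) = card {a. (a, b) \<in> F}"
      by (subst card_image, rule inj_on_subset[OF inj])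
         (auto simp: X_def F_def card_image inj_on_def)
    ultimately show ?thesis by (simp add: card_image)
  qed
  ultimately show ?thesis by (intro exI[of _ F]) (auto simp: F_def)
qed

text \<open>Double counting the edges at \<open>S\<close> against those at its neighbourhood gives
  Hall's condition in a regular graph of positive degree; removing the matching lowers every degree
  by one. Disjointness is stated as \<open>\<phi> t a \<noteq> \<phi> t' a\<close>, the form in
  which two cycles from the same ordering are later separated.\<close>

lemma regular_bipartite_perfect_matchings:
  fixes F :: "('a \<times> 'b) set"
  assumes "finite A" "finite B" "card A = card B" "F \<subseteq> A \<times> B"
    and "\<And>a. a \<in> A \<Longrightarrow> card {b. (a, b) \<in> F} = r"
    and "\<And>b. b \<in> B \<Longrightarrow> card {a. (a, b) \<in> F} = r"
  shows "\<exists>\<phi>. (\<forall>t<r. bij_betw (\<phi> t) A B \<and> (\<forall>a\<in>A. (a, \<phi> t a) \<in> F)) \<and>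
     (\<forall>t<r. \<forall>t'<r. \<forall>a\<in>A. t \<noteq> t' \<longrightarrow> \<phi> t a \<noteq> \<phi> t' a)"
  using assms
proof (induction r arbitrary: F)
  case 0
  then show ?case by simp
next
  case (Suc r)
  note finA = Suc.prems(1) and finB = Suc.prems(2) and FAB = Suc.prems(4)
    and degA = Suc.prems(5) and degB = Suc.prems(6)
  have finF: "finite F" using FAB finA finB finite_subset by blast
  have finR: "finite {b. (a, b) \<in> F}" for a
    by (rule finite_subset[of _ "snd ` F"]) (use finF in \<open>auto simp: image_iff\<close>, force)
  have finC: "finite {a. (a, b) \<in> F}" for b
    by (rule finite_subset[of _ "fst ` F"]) (use finF in \<open>auto simp: image_iff\<close>, force)
  have "\<exists>f. inj_on f A \<and> (\<forall>a\<in>A. f a \<in> {b. (a, b) \<in> F})"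
  proof (rule hall_marriage[OF finA])
    show "finite {b. (a, b) \<in> F}" for a by (rule finR)
    show "card S \<le> card (\<Union>a\<in>S. {b. (a, b) \<in> F})" if S: "S \<subseteq> A" for S
    proof -
      define T where "T = (\<Union>a\<in>S. {b. (a, b) \<in> F})"
      have TB: "T \<subseteq> B" using FAB by (auto simp: T_def)
      have finS: "finite S" and finT: "finite T" using S TB finA finB finite_subset by auto
      have "Suc r * card S = card (SIGMA a:S. {b. (a, b) \<in> F})"
        using S degA finS finR by (subst card_SigmaI) (auto simp: subset_iff)
      also have "\<dots> \<le> card (SIGMA b:T. {a. (a, b) \<in> F})"
        by (rule card_inj_on_le[of "\<lambda>(a, b). (b, a)"])
           (use finT finC in \<open>auto simp: inj_on_def T_def\<close>)
      also have "\<dots> = Suc r * card T"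
        using TB degB finT finC by (subst card_SigmaI) (auto simp: subset_iff)
      finally show ?thesis unfolding T_def[symmetric] by (subst (asm) Suc_mult_le_cancel1)
    qed
  qed
  then obtain f where f: "inj_on f A" "\<And>a. a \<in> A \<Longrightarrow> (a, f a) \<in> F" by auto
  have fB: "f ` A = B"
    using f FAB finB Suc.prems(3) by (intro card_subset_eq) (auto simp: card_image)
  define F' where "F' = F - (\<lambda>a. (a, f a)) ` A"
  have "\<exists>\<phi>. (\<forall>t<r. bij_betw (\<phi> t) A B \<and> (\<forall>a\<in>A. (a, \<phi> t a) \<in> F')) \<and>
     (\<forall>t<r. \<forall>t'<r. \<forall>a\<in>A. t \<noteq> t' \<longrightarrow> \<phi> t a \<noteq> \<phi> t' a)"
  proof (rule Suc.IH[OF finA finB Suc.prems(3)])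
    show "F' \<subseteq> A \<times> B" using FAB by (auto simp: F'_def)
    show "card {b. (a, b) \<in> F'} = r" if a: "a \<in> A" for a
    proof -
      have "{b. (a, b) \<in> F'} = {b. (a, b) \<in> F} - {f a}" using a by (auto simp: F'_def)
      then show ?thesis using degA[OF a] f(2)[OF a] by simp
    qed
    show "card {a. (a, b) \<in> F'} = r" if b: "b \<in> B" for b
    proof -
      obtain a where a: "a \<in> A" "f a = b" using b fB by auto
      have "{a. (a, b) \<in> F'} = {a. (a, b) \<in> F} - {a}"
        using a f(1) by (auto simp: F'_def inj_on_def)
      then show ?thesis using degB[OF b] f(2)[OF a(1)] a by simp
    qed
  qed
  then obtain \<phi> where \<phi>: "\<And>t. t < r \<Longrightarrow> bij_betw (\<phi> t) A B"
      "\<And>t a. t < r \<Longrightarrow> a \<in> A \<Longrightarrow> (a, \<phi> t a) \<in> F'"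
      "\<And>t t' a. t < r \<Longrightarrow> t' < r \<Longrightarrow> a \<in> A \<Longrightarrow> t \<noteq> t' \<Longrightarrow> \<phi> t a \<noteq> \<phi> t' a"
    by blast
  have new: "\<phi> t a \<noteq> f a" if "t < r" "a \<in> A" for t a using \<phi>(2)[OF that] that by (auto simp: F'_def)
  show ?case
  proof (intro exI[of _ "\<phi>(r := f)"] conjI allI impI ballI)
    fix t assume t: "t < Suc r"
    show "bij_betw ((\<phi>(r := f)) t) A B" using t \<phi>(1)[of t] f fB by (auto simp: bij_betw_def)
    show "(a, (\<phi>(r := f)) t a) \<in> F" if "a \<in> A" for a
      using t that \<phi>(2)[of t a] f by (auto simp: F'_def)
    fix t' a assume "t' < Suc r" "a \<in> A" "t \<noteq> t'"
    then show "(\<phi>(r := f)) t a \<noteq> (\<phi>(r := f)) t' a"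
      using t new[of t a] new[of t' a] \<phi>(3)[of t t' a] by (auto simp: less_Suc_eq)
  qed
qed

section \<open>Edge distribution from degrees and codegrees\<close>

text \<open>Cauchy-Schwarz over \<open>T\<close> reduces the claim to the second moment of
  \<open>D b\<close>, the degree of \<open>b\<close> into \<open>S\<close>, around
  \<open>d * card S\<close>. In the expanded square codegrees occur positively and degrees
  negatively, so one-sided bounds are enough; the main terms combine to
  \<open>(1 + c) - 2 * (1 - c) + 1 = 3 * c\<close>.\<close>

lemma edge_discrepancy:
  fixes G :: "('a \<times> 'b) set" and d c :: real
  assumes fin: "finite A" "finite B" and G: "G \<subseteq> A \<times> B" and d: "0 \<le> d"
    and deg: "\<And>a. a \<in> A \<Longrightarrow> (1 - c) * d * card B \<le> real (card {b. (a, b) \<in> G})"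
    and codeg: "\<And>a a'. a \<in> A \<Longrightarrow> a' \<in> A \<Longrightarrow> a \<noteq> a' \<Longrightarrow>
      real (card {b. (a, b) \<in> G \<and> (a', b) \<in> G}) \<le> (1 + c) * d\<^sup>2 * card B"
    and c: "0 \<le> c"
    and S: "S \<subseteq> A" and T: "T \<subseteq> B"
  shows "(d * card S * card T - real (card (G \<inter> S \<times> T)))\<^sup>2
    \<le> card T * (card S * card B + 3 * c * d\<^sup>2 * (card S)\<^sup>2 * card B)"
proof -
  define g :: "'a \<Rightarrow> 'b \<Rightarrow> real" where "g a b = of_bool ((a, b) \<in> G)" for a b
  define D where "D b = (\<Sum>a\<in>S. g a b)" for b
  have finS: "finite S" and finT: "finite T" using S T fin finite_subset by auto
  define N where "N = real (card B)"
  define m where "m = real (card S)"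
  have degD: "real (card {b. (a, b) \<in> G}) = (\<Sum>b\<in>B. g a b)" for a
  proof -
    have "{b. (a, b) \<in> G} = B \<inter> {b. (a, b) \<in> G}" using G by auto
    then show ?thesis using fin by (simp add: g_def of_bool_def sum.If_cases)
  qed
  have codegD: "real (card {b. (a, b) \<in> G \<and> (a', b) \<in> G}) = (\<Sum>b\<in>B. g a b * g a' b)" for a a'
  proof -
    have "{b. (a, b) \<in> G \<and> (a', b) \<in> G} = B \<inter> {b. (a, b) \<in> G \<and> (a', b) \<in> G}" using G by auto
    moreover have "(\<Sum>b\<in>B. g a b * g a' b) = (\<Sum>b\<in>B. if (a, b) \<in> G \<and> (a', b) \<in> G then 1 else 0)"
      by (intro sum.cong) (auto simp: g_def)
    ultimately show ?thesis using fin by (simp add: sum.If_cases)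
  qed
  have e: "real (card (G \<inter> S \<times> T)) = (\<Sum>b\<in>T. D b)"
  proof -
    have "(\<Sum>b\<in>T. D b) = (\<Sum>a\<in>S. \<Sum>b\<in>T. g a b)" unfolding D_def by (rule sum.swap)
    also have "\<dots> = (\<Sum>z\<in>S \<times> T. if z \<in> G then 1 else 0)"
      by (simp add: sum.cartesian_product g_def of_bool_def case_prod_beta)
    also have "\<dots> = real (card (G \<inter> S \<times> T))" using finS finT by (simp add: sum.If_cases Int_commute)
    finally show ?thesis by simp
  qed
  have sumD: "(\<Sum>b\<in>B. D b) \<ge> m * ((1 - c) * d * N)"
  proof -
    have "(\<Sum>b\<in>B. D b) = (\<Sum>a\<in>S. \<Sum>b\<in>B. g a b)" unfolding D_def by (rule sum.swap)
    also have "\<dots> \<ge> (\<Sum>a\<in>S. (1 - c) * d * N)"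
      using deg S by (intro sum_mono) (auto simp: degD[symmetric] N_def)
    finally show ?thesis by (simp add: m_def)
  qed
  have sumD2: "(\<Sum>b\<in>B. (D b)\<^sup>2) \<le> m * N + m\<^sup>2 * ((1 + c) * d\<^sup>2 * N)"
  proof -
    have "(\<Sum>b\<in>B. (D b)\<^sup>2) = (\<Sum>b\<in>B. \<Sum>a\<in>S. \<Sum>a'\<in>S. g a b * g a' b)"
      by (simp add: D_def power2_eq_square sum_product)
    also have "\<dots> = (\<Sum>a\<in>S. \<Sum>a'\<in>S. \<Sum>b\<in>B. g a b * g a' b)"
      by (subst sum.swap) (intro sum.cong refl sum.swap)
    \<comment> \<open>Diagonal pairs are bounded trivially by \<open>N\<close>. Giving them the
      codegree term as well only enlarges the bound and keeps the summation uniform.\<close>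
    also have "\<dots> \<le> (\<Sum>a\<in>S. \<Sum>a'\<in>S. (if a' = a then N else 0) + (1 + c) * d\<^sup>2 * N)"
    proof (intro sum_mono)
      fix a a' assume a: "a \<in> S" "a' \<in> S"
      show "(\<Sum>b\<in>B. g a b * g a' b) \<le> (if a' = a then N else 0) + (1 + c) * d\<^sup>2 * N"
      proof (cases "a' = a")
        case True
        have "(\<Sum>b\<in>B. g a b * g a' b) \<le> (\<Sum>b\<in>B. 1)" by (intro sum_mono) (auto simp: g_def)
        moreover have "0 \<le> (1 + c) * d\<^sup>2 * N" using c by (simp add: N_def)
        ultimately show ?thesis using True by (simp add: N_def)
      next
        case False
        then show ?thesis using codeg[of a a'] a S by (auto simp: codegD N_def)
      qed
    qed
    also have "\<dots> = m * N + m\<^sup>2 * ((1 + c) * d\<^sup>2 * N)"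
      using finS by (simp add: sum.distrib m_def power2_eq_square algebra_simps)
    finally show ?thesis .
  qed
  have "(\<Sum>b\<in>T. D b - d * m)\<^sup>2 \<le> (\<Sum>b\<in>T. (D b - d * m)\<^sup>2) * card T"
    by (rule sum_squared_le_sum_of_squares)
  also have "(\<Sum>b\<in>T. (D b - d * m)\<^sup>2) \<le> (\<Sum>b\<in>B. (D b - d * m)\<^sup>2)"
    using fin T by (intro sum_mono2) auto
  also have "\<dots> = (\<Sum>b\<in>B. (D b)\<^sup>2 - 2 * (d * m) * D b + (d * m)\<^sup>2)"
    by (intro sum.cong) (auto simp: power2_diff)
  also have "\<dots> = (\<Sum>b\<in>B. (D b)\<^sup>2) - 2 * (d * m) * (\<Sum>b\<in>B. D b) + N * (d * m)\<^sup>2"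
    by (simp only: sum.distrib sum_subtractf sum_distrib_left[symmetric] sum_constant N_def)
  also have "\<dots> \<le> m * N + m\<^sup>2 * ((1 + c) * d\<^sup>2 * N) - 2 * (d * m) * (m * ((1 - c) * d * N)) + N * (d * m)\<^sup>2"
    using sumD2 sumD d by (intro add_right_mono diff_mono mult_left_mono) (auto simp: m_def)
  also have "\<dots> = m * N + 3 * c * d\<^sup>2 * m\<^sup>2 * N"
    by (simp add: algebra_simps power2_eq_square)
  finally have "(\<Sum>b\<in>T. D b - d * m)\<^sup>2 \<le> (m * N + 3 * c * d\<^sup>2 * m\<^sup>2 * N) * card T"
    by (simp add: mult_right_mono)
  moreover have "(\<Sum>b\<in>T. D b - d * m)\<^sup>2 = (d * m * card T - real (card (G \<inter> S \<times> T)))\<^sup>2"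
    by (simp add: sum_subtractf e power2_commute algebra_simps)
  ultimately show ?thesis by (simp add: m_def N_def mult.commute)
qed

text \<open>Pairs with \<open>|S| + |T| \<ge> N\<close> have a side of size at least \<open>N/2\<close>; this is what makes the
  constant 1.9 (below the 2 of the theorem) sufficient.\<close>

lemma pseudorandom_pair_edges:
  fixes G :: "('a \<times> 'b) set" and d x :: real
  assumes fin: "finite A" "finite B" and AB: "card A = card B" and G: "G \<subseteq> A \<times> B" and d: "0 < d"
    and x: "0 < x" "x \<le> 1 / 2"
    and deg: "\<And>a. a \<in> A \<Longrightarrow> (1 - 26/25 * x ^ 3) * d * card B \<le> real (card {b. (a, b) \<in> G})"
    and codeg: "\<And>a a'. a \<in> A \<Longrightarrow> a' \<in> A \<Longrightarrow> a \<noteq> a' \<Longrightarrow>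
      real (card {b. (a, b) \<in> G \<and> (a', b) \<in> G}) \<le> (1 + 26/25 * x ^ 3) * d\<^sup>2 * card B"
    and large: "100 \<le> x ^ 4 * d ^ 3 * card B"
    and S: "S \<subseteq> A" and T: "T \<subseteq> B" and ST: "card S \<le> card T" "card B \<le> card S + card T"
    and r: "0 \<le> r" "r \<le> (1 - 19/10 * x) * d * card B"
  shows "r * (real (card S) + card T - card B) \<le> card (G \<inter> S \<times> T)"
proof -
  define m t N e where "m = real (card S)" and "t = real (card T)" and "N = real (card B)"
    and "e = real (card (G \<inter> S \<times> T))"
  have finS: "finite S" and finT: "finite T" using S T fin finite_subset by auto
  have mN: "m \<le> N" using S fin AB card_mono by (metis m_def N_def of_nat_le_iff)
  have tN: "t \<le> N" using T fin card_mono by (metis t_def N_def of_nat_le_iff)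
  have m0: "0 \<le> m" by (simp add: m_def)
  have mt: "m \<le> t" "N \<le> m + t" using ST unfolding m_def t_def N_def by linarith+
  have N0: "0 < N" using large x d by (cases "card B = 0") (auto simp: N_def)
  have x3: "x ^ 3 \<le> x / 4"
  proof -
    have "x ^ 3 = x * (x * x)" by (simp add: power3_eq_cube)
    also have "\<dots> \<le> x * (1/2 * (1/2))" using x by (intro mult_left_mono mult_mono) auto
    finally show ?thesis by simp
  qed
  show ?thesis
  \<comment> \<open>The threshold makes the diagonal contribution \<open>m * N\<close> at most one
    hundredth of \<open>x^3 * d^2 * m^2 * N\<close>; with \<open>3 * 26/25\<close> this gives
    313/100. Smaller \<open>S\<close> are treated by degrees alone.\<close>
  proof (cases "100 \<le> x ^ 3 * d\<^sup>2 * m")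
    case True
    have mpos: "0 < m" using True x d m0 by (cases "m = 0") auto
    have tpos: "0 < t" using mpos mt by simp
    have "(d * m * t - e)\<^sup>2 \<le> t * (m * N + 3 * (26/25 * x ^ 3) * d\<^sup>2 * m\<^sup>2 * N)"
      using edge_discrepancy[OF fin G _ deg codeg _ S T] d x
      by (simp add: m_def t_def N_def e_def)
    also have "m * N \<le> m * N * (x ^ 3 * d\<^sup>2 * m / 100)"
      using mult_left_mono[of 1 "x ^ 3 * d\<^sup>2 * m / 100" "m * N"] True m0 N0 by simp
    also have "m * N * (x ^ 3 * d\<^sup>2 * m / 100) + 3 * (26/25 * x ^ 3) * d\<^sup>2 * m\<^sup>2 * N
      = (313/100) * x ^ 3 * d\<^sup>2 * m\<^sup>2 * N" by (simp add: power2_eq_square)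
    finally have *: "(d * m * t - e)\<^sup>2 \<le> t * ((313/100) * x ^ 3 * d\<^sup>2 * m\<^sup>2 * N)"
      using tpos by (simp add: mult_left_mono)
    \<comment> \<open>Here \<open>x^3 \<le> x^2 / 2\<close> and \<open>N \<le> 2 * t\<close> cancel
      each other's factor 2, and 3.13 stays below the square 3.61 of 1.9.\<close>
    have "t * ((313/100) * x ^ 3 * d\<^sup>2 * m\<^sup>2 * N) \<le> t * ((313/100) * (x\<^sup>2 * (1/2)) * d\<^sup>2 * m\<^sup>2 * (2 * t))"
      using x mt tpos N0
      by (intro mult_left_mono mult_mono) (auto simp: power3_eq_cube power2_eq_square)
    also have "\<dots> = (313/100) * (x * d * m * t)\<^sup>2" by (simp add: power2_eq_square)
    also have "\<dots> \<le> (19/10)\<^sup>2 * (x * d * m * t)\<^sup>2" by (intro mult_right_mono) (auto simp: power2_eq_square)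
    also have "\<dots> = (19/10 * (x * d * m * t))\<^sup>2" by (simp only: power_mult_distrib)
    finally have "(d * m * t - e)\<^sup>2 \<le> (19/10 * (x * d * m * t))\<^sup>2" using * by (rule order_trans[rotated])
    moreover have "0 \<le> 19/10 * (x * d * m * t)" using x d m0 tpos by simp
    ultimately have "d * m * t - e \<le> 19/10 * (x * d * m * t)" by (rule power2_le_imp_le)
    then have e: "(1 - 19/10 * x) * d * (m * t) \<le> e" by (simp add: algebra_simps)
    have "r * (m + t - N) \<le> (1 - 19/10 * x) * d * N * (m + t - N)"
      using r mt by (intro mult_right_mono) (auto simp: N_def)
    also have "\<dots> = (1 - 19/10 * x) * d * (N * (m + t - N))" by simp
    \<comment> \<open>The difference of the two products is
      \<open>(N - m) * (N - t)\<close>.\<close>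
    also have "\<dots> \<le> (1 - 19/10 * x) * d * (m * t)"
    proof (intro mult_left_mono)
      have "0 \<le> (N - m) * (N - t)" using mN tN by simp
      then show "N * (m + t - N) \<le> m * t" by (simp add: algebra_simps)
      show "0 \<le> (1 - 19/10 * x) * d" using x d by simp
    qed
    finally show ?thesis using e by (simp add: m_def t_def N_def e_def)
  next
    case False
    \<comment> \<open>If \<open>S\<close> is this small, \<open>T\<close> misses at most
      \<open>x * d * N\<close> vertices of \<open>B\<close>, so each vertex of \<open>S\<close> on
      its own sends \<open>r\<close> edges into \<open>T\<close>. The loss is at most
      \<open>0.26 * x + x\<close>, since \<open>26/25 * x^3 \<le> 0.26 * x\<close>.\<close>
    have small: "m \<le> x * d * N / 1"
    proof -
      have "x ^ 3 * d\<^sup>2 * m \<le> x ^ 3 * d\<^sup>2 * (x * d * N)"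
        using False large by (simp add: N_def power2_eq_square power3_eq_cube power4_eq_xxxx algebra_simps)
      then show ?thesis using x d by simp
    qed
    have "real (card ({b. (a, b) \<in> G} \<inter> T)) \<ge> r" if "a \<in> S" for a
    proof -
      have sub: "{b. (a, b) \<in> G} \<subseteq> ({b. (a, b) \<in> G} \<inter> T) \<union> (B - T)" using G by auto
      have "card {b. (a, b) \<in> G} \<le> card (({b. (a, b) \<in> G} \<inter> T) \<union> (B - T))"
        using fin finT by (intro card_mono sub) auto
      also have "\<dots> \<le> card ({b. (a, b) \<in> G} \<inter> T) + card (B - T)" by (rule card_Un_le)
      also have "card (B - T) = card B - card T" using T finT by (simp add: card_Diff_subset)
      finally have "real (card {b. (a, b) \<in> G}) \<le> card ({b. (a, b) \<in> G} \<inter> T) + (N - t)"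
        using tN unfolding N_def t_def by linarith
      moreover have "(1 - 26/25 * x ^ 3) * d * N \<le> real (card {b. (a, b) \<in> G})"
        using deg that S by (auto simp: N_def)
      moreover have "N - t \<le> x * d * N" using small mt by simp
      moreover have "r \<le> (1 - 26/25 * x ^ 3) * d * N - x * d * N"
      proof -
        have "(1 - 19/10 * x) * (d * N) \<le> (1 - 26/25 * x ^ 3 - x) * (d * N)"
          using x3 x d N0 by (intro mult_right_mono) auto
        then show ?thesis using r by (simp add: N_def algebra_simps)
      qed
      ultimately show ?thesis by linarith
    qed
    then have "(\<Sum>a\<in>S. r) \<le> (\<Sum>a\<in>S. real (card ({b. (a, b) \<in> G} \<inter> T)))" by (intro sum_mono) auto
    also have "\<dots> = real (card (SIGMA a:S. {b. (a, b) \<in> G} \<inter> T))"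
      using finS finT by (subst card_SigmaI) auto
    also have "(SIGMA a:S. {b. (a, b) \<in> G} \<inter> T) = G \<inter> S \<times> T" by auto
    finally have "r * m \<le> e" by (simp add: m_def e_def mult.commute)
    moreover have "r * (m + t - N) \<le> r * m" using r tN by (intro mult_left_mono) auto
    ultimately show ?thesis by (simp add: m_def t_def N_def e_def)
  qed
qed

text \<open>Both sides are controlled because the discrepancy bound sums over the smaller of the two
  sets, which may lie on either side.\<close>

definition degree_bounds :: "nat \<Rightarrow> real \<Rightarrow> real \<Rightarrow> (nat \<times> nat) set \<Rightarrow> bool" where
  "degree_bounds N c C G \<longleftrightarrow>
    (\<forall>i<N. c \<le> real (card {j. (i, j) \<in> G})) \<and>
    (\<forall>j<N. c \<le> real (card {i. (i, j) \<in> G})) \<and>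
    (\<forall>i<N. \<forall>i'<N. i \<noteq> i' \<longrightarrow> real (card {j. (i, j) \<in> G \<and> (i', j) \<in> G}) \<le> C) \<and>
    (\<forall>j<N. \<forall>j'<N. j \<noteq> j' \<longrightarrow> real (card {i. (i, j) \<in> G \<and> (i, j') \<in> G}) \<le> C)"

lemma degree_bounds_mono:
  "degree_bounds N c C G \<Longrightarrow> c' \<le> c \<Longrightarrow> C \<le> C' \<Longrightarrow> degree_bounds N c' C' G"
  unfolding degree_bounds_def by (meson order_trans)

lemma pseudorandom_perfect_matchings:
  fixes G :: "(nat \<times> nat) set" and d x :: real and N r :: nat
  assumes G: "G \<subseteq> {..<N} \<times> {..<N}" and d: "0 < d" and x: "0 < x" "x \<le> 1 / 2"
    and bounds: "degree_bounds N ((1 - 26/25 * x ^ 3) * d * N) ((1 + 26/25 * x ^ 3) * d\<^sup>2 * N) G"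
    and large: "100 \<le> x ^ 4 * d ^ 3 * N"
    and r: "real r \<le> (1 - 19/10 * x) * d * N"
  shows "\<exists>\<phi>. (\<forall>t<r. bij_betw (\<phi> t) {..<N} {..<N} \<and> (\<forall>i<N. (i, \<phi> t i) \<in> G)) \<and>
     (\<forall>t<r. \<forall>t'<r. \<forall>i<N. t \<noteq> t' \<longrightarrow> \<phi> t i \<noteq> \<phi> t' i)"
proof -
  have degL: "(1 - 26/25 * x ^ 3) * d * N \<le> real (card {j. (i, j) \<in> G})"
    and degR: "(1 - 26/25 * x ^ 3) * d * N \<le> real (card {j. (j, i) \<in> G})" if "i < N" for i
    using bounds that by (auto simp: degree_bounds_def)
  have codegL: "real (card {j. (i, j) \<in> G \<and> (i', j) \<in> G}) \<le> (1 + 26/25 * x ^ 3) * d\<^sup>2 * N"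
    and codegR: "real (card {j. (j, i) \<in> G \<and> (j, i') \<in> G}) \<le> (1 + 26/25 * x ^ 3) * d\<^sup>2 * N"
    if "i < N" "i' < N" "i \<noteq> i'" for i i'
    using bounds that by (auto simp: degree_bounds_def)
  have "\<exists>F\<subseteq>G. (\<forall>a\<in>{..<N}. card {b. (a, b) \<in> F} = r) \<and> (\<forall>b\<in>{..<N}. card {a. (a, b) \<in> F} = r)"
  proof (rule bipartite_factor_exists)
    show "r * (card S + card T) \<le> card (G \<inter> S \<times> T) + r * card {..<N}"
      if S: "S \<subseteq> {..<N}" and T: "T \<subseteq> {..<N}" for S T
    proof (cases "N \<le> card S + card T")
      case False
      then have "r * (card S + card T) \<le> r * N" by (intro mult_left_mono) auto
      then show ?thesis by (simp only: card_lessThan)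
    next
      case True
      have "real r * (real (card S) + card T - N) \<le> card (G \<inter> S \<times> T)"
      proof (cases "card S \<le> card T")
        case le: True
        show ?thesis
          using pseudorandom_pair_edges[OF _ _ _ G d x _ _ _ S T le _ _ , of "real r"] degL codegL large r True
          by simp
      next
        case False
        \<comment> \<open>The larger set lies on the left, so the pair estimate is applied to the
          transposed graph.\<close>
        have "G\<inverse> \<subseteq> {..<N} \<times> {..<N}" using G by auto
        then have "real r * (real (card T) + card S - N) \<le> card (G\<inverse> \<inter> T \<times> S)"
          using pseudorandom_pair_edges[of "{..<N}" "{..<N}" "G\<inverse>" d x T S "real r"]
            degR codegR large r True False S T d x
          by auto
        moreover have "card (G\<inverse> \<inter> T \<times> S) = card (G \<inter> S \<times> T)"
          by (rule bij_betw_same_card[of prod.swap]) (force simp: bij_betw_def inj_on_def image_iff)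
        ultimately show ?thesis by (simp add: add.commute)
      qed
      then have "real (r * (card S + card T)) \<le> real (card (G \<inter> S \<times> T) + r * N)"
        by (simp add: algebra_simps)
      then show ?thesis by (simp only: of_nat_le_iff card_lessThan)
    qed
  qed (use G in auto)
  then obtain F where F: "F \<subseteq> G" "\<And>a. a \<in> {..<N} \<Longrightarrow> card {b. (a, b) \<in> F} = r"
    "\<And>b. b \<in> {..<N} \<Longrightarrow> card {a. (a, b) \<in> F} = r" by blast
  have "F \<subseteq> {..<N} \<times> {..<N}" using F G by blast
  from regular_bipartite_perfect_matchings[OF _ _ _ this F(2) F(3)]
  obtain \<phi> where "(\<forall>t<r. bij_betw (\<phi> t) {..<N} {..<N} \<and> (\<forall>a\<in>{..<N}. (a, \<phi> t a) \<in> F)) \<and>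
     (\<forall>t<r. \<forall>t'<r. \<forall>a\<in>{..<N}. t \<noteq> t' \<longrightarrow> \<phi> t a \<noteq> \<phi> t' a)" by auto
  then show ?thesis using F(1) by (intro exI[of _ \<phi>]) auto
qed

section \<open>Concentration on finite product and permutation spaces\<close>

text \<open>Summed over values with mean zero, the linear term vanishes and a sub-Gaussian bound
  remains. This replaces the convexity argument in Hoeffding's lemma, at the price of a worse
  constant.\<close>

lemma exp_le_self_plus_exp_square: "exp y \<le> y + exp (y\<^sup>2)" for y :: real
proof -
  have sq: "1 + y\<^sup>2 \<le> exp (y\<^sup>2)" by (rule exp_ge_add_one_self)
  consider "y < - 1" | "- 1 \<le> y" "y < 0" | "0 \<le> y" "y \<le> 1" | "1 < y" by linarith
  then show ?thesis
  proof cases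
    case 1
    then have "- y \<le> y\<^sup>2" using mult_left_mono_neg[of y "-1" y] by (simp add: power2_eq_square)
    moreover have "exp y \<le> 1" using 1 by simp
    ultimately show ?thesis using sq by linarith
  next
    case 2
    define u where "u = - y"
    have u: "0 \<le> u" using 2 by (simp add: u_def)
    \<comment> \<open>The product equals \<open>1 + u^3\<close>.\<close>
    have "1 \<le> (1 - u + u\<^sup>2) * (1 + u)"
      using u zero_le_power[of u 3] by (simp add: algebra_simps power2_eq_square power3_eq_cube)
    also have "\<dots> \<le> (1 - u + u\<^sup>2) * exp u"
    proof (rule mult_left_mono)
      show "1 + u \<le> exp u" by (rule exp_ge_add_one_self)
      show "0 \<le> 1 - u + u\<^sup>2" using 2 by (simp add: u_def)
    qed
    finally have "exp y \<le> 1 - u + u\<^sup>2" by (simp add: u_def exp_minus field_simps)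
    then have "exp y \<le> 1 + y + y\<^sup>2" by (simp add: u_def)
    then show ?thesis using sq by linarith
  next
    case 3
    then have "exp y \<le> 1 + y + y\<^sup>2" by (rule exp_bound)
    then show ?thesis using sq by linarith
  next
    case 4
    then have "exp y \<le> exp (y\<^sup>2)" by (simp add: power2_eq_square)
    then show ?thesis using 4 by linarith
  qed
qed

text \<open>One martingale step, shared by the permutation and the product space: \<open>i\<close>
  is the value revealed first and \<open>p\<close> the remaining randomness. Conditional means that
  differ pairwise by at most \<open>c\<close> lie within \<open>c\<close> of the overall mean, so
  revealing \<open>i\<close> costs one factor
  \<open>exp (\<theta>\<^sup>2 * c\<^sup>2)\<close>.\<close>

lemma mgf_step:
  fixes F :: "'i \<Rightarrow> 'p \<Rightarrow> real" and \<theta> c K :: real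
  assumes I: "finite I" "I \<noteq> {}" and P: "finite P" "P \<noteq> {}"
    and m: "\<And>i. i \<in> I \<Longrightarrow> m i = (\<Sum>p\<in>P. F i p) / card P"
    and mu: "\<mu> = (\<Sum>i\<in>I. \<Sum>p\<in>P. F i p) / (card I * card P)"
    and close: "\<And>i i'. i \<in> I \<Longrightarrow> i' \<in> I \<Longrightarrow> m i - m i' \<le> c"
    and K: "\<And>i. i \<in> I \<Longrightarrow> (\<Sum>p\<in>P. exp (\<theta> * (F i p - m i))) \<le> card P * K"
    and K0: "0 \<le> K"
  shows "(\<Sum>i\<in>I. \<Sum>p\<in>P. exp (\<theta> * (F i p - \<mu>))) \<le> card I * card P * (K * exp (\<theta>\<^sup>2 * c\<^sup>2))"
proof -
  have cI: "0 < real (card I)" and cP: "0 < real (card P)" using I P by (auto simp: card_gt_0_iff)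
  have mu': "\<mu> = (\<Sum>i\<in>I. m i) / card I"
    using m cP by (simp add: mu sum_divide_distrib[symmetric])
  have dev: "\<bar>m i - \<mu>\<bar> \<le> c" if i: "i \<in> I" for i
  proof -
    have e: "m i - \<mu> = (\<Sum>i'\<in>I. m i - m i') / card I"
      using cI by (simp add: mu' sum_subtractf field_simps)
    have "(\<Sum>i'\<in>I. m i - m i') \<le> (\<Sum>i'\<in>I. c)" using close i by (intro sum_mono) auto
    moreover have "(\<Sum>i'\<in>I. - c) \<le> (\<Sum>i'\<in>I. m i - m i')"
    proof (intro sum_mono)
      fix i' assume "i' \<in> I"
      then show "- c \<le> m i - m i'" using close[of i' i] i by linarith
    qed
    ultimately show ?thesis using cI by (simp add: e abs_le_iff field_simps)
  qed
  define y where "y i = \<theta> * (m i - \<mu>)" for i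
  have "(\<Sum>i\<in>I. y i) = 0"
    using cI by (simp add: y_def sum_distrib_left[symmetric] sum_subtractf mu')
  then have "(\<Sum>i\<in>I. exp (y i)) \<le> (\<Sum>i\<in>I. exp ((y i)\<^sup>2))"
    using sum_mono[of I "\<lambda>i. exp (y i)" "\<lambda>i. y i + exp ((y i)\<^sup>2)"] exp_le_self_plus_exp_square
    by (simp add: sum.distrib)
  also have "\<dots> \<le> (\<Sum>i\<in>I. exp (\<theta>\<^sup>2 * c\<^sup>2))"
  proof (intro sum_mono)
    fix i assume "i \<in> I"
    then have "(m i - \<mu>)\<^sup>2 \<le> c\<^sup>2" using dev abs_le_square_iff by fastforce
    then show "exp ((y i)\<^sup>2) \<le> exp (\<theta>\<^sup>2 * c\<^sup>2)"
      by (simp add: y_def power_mult_distrib mult_left_mono)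
  qed
  finally have ey: "(\<Sum>i\<in>I. exp (y i)) \<le> card I * exp (\<theta>\<^sup>2 * c\<^sup>2)" by simp
  have "(\<Sum>i\<in>I. \<Sum>p\<in>P. exp (\<theta> * (F i p - \<mu>)))
    = (\<Sum>i\<in>I. exp (y i) * (\<Sum>p\<in>P. exp (\<theta> * (F i p - m i))))"
    by (simp add: y_def sum_distrib_left exp_add[symmetric] algebra_simps)
  also have "\<dots> \<le> (\<Sum>i\<in>I. exp (y i) * (card P * K))"
    using K by (intro sum_mono mult_left_mono) auto
  also have "\<dots> = (\<Sum>i\<in>I. exp (y i)) * (card P * K)" by (simp add: sum_distrib_right)
  also have "\<dots> \<le> card I * exp (\<theta>\<^sup>2 * c\<^sup>2) * (card P * K)"
    using ey K0 by (intro mult_right_mono) auto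
  finally show ?thesis by (simp add: algebra_simps)
qed

text \<open>The martingale reveals the image \<open>b\<close> of a new point \<open>a\<close> by
  writing a permutation as \<open>transpose a b \<circ> q\<close>. The conditional means for
  \<open>b\<close> and \<open>b'\<close> are compared by a coupling under which the two permutations
  differ by one transposition.\<close>

lemma permutation_mgf:
  fixes f :: "('a \<Rightarrow> 'a) \<Rightarrow> real" and c \<theta> :: real
  assumes "finite W" and c: "0 \<le> c"
    and "\<And>p v w. p permutes W \<Longrightarrow> v \<in> W \<Longrightarrow> w \<in> W \<Longrightarrow> \<bar>f (p \<circ> transpose v w) - f p\<bar> \<le> c"
  shows "(\<Sum>p | p permutes W. exp (\<theta> * (f p - (\<Sum>p | p permutes W. f p) / fact (card W))))
    \<le> fact (card W) * exp (\<theta>\<^sup>2 * (card W * c\<^sup>2))"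
  using assms(1,3)
proof (induction W arbitrary: f rule: finite_induct)
  case empty
  then show ?case by simp
next
  case (insert a W)
  let ?P = "{p. p permutes W}"
  let ?I = "insert a W"
  define F where "F b q = f (transpose a b \<circ> q)" for b q
  define m where "m b = (\<Sum>q\<in>?P. F b q) / card ?P" for b
  have cP: "card ?P = fact (card W)" using insert.hyps by (simp add: card_permutations)
  have P: "finite ?P" "?P \<noteq> {}"
    using insert.hyps permutes_id[where S = W] by (auto simp: finite_permutations simp del: permutes_id)
  have perm: "transpose a b \<circ> q permutes ?I" if "b \<in> ?I" "q permutes W" for b q
    using that permutes_subset[of q W ?I] by (intro permutes_compose permutes_swap_id) auto
  have left: "\<bar>f (transpose v w \<circ> p) - f p\<bar> \<le> c" if "p permutes ?I" "v \<in> ?I" "w \<in> ?I" for p v w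
  proof -
    \<comment> \<open>The coupling changes values while the hypothesis exchanges arguments;
      conjugation by \<open>p\<close> translates one into the other.\<close>
    have "transpose v w \<circ> p = p \<circ> transpose (inv p v) (inv p w)"
      using that(1) by (intro transpose_comp_eq) (rule permutes_bij)
    moreover have "inv p v \<in> ?I" "inv p w \<in> ?I"
      using that permutes_inv[OF that(1)] by (auto simp only: permutes_in_image)
    ultimately show ?thesis using insert.prems[OF that(1)] by metis
  qed
  have "(\<Sum>b\<in>?I. \<Sum>q\<in>?P. exp (\<theta> * (F b q - (\<Sum>b\<in>?I. \<Sum>q\<in>?P. F b q) / (card ?I * card ?P))))
    \<le> card ?I * card ?P * (exp (\<theta>\<^sup>2 * (card W * c\<^sup>2)) * exp (\<theta>\<^sup>2 * c\<^sup>2))"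
  proof (rule mgf_step[OF _ _ P m_def refl])
    show "finite ?I" "?I \<noteq> {}" using insert.hyps by auto
    show "m b' - m b \<le> c" if b: "b' \<in> ?I" "b \<in> ?I" for b' b
    proof -
      have "(\<Sum>q\<in>?P. F b' q) \<le> (\<Sum>q\<in>?P. F b q + c)"
      proof -
        consider "b = b'" | "b = a" | "b' = a" | "b \<noteq> b'" "b \<noteq> a" "b' \<noteq> a" by blast
        then show ?thesis
        proof cases
          case 1
          then show ?thesis using c by (intro sum_mono) auto
        next
          case 2
          show ?thesis
          proof (intro sum_mono)
            fix q assume "q \<in> ?P"
            then show "F b' q \<le> F b q + c"
              using left[of "transpose a b \<circ> q" a b'] perm[of b q] 2 b by (auto simp: F_def)
          qed
        next
          case 3
          show ?thesis
          proof (intro sum_mono)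
            fix q assume q: "q \<in> ?P"
            have "transpose a b \<circ> (transpose a b \<circ> q) = transpose a b' \<circ> q"
              using 3 by (simp add: o_assoc)
            then show "F b' q \<le> F b q + c"
              using left[of "transpose a b \<circ> q" a b] perm[of b q] b q by (auto simp: F_def)
          qed
        next
          case 4
          \<comment> \<open>When neither \<open>b\<close> nor \<open>b'\<close> is \<open>a\<close>,
            \<open>q\<close> is matched with \<open>transpose b b' \<circ> q\<close>; this gives
            \<open>transpose a b' \<circ> (transpose b b' \<circ> q) = transpose b b' \<circ>
            (transpose a b \<circ> q)\<close>.\<close>
          have bW: "transpose b b' permutes W" using b 4 by (intro permutes_swap_id) auto
          have "(\<Sum>q\<in>?P. F b' q) = (\<Sum>q\<in>?P. F b' (transpose b b' \<circ> q))"
            by (rule sum.reindex_bij_witness[of _ "\<lambda>q. transpose b b' \<circ> q" "\<lambda>q. transpose b b' \<circ> q"])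
               (auto simp: o_assoc intro: permutes_compose[OF _ bW])
          also have "\<dots> \<le> (\<Sum>q\<in>?P. F b q + c)"
          proof (intro sum_mono)
            fix q assume q: "q \<in> ?P"
            have "transpose a b' \<circ> transpose b b' = transpose b b' \<circ> transpose a b"
              using 4 by (auto simp: fun_eq_iff transpose_def)
            then have "transpose a b' \<circ> (transpose b b' \<circ> q) = transpose b b' \<circ> (transpose a b \<circ> q)"
              by (simp add: o_assoc)
            then show "F b' (transpose b b' \<circ> q) \<le> F b q + c"
              using left[of "transpose a b \<circ> q" b b'] perm[of b q] b q by (auto simp: F_def)
          qed
          finally show ?thesis .
        qed
      qed
      then show ?thesis using P by (simp add: m_def sum.distrib field_simps card_gt_0_iff)
    qed
    show "(\<Sum>q\<in>?P. exp (\<theta> * (F b q - m b))) \<le> card ?P * exp (\<theta>\<^sup>2 * (card W * c\<^sup>2))" if b: "b \<in> ?I" for b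
    proof -
      have "(\<Sum>q\<in>?P. exp (\<theta> * (F b q - (\<Sum>q\<in>?P. F b q) / fact (card W))))
        \<le> fact (card W) * exp (\<theta>\<^sup>2 * (card W * c\<^sup>2))"
      proof (rule insert.IH)
        fix q v w assume "q permutes W" "v \<in> W" "w \<in> W"
        then show "\<bar>F b (q \<circ> transpose v w) - F b q\<bar> \<le> c"
          using insert.prems[OF perm[OF b], of q v w] unfolding F_def o_assoc by blast
      qed
      then show ?thesis by (simp add: m_def cP)
    qed
  qed simp
  moreover have "(\<Sum>p | p permutes ?I. g p) = (\<Sum>b\<in>?I. \<Sum>q\<in>?P. g (transpose a b \<circ> q))"
    for g :: "('a \<Rightarrow> 'a) \<Rightarrow> real"
    by (rule sum_over_permutations_insert[OF insert.hyps])
  moreover have "real (card ?I * card ?P) = fact (card ?I)" using insert.hyps by (simp add: cP algebra_simps)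
  moreover have "exp (\<theta>\<^sup>2 * (card W * c\<^sup>2)) * exp (\<theta>\<^sup>2 * c\<^sup>2) = exp (\<theta>\<^sup>2 * (card ?I * c\<^sup>2))"
    using insert.hyps by (simp add: exp_add[symmetric] algebra_simps)
  ultimately show ?case by (simp only: F_def)
qed

lemma sum_PiE_insert:
  assumes "x \<notin> A"
  shows "(\<Sum>h\<in>PiE (insert x A) (\<lambda>_. K). g h) = (\<Sum>v\<in>K. \<Sum>h\<in>PiE A (\<lambda>_. K). g (h(x := v)))"
proof -
  have "(\<Sum>h\<in>PiE (insert x A) (\<lambda>_. K). g h)
    = (\<Sum>(v, h)\<in>K \<times> PiE A (\<lambda>_. K). g (h(x := v)))"
    unfolding PiE_insert_eq
    by (subst sum.reindex[OF inj_combinator[OF assms]]) (simp add: case_prod_beta o_def)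
  then show ?thesis by (simp add: sum.cartesian_product)
qed

text \<open>A separate constant \<open>C x\<close> for each coordinate is essential: a colouring has
  one coordinate per hyperedge, but only linearly many in \<open>N\<close> influence a given degree,
  and the others contribute zero.\<close>

lemma bounded_differences_mgf:
  fixes f :: "('a \<Rightarrow> 'b) \<Rightarrow> real" and C :: "'a \<Rightarrow> real" and \<theta> :: real
  assumes "finite A" and K: "finite K" "K \<noteq> {}"
    and "\<And>h x v. h \<in> PiE A (\<lambda>_. K) \<Longrightarrow> x \<in> A \<Longrightarrow> v \<in> K \<Longrightarrow> \<bar>f (h(x := v)) - f h\<bar> \<le> C x"
  shows "(\<Sum>h\<in>PiE A (\<lambda>_. K). exp (\<theta> * (f h - (\<Sum>h\<in>PiE A (\<lambda>_. K). f h) / card K ^ card A)))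
    \<le> card K ^ card A * exp (\<theta>\<^sup>2 * (\<Sum>x\<in>A. (C x)\<^sup>2))"
  using assms(1,4)
proof (induction A arbitrary: f rule: finite_induct)
  case empty
  then show ?case by simp
next
  case (insert x A)
  let ?P = "PiE A (\<lambda>_. K)"
  define F where "F v h = f (h(x := v))" for v h
  define m where "m v = (\<Sum>h\<in>?P. F v h) / card ?P" for v
  have cP: "card ?P = card K ^ card A" using insert.hyps by (simp add: card_PiE)
  have P: "finite ?P" "?P \<noteq> {}" using insert.hyps K by (auto simp: finite_PiE PiE_eq_empty_iff)
  have upd: "h(x := v) \<in> PiE (insert x A) (\<lambda>_. K)" if "h \<in> ?P" "v \<in> K" for h v
    using that by (auto simp: PiE_insert_eq)
  have "(\<Sum>v\<in>K. \<Sum>h\<in>?P. exp (\<theta> * (F v h - (\<Sum>v\<in>K. \<Sum>h\<in>?P. F v h) / (card K * card ?P))))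
    \<le> card K * card ?P * (exp (\<theta>\<^sup>2 * (\<Sum>x\<in>A. (C x)\<^sup>2)) * exp (\<theta>\<^sup>2 * (C x)\<^sup>2))"
  proof (rule mgf_step[OF K P m_def refl])
    show "m v' - m v \<le> C x" if v: "v' \<in> K" "v \<in> K" for v' v
    proof -
      have "(\<Sum>h\<in>?P. F v' h) \<le> (\<Sum>h\<in>?P. F v h + C x)"
      proof (intro sum_mono)
        fix h assume "h \<in> ?P"
        have "\<bar>f ((h(x := v))(x := v')) - f (h(x := v))\<bar> \<le> C x"
          using insert.prems[OF upd[OF \<open>h \<in> ?P\<close> v(2)], of x v'] v by blast
        then show "F v' h \<le> F v h + C x" unfolding F_def fun_upd_upd by linarith
      qed
      then show ?thesis using P by (simp add: m_def sum.distrib field_simps card_gt_0_iff)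
    qed
    show "(\<Sum>h\<in>?P. exp (\<theta> * (F v h - m v))) \<le> card ?P * exp (\<theta>\<^sup>2 * (\<Sum>x\<in>A. (C x)\<^sup>2))" if v: "v \<in> K" for v
    proof -
      have "(\<Sum>h\<in>?P. exp (\<theta> * (F v h - (\<Sum>h\<in>?P. F v h) / card K ^ card A)))
        \<le> card K ^ card A * exp (\<theta>\<^sup>2 * (\<Sum>x\<in>A. (C x)\<^sup>2))"
      proof (rule insert.IH)
        fix h y u assume h: "h \<in> ?P" "y \<in> A" "u \<in> K"
        then have "(h(y := u))(x := v) = (h(x := v))(y := u)" using insert.hyps by (auto simp: fun_upd_twist)
        then show "\<bar>F v (h(y := u)) - F v h\<bar> \<le> C y"
          using insert.prems[OF upd[OF h(1) v] _ h(3), of y] h(2) unfolding F_def by (simp only: insertI2)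
      qed
      then show ?thesis by (simp add: m_def cP)
    qed
  qed simp
  moreover have "real (card K * card ?P) = real (card K ^ card (insert x A))" using insert.hyps by (simp add: cP algebra_simps)
  moreover have "exp (\<theta>\<^sup>2 * (\<Sum>x\<in>A. (C x)\<^sup>2)) * exp (\<theta>\<^sup>2 * (C x)\<^sup>2) = exp (\<theta>\<^sup>2 * (\<Sum>x\<in>insert x A. (C x)\<^sup>2))"
    using insert.hyps by (simp add: exp_add[symmetric] algebra_simps)
  ultimately show ?case by (simp only: F_def sum_PiE_insert[OF insert.hyps(2)])
qed

lemma subgaussian_tail:
  fixes f :: "'a \<Rightarrow> real" and A s \<mu> :: real
  assumes fin: "finite \<Omega>" and A: "0 < A" and s: "0 \<le> s"
    and mgf: "\<And>\<theta>. (\<Sum>\<omega>\<in>\<Omega>. exp (\<theta> * (f \<omega> - \<mu>))) \<le> M * exp (\<theta>\<^sup>2 * A)"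
  shows "real (card {\<omega> \<in> \<Omega>. \<mu> + s \<le> f \<omega>}) \<le> M * exp (- (s\<^sup>2 / (4 * A)))"
    and "real (card {\<omega> \<in> \<Omega>. f \<omega> \<le> \<mu> - s}) \<le> M * exp (- (s\<^sup>2 / (4 * A)))"
proof -
  \<comment> \<open>The minimiser of \<open>\<theta>\<^sup>2 * A - \<theta> * s\<close>. Its
    negative serves the lower tail, since the moment bound depends on the parameter only through its
    square.\<close>
  define \<theta> where "\<theta> = s / (2 * A)"
  have \<theta>0: "0 \<le> \<theta>" using A s by (simp add: \<theta>_def)
  have ls: "\<theta>\<^sup>2 * A - \<theta> * s = - (s\<^sup>2 / (4 * A))"
    using A by (simp add: \<theta>_def power2_eq_square field_simps)
  have gen: "real (card B) \<le> M * exp (- (s\<^sup>2 / (4 * A)))"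
    if B: "B \<subseteq> \<Omega>" and l: "l\<^sup>2 = \<theta>\<^sup>2" and ge: "\<And>\<omega>. \<omega> \<in> B \<Longrightarrow> \<theta> * s \<le> l * (f \<omega> - \<mu>)" for B l
  proof -
    have "real (card B) * exp (\<theta> * s) = (\<Sum>\<omega>\<in>B. exp (\<theta> * s))" by simp
    also have "\<dots> \<le> (\<Sum>\<omega>\<in>B. exp (l * (f \<omega> - \<mu>)))" using ge by (intro sum_mono) auto
    also have "\<dots> \<le> (\<Sum>\<omega>\<in>\<Omega>. exp (l * (f \<omega> - \<mu>)))" using B fin by (intro sum_mono2) auto
    also have "\<dots> \<le> M * exp (\<theta>\<^sup>2 * A)" using mgf[of l] l by simp
    finally have "real (card B) \<le> M * exp (\<theta>\<^sup>2 * A) / exp (\<theta> * s)" by (simp add: field_simps)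
    then show ?thesis by (simp add: ls[symmetric] exp_diff)
  qed
  show "real (card {\<omega> \<in> \<Omega>. \<mu> + s \<le> f \<omega>}) \<le> M * exp (- (s\<^sup>2 / (4 * A)))"
    by (rule gen[of _ \<theta>]) (use \<theta>0 in \<open>auto intro!: mult_left_mono\<close>)
  show "real (card {\<omega> \<in> \<Omega>. f \<omega> \<le> \<mu> - s}) \<le> M * exp (- (s\<^sup>2 / (4 * A)))"
  proof (rule gen[of _ "- \<theta>"])
    show "\<theta> * s \<le> - \<theta> * (f \<omega> - \<mu>)" if "\<omega> \<in> {\<omega> \<in> \<Omega>. f \<omega> \<le> \<mu> - s}" for \<omega>
      using that \<theta>0 mult_left_mono[of s "\<mu> - f \<omega>" \<theta>] by (auto simp: algebra_simps)
  qed auto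
qed

section \<open>Images of blocks under random permutations\<close>

lemma exists_permutation_image:
  assumes "finite W" "Y \<subseteq> W" "Z \<subseteq> W" "card Y = card Z"
  shows "\<exists>p. p permutes W \<and> p ` Y = Z"
proof -
  have fin: "finite Y" "finite Z" using assms finite_subset by auto
  obtain f where f: "bij_betw f Y Z" using finite_same_card_bij[OF fin assms(4)] by blast
  have "card (W - Y) = card (W - Z)" using assms fin by (simp add: card_Diff_subset)
  then obtain g where g: "bij_betw g (W - Y) (W - Z)"
    using finite_same_card_bij[of "W - Y" "W - Z"] assms by auto
  define p where "p x = (if x \<in> Y then f x else if x \<in> W then g x else x)" for x
  have "bij_betw p Y Z" using f by (rule bij_betw_cong[THEN iffD1, rotated]) (simp add: p_def)
  moreover have "bij_betw p (W - Y) (W - Z)"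
    using g by (rule bij_betw_cong[THEN iffD1, rotated]) (simp add: p_def)
  ultimately have "bij_betw p (Y \<union> (W - Y)) (Z \<union> (W - Z))" by (rule bij_betw_combine) auto
  moreover have "Y \<union> (W - Y) = W" "Z \<union> (W - Z) = W" using assms by auto
  ultimately have "p permutes W" using assms(2) by (intro bij_imp_permutes) (auto simp: p_def)
  moreover have "p ` Y = Z" using \<open>bij_betw p Y Z\<close> by (simp add: bij_betw_def)
  ultimately show ?thesis by blast
qed

text \<open>Left composition with a permutation carrying \<open>Y\<close> to \<open>Z\<close>
  matches the permutations with image \<open>Y\<close> to those with image \<open>Z\<close>, so all
  target sets of the right size are equally likely.\<close>

lemma card_permutations_image_eq:
  assumes W: "finite W" and T: "T \<subseteq> W" and Y: "Y \<subseteq> W" "card Y = card T"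
  shows "real (card {p. p permutes W \<and> p ` T = Y}) = fact (card W) / real (card W choose card T)"
proof -
  define S where "S = {Z. Z \<subseteq> W \<and> card Z = card T}"
  let ?N = "\<lambda>Z. {p. p permutes W \<and> p ` T = Z}"
  have finS: "finite S" using W by (simp add: S_def)
  have finN: "finite (?N Z)" for Z using finite_permutations[OF W] by (rule finite_subset[rotated]) auto
  have eq: "card (?N Z) = card (?N Y)" if Z: "Z \<in> S" for Z
  proof -
    obtain r where r: "r permutes W" "r ` Y = Z"
      using exists_permutation_image[OF W Y(1), of Z] Z Y by (auto simp: S_def)
    have rinv: "inv r permutes W" using r by (simp add: permutes_inv)
    have "bij_betw (\<lambda>p. r \<circ> p) (?N Y) (?N Z)"
    proof (rule bij_betw_byWitness[where f' = "\<lambda>p. inv r \<circ> p"])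
      show "\<forall>p\<in>?N Y. inv r \<circ> (r \<circ> p) = p"
        using permutes_inv_o(2)[OF r(1)] by (simp add: o_assoc)
      show "\<forall>p\<in>?N Z. r \<circ> (inv r \<circ> p) = p"
        using permutes_inv_o(1)[OF r(1)] by (simp add: o_assoc)
      show "(\<lambda>p. r \<circ> p) ` ?N Y \<subseteq> ?N Z"
        using r by (auto intro: permutes_compose simp: image_comp[symmetric])
      have "inv r ` Z = Y" using r permutes_inj[OF r(1)] by (simp add: image_inv_f_f flip: r(2))
      then show "(\<lambda>p. inv r \<circ> p) ` ?N Z \<subseteq> ?N Y"
        using rinv by (auto intro: permutes_compose simp: image_comp[symmetric])
    qed
    then show ?thesis by (simp add: bij_betw_same_card)
  qed
  have "{p. p permutes W} = (\<Union>Z\<in>S. ?N Z)"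
    using T by (auto simp: S_def permutes_in_image card_image[OF permutes_inj_on] subset_iff)
  then have "card {p. p permutes W} = (\<Sum>Z\<in>S. card (?N Z))"
    using finS finN by (simp only:) (intro card_UN_disjoint, auto)
  also have "\<dots> = card S * card (?N Y)" by (simp add: eq)
  also have "card S = card W choose card T" using W by (simp add: S_def n_subsets)
  finally have "fact (card W) = real (card W choose card T) * card (?N Y)"
    using W by (simp add: card_permutations) (metis of_nat_fact of_nat_mult)
  moreover have "card W choose card T \<noteq> 0"
    using card_mono[OF W T] by (simp add: binomial_eq_0_iff)
  ultimately show ?thesis by simp
qed

lemma card_Collect_diff_le:
  assumes "finite J" "D \<subseteq> J" "\<And>j. j \<in> J - D \<Longrightarrow> P j \<longleftrightarrow> Q j"
  shows "real (card {j \<in> J. P j}) - real (card {j \<in> J. Q j}) \<le> card D"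
proof -
  have "{j \<in> J. P j} \<subseteq> {j \<in> J. Q j} \<union> D" using assms by auto
  then have "card {j \<in> J. P j} \<le> card ({j \<in> J. Q j} \<union> D)"
    using assms finite_subset[of D J] by (intro card_mono) auto
  also have "\<dots> \<le> card {j \<in> J. Q j} + card D" by (rule card_Un_le)
  finally show ?thesis by linarith
qed

text \<open>Each of the two transposed points lies in at most two blocks, so the count changes by at
  most 4. The variance proxy is therefore \<open>16 * n\<close>, and the tail bound multiplies it by
  4. Using \<open>n\<close> in place of \<open>card W\<close> makes the bound uniform over all
  blocks that are conditioned on.\<close>

lemma permutation_block_tail:
  fixes T :: "'j \<Rightarrow> 'a set" and s \<mu> :: real and n :: nat
  assumes W: "finite W" and J: "finite J"
    and T: "\<And>j. j \<in> J \<Longrightarrow> T j \<subseteq> W \<and> card (T j) = t"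
    and mult: "\<And>w. w \<in> W \<Longrightarrow> card {j \<in> J. w \<in> T j} \<le> 2"
    and N: "\<N> \<subseteq> {Y. Y \<subseteq> W \<and> card Y = t}"
    and n: "card W \<le> n" "0 < n" and s: "0 \<le> s"
    and mu: "\<mu> = card J * card \<N> / real (card W choose t)"
  shows "real (card {p. p permutes W \<and> \<mu> + s \<le> card {j \<in> J. p ` T j \<in> \<N>}})
      \<le> fact (card W) * exp (- (s\<^sup>2 / (64 * real n)))"
    and "real (card {p. p permutes W \<and> card {j \<in> J. p ` T j \<in> \<N>} \<le> \<mu> - s})
      \<le> fact (card W) * exp (- (s\<^sup>2 / (64 * real n)))"
proof -
  define f where "f p = real (card {j \<in> J. p ` T j \<in> \<N>})" for p
  have finN: "finite \<N>" using N W by (auto intro: finite_subset)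
  have finP: "finite {p. p permutes W}" using W by (rule finite_permutations)
  have lip: "\<bar>f (p \<circ> transpose v w) - f p\<bar> \<le> 4" if "v \<in> W" "w \<in> W" for p v w
  proof -
    define D where "D = {j \<in> J. v \<in> T j} \<union> {j \<in> J. w \<in> T j}"
    have "card D \<le> 2 + 2"
      unfolding D_def by (rule order_trans[OF card_Un_le]) (intro add_mono mult that)
    moreover have "transpose v w ` T j = T j" if "j \<in> J - D" for j
    proof -
      have "transpose v w x = x" if "x \<in> T j" for x
        using that \<open>j \<in> J - D\<close> by (auto simp: D_def transpose_def)
      then show ?thesis by simp
    qed
    then have "(p \<circ> transpose v w) ` T j = p ` T j" if "j \<in> J - D" for j
      using that by (simp only: image_comp[symmetric])
    then have "f (p \<circ> transpose v w) - f p \<le> card D" "f p - f (p \<circ> transpose v w) \<le> card D"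
      unfolding f_def by (intro card_Collect_diff_le; auto simp: D_def J)+
    ultimately show ?thesis by linarith
  qed
  have mean: "(\<Sum>p | p permutes W. f p) / fact (card W) = \<mu>"
  proof -
    have "(\<Sum>p | p permutes W. f p) = (\<Sum>p | p permutes W. \<Sum>j\<in>J. \<Sum>Y\<in>\<N>. if p ` T j = Y then 1 else 0)"
    proof (intro sum.cong refl)
      fix p
      have "(\<Sum>j\<in>J. \<Sum>Y\<in>\<N>. if p ` T j = Y then 1 else 0) = (\<Sum>j\<in>J. if p ` T j \<in> \<N> then 1 else (0::real))"
        using finN by (intro sum.cong) auto
      also have "\<dots> = f p" using J by (simp add: f_def sum.If_cases Collect_conj_eq)
      finally show "f p = (\<Sum>j\<in>J. \<Sum>Y\<in>\<N>. if p ` T j = Y then 1 else 0)" by simp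
    qed
    also have "\<dots> = (\<Sum>j\<in>J. \<Sum>Y\<in>\<N>. \<Sum>p | p permutes W. if p ` T j = Y then 1 else 0)"
      by (subst sum.swap) (intro sum.cong refl sum.swap)
    also have "\<dots> = (\<Sum>j\<in>J. \<Sum>Y\<in>\<N>. fact (card W) / real (card W choose t))"
    proof (intro sum.cong refl)
      fix j Y assume j: "j \<in> J" and Y: "Y \<in> \<N>"
      have "(\<Sum>p | p permutes W. if p ` T j = Y then 1 else 0) = real (card {p. p permutes W \<and> p ` T j = Y})"
        using finP by (simp add: sum.If_cases Collect_conj_eq)
      also have "\<dots> = fact (card W) / real (card W choose t)"
        using card_permutations_image_eq[OF W, of "T j" Y] T[OF j] Y N by auto
      finally show "(\<Sum>p | p permutes W. if p ` T j = Y then 1 else 0) = fact (card W) / real (card W choose t)" .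
    qed
    finally show ?thesis by (simp add: mu)
  qed
  have mgf: "(\<Sum>p\<in>{p. p permutes W}. exp (\<theta> * (f p - \<mu>))) \<le> fact (card W) * exp (\<theta>\<^sup>2 * (16 * n))" for \<theta>
  proof -
    have "(\<Sum>p\<in>{p. p permutes W}. exp (\<theta> * (f p - \<mu>))) \<le> fact (card W) * exp (\<theta>\<^sup>2 * (card W * 4\<^sup>2))"
      using permutation_mgf[OF W _ lip, of \<theta>] by (simp add: mean)
    also have "\<dots> \<le> fact (card W) * exp (\<theta>\<^sup>2 * (16 * n))"
      using n by (intro mult_left_mono) (auto intro!: mult_left_mono mult_right_mono)
    finally show ?thesis .
  qed
  have n16: "0 < real (16 * n)" using n by simp
  show "real (card {p. p permutes W \<and> \<mu> + s \<le> card {j \<in> J. p ` T j \<in> \<N>}})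
      \<le> fact (card W) * exp (- (s\<^sup>2 / (64 * real n)))"
    using subgaussian_tail(1)[OF finP n16 s mgf] by (simp add: f_def)
  show "real (card {p. p permutes W \<and> card {j \<in> J. p ` T j \<in> \<N>} \<le> \<mu> - s})
      \<le> fact (card W) * exp (- (s\<^sup>2 / (64 * real n)))"
    using subgaussian_tail(2)[OF finP n16 s mgf] by (simp add: f_def)
qed

text \<open>Averaging over the translates \<open>\<sigma> \<circ> \<tau>\<close> with \<open>\<tau>\<close> permuting \<open>W\<close> amounts to conditioning on
  the values of \<open>\<sigma>\<close> outside \<open>W\<close>.\<close>

lemma card_permutations_le_by_translates:
  fixes \<alpha> :: real
  assumes V: "finite V" and W: "W \<subseteq> V"
    and bound: "\<And>\<sigma>. \<sigma> permutes V \<Longrightarrow> card {\<tau>. \<tau> permutes W \<and> P (\<sigma> \<circ> \<tau>)} \<le> fact (card W) * \<alpha>"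
  shows "card {\<sigma>. \<sigma> permutes V \<and> P \<sigma>} \<le> fact (card V) * \<alpha>"
proof -
  have finW: "finite W" using V W finite_subset by blast
  let ?V = "{\<sigma>. \<sigma> permutes V}" and ?W = "{\<tau>. \<tau> permutes W}"
  have finV': "finite ?V" and finW': "finite ?W" using V finW by (auto simp: finite_permutations)
  have "fact (card W) * real (card {\<sigma>. \<sigma> permutes V \<and> P \<sigma>})
    = (\<Sum>\<tau>\<in>?W. \<Sum>\<sigma>\<in>?V. if P \<sigma> then 1 else 0)"
    using finV' finW by (simp add: sum.If_cases card_permutations Collect_conj_eq)
  also have "\<dots> = (\<Sum>\<tau>\<in>?W. \<Sum>\<sigma>\<in>?V. if P (\<sigma> \<circ> \<tau>) then 1 else 0)"
  proof (rule sum.cong[OF refl])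
    fix \<tau> assume "\<tau> \<in> ?W"
    then have t: "\<tau> permutes V" using permutes_subset W by blast
    show "(\<Sum>\<sigma>\<in>?V. if P \<sigma> then 1 else 0) = (\<Sum>\<sigma>\<in>?V. if P (\<sigma> \<circ> \<tau>) then 1 else (0::real))"
      by (rule sum.reindex_bij_witness[of _ "\<lambda>\<sigma>. \<sigma> \<circ> \<tau>" "\<lambda>\<sigma>. \<sigma> \<circ> inv \<tau>"])
         (auto simp: o_assoc[symmetric] permutes_inv_o[OF t] intro: permutes_compose permutes_inv t)
  qed
  also have "\<dots> = (\<Sum>\<sigma>\<in>?V. \<Sum>\<tau>\<in>?W. if P (\<sigma> \<circ> \<tau>) then 1 else 0)" by (rule sum.swap)
  also have "\<dots> = (\<Sum>\<sigma>\<in>?V. real (card {\<tau>. \<tau> permutes W \<and> P (\<sigma> \<circ> \<tau>)}))"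
    using finW' by (simp add: sum.If_cases Collect_conj_eq)
  also have "\<dots> \<le> (\<Sum>\<sigma>\<in>?V. fact (card W) * \<alpha>)" using bound by (intro sum_mono) auto
  also have "\<dots> = fact (card W) * (fact (card V) * \<alpha>)" using V by (simp add: card_permutations)
  finally show ?thesis by simp
qed

lemma card_common_nbhd:
  assumes H: "uniform_hypergraph n k E" and \<sigma>: "\<sigma> permutes {0..<n}"
    and Q: "Q1 \<subseteq> {0..<n}" "Q2 \<subseteq> {0..<n}" "card Q1 = k - t" "card Q2 = k - t" and t: "t \<le> k"
  shows "card {Y. Y \<subseteq> {0..<n} - (Q1 \<union> Q2) \<and> card Y = t \<and> \<sigma> ` (Q1 \<union> Y) \<in> E \<and> \<sigma> ` (Q2 \<union> Y) \<in> E}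
    = card (nbhd n k E (\<sigma> ` Q1) \<inter> nbhd n k E (\<sigma> ` Q2))"
proof (rule bij_betw_same_card)
  have inj: "inj \<sigma>" using \<sigma> by (rule permutes_inj)
  have im: "\<sigma> ` {0..<n} = {0..<n}" using \<sigma> by (rule permutes_image)
  have cs: "card (\<sigma> ` X) = card X" for X using inj by (intro card_image inj_on_subset[OF inj]) auto
  let ?A = "{Y. Y \<subseteq> {0..<n} - (Q1 \<union> Q2) \<and> card Y = t \<and> \<sigma> ` (Q1 \<union> Y) \<in> E \<and> \<sigma> ` (Q2 \<union> Y) \<in> E}"
  let ?B = "nbhd n k E (\<sigma> ` Q1) \<inter> nbhd n k E (\<sigma> ` Q2)"
  show "bij_betw ((`) \<sigma>) ?A ?B"
  proof (rule bij_betw_imageI)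
    show "inj_on ((`) \<sigma>) ?A" using inj by (auto simp: inj_on_def inj_image_eq_iff)
    show "(`) \<sigma> ` ?A = ?B"
    proof (intro equalityI subsetI)
      fix Z assume "Z \<in> (`) \<sigma> ` ?A"
      then obtain Y where Y: "Y \<in> ?A" "Z = \<sigma> ` Y" by auto
      then have "Z \<subseteq> {0..<n}" using im by auto
      then show "Z \<in> ?B" using Y Q t by (auto simp: nbhd_def cs image_Un)
    next
      fix Z assume Z: "Z \<in> ?B"
      have disj: "Z \<inter> \<sigma> ` Q = {}" if Q: "Q \<subseteq> {0..<n}" "card Q = k - t" "Z \<in> nbhd n k E (\<sigma> ` Q)" for Q
      proof -
        have "card (\<sigma> ` Q \<union> Z) = k" using H Q by (auto simp: nbhd_def uniform_hypergraph_def)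
        moreover have "card Z = t" "finite Z" using Q t by (auto simp: nbhd_def cs finite_subset)
        moreover have "finite (\<sigma> ` Q)" "card (\<sigma> ` Q) = k - t" using Q by (auto simp: cs finite_subset)
        ultimately have "card (\<sigma> ` Q \<inter> Z) = 0" using card_Un_Int[of "\<sigma> ` Q" Z] t by simp
        then show ?thesis using \<open>finite Z\<close> by auto
      qed
      have d: "Z \<inter> \<sigma> ` Q1 = {}" "Z \<inter> \<sigma> ` Q2 = {}" using disj Q Z by auto
      have Zn: "Z \<subseteq> {0..<n}" using Z by (auto simp: nbhd_def)
      then obtain Y where Y: "Y \<subseteq> {0..<n}" "Z = \<sigma> ` Y" using im by (metis subset_imageE)
      have "card Y = t" using Z Y Q t by (auto simp: nbhd_def cs)
      moreover have "Y \<inter> Q1 = {}" "Y \<inter> Q2 = {}" using d Y by auto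
      moreover have "\<sigma> ` (Q1 \<union> Y) \<in> E" "\<sigma> ` (Q2 \<union> Y) \<in> E" using Z Y by (auto simp: nbhd_def image_Un)
      ultimately have "Y \<in> ?A" using Y by auto
      then show "Z \<in> (`) \<sigma> ` ?A" using Y by blast
    qed
  qed
qed

text \<open>With the values of \<sigma> on \<open>Q1 \<union> Q2\<close> fixed, the common
  neighbourhood is a fixed family and the blocks \<open>T j\<close> are placed at random in the
  remaining vertices. \<open>\<mu>\<close> only has to bound every conditional mean. Taking
  \<open>Q1 = Q2\<close> yields degrees, so one statement serves all four kinds of bound on a block
  graph.\<close>

lemma
  fixes T :: "'j \<Rightarrow> nat set" and s \<mu> :: real
  assumes H: "uniform_hypergraph n k E"
    and Q: "Q1 \<subseteq> {0..<n}" "Q2 \<subseteq> {0..<n}" "card Q1 = k - t" "card Q2 = k - t" and t: "t \<le> k"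
    and J: "finite J"
    and T: "\<And>j. j \<in> J \<Longrightarrow> T j \<subseteq> {0..<n} - (Q1 \<union> Q2) \<and> card (T j) = t"
    and mult: "\<And>w. card {j \<in> J. w \<in> T j} \<le> 2"
    and n: "0 < n" and s: "0 \<le> s"
  shows codegree_upper_tail:
    "(\<And>\<sigma>. \<sigma> permutes {0..<n} \<Longrightarrow>
        card J * (real (card (nbhd n k E (\<sigma> ` Q1) \<inter> nbhd n k E (\<sigma> ` Q2)))
          / real (card ({0..<n} - (Q1 \<union> Q2)) choose t)) \<le> \<mu>) \<Longrightarrow>
      card {\<sigma>. \<sigma> permutes {0..<n} \<and>
        \<mu> + s \<le> card {j \<in> J. \<sigma> ` (Q1 \<union> T j) \<in> E \<and> \<sigma> ` (Q2 \<union> T j) \<in> E}}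
      \<le> fact n * exp (- (s\<^sup>2 / (64 * real n)))" (is "PROP ?up")
    and codegree_lower_tail:
    "(\<And>\<sigma>. \<sigma> permutes {0..<n} \<Longrightarrow>
        \<mu> \<le> card J * (real (card (nbhd n k E (\<sigma> ` Q1) \<inter> nbhd n k E (\<sigma> ` Q2)))
          / real (card ({0..<n} - (Q1 \<union> Q2)) choose t))) \<Longrightarrow>
      card {\<sigma>. \<sigma> permutes {0..<n} \<and>
        card {j \<in> J. \<sigma> ` (Q1 \<union> T j) \<in> E \<and> \<sigma> ` (Q2 \<union> T j) \<in> E} \<le> \<mu> - s}
      \<le> fact n * exp (- (s\<^sup>2 / (64 * real n)))" (is "PROP ?low")
proof -
  define W where "W = {0..<n} - (Q1 \<union> Q2)"
  have W: "finite W" "W \<subseteq> {0..<n}" "card W \<le> n"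
    using card_mono[of "{0..<n}" W] by (auto simp: W_def)
  define X where "X \<sigma> = real (card {j \<in> J. \<sigma> ` (Q1 \<union> T j) \<in> E \<and> \<sigma> ` (Q2 \<union> T j) \<in> E})" for \<sigma>
  define \<N> where "\<N> \<sigma> = {Y. Y \<subseteq> W \<and> card Y = t \<and> \<sigma> ` (Q1 \<union> Y) \<in> E \<and> \<sigma> ` (Q2 \<union> Y) \<in> E}" for \<sigma>
  have TW: "\<And>j. j \<in> J \<Longrightarrow> T j \<subseteq> W \<and> card (T j) = t" using T by (simp add: W_def)
  have NW: "\<N> \<sigma> \<subseteq> {Y. Y \<subseteq> W \<and> card Y = t}" for \<sigma> by (auto simp: \<N>_def)
  have cN: "card (\<N> \<sigma>) = card (nbhd n k E (\<sigma> ` Q1) \<inter> nbhd n k E (\<sigma> ` Q2))"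
    if "\<sigma> permutes {0..<n}" for \<sigma>
    using card_common_nbhd[OF H that Q t] by (simp add: \<N>_def W_def)
  have X_comp: "X (\<sigma> \<circ> \<tau>) = card {j \<in> J. \<tau> ` T j \<in> \<N> \<sigma>}" if t: "\<tau> permutes W" for \<sigma> \<tau>
  proof -
    have fixQ: "\<tau> ` Q1 = Q1" "\<tau> ` Q2 = Q2"
      using permutes_not_in[OF t] by (auto simp: W_def image_iff)
    have im: "(\<sigma> \<circ> \<tau>) ` (Q1 \<union> T j) = \<sigma> ` (Q1 \<union> \<tau> ` T j)" "(\<sigma> \<circ> \<tau>) ` (Q2 \<union> T j) = \<sigma> ` (Q2 \<union> \<tau> ` T j)" for j
      by (simp_all only: image_comp[symmetric] image_Un fixQ)
    have "\<tau> ` T j \<subseteq> W \<and> card (\<tau> ` T j) = t" if "j \<in> J" for j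
      using TW[OF that] permutes_image[OF t] permutes_inj_on[OF t] by (auto simp: card_image)
    then have "\<tau> ` T j \<in> \<N> \<sigma> \<longleftrightarrow> (\<sigma> \<circ> \<tau>) ` (Q1 \<union> T j) \<in> E \<and> (\<sigma> \<circ> \<tau>) ` (Q2 \<union> T j) \<in> E"
      if "j \<in> J" for j using that unfolding \<N>_def im by blast
    then have "{j \<in> J. \<tau> ` T j \<in> \<N> \<sigma>} = {j \<in> J. (\<sigma> \<circ> \<tau>) ` (Q1 \<union> T j) \<in> E \<and> (\<sigma> \<circ> \<tau>) ` (Q2 \<union> T j) \<in> E}"
      by blast
    then show ?thesis unfolding X_def by (simp only:)
  qed
  show "PROP ?up"
  proof -
    assume mu: "\<And>\<sigma>. \<sigma> permutes {0..<n} \<Longrightarrow>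
        card J * (real (card (nbhd n k E (\<sigma> ` Q1) \<inter> nbhd n k E (\<sigma> ` Q2)))
          / real (card ({0..<n} - (Q1 \<union> Q2)) choose t)) \<le> \<mu>"
    have "real (card {\<sigma>. \<sigma> permutes {0..<n} \<and> \<mu> + s \<le> X \<sigma>})
      \<le> fact (card {0..<n}) * exp (- (s\<^sup>2 / (64 * real n)))"
    proof (rule card_permutations_le_by_translates[OF _ W(2)])
      fix \<sigma> assume \<sigma>: "\<sigma> permutes {0..<n}"
      have le: "card J * real (card (\<N> \<sigma>)) / real (card W choose t) \<le> \<mu>"
        using mu[OF \<sigma>] by (simp add: cN[OF \<sigma>] W_def)
      have "card {\<tau>. \<tau> permutes W \<and> \<mu> + s \<le> X (\<sigma> \<circ> \<tau>)}
        \<le> card {\<tau>. \<tau> permutes W \<and> card J * real (card (\<N> \<sigma>)) / real (card W choose t) + s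
            \<le> card {j \<in> J. \<tau> ` T j \<in> \<N> \<sigma>}}"
        using le finite_permutations[OF W(1)]
        by (intro card_mono) (auto simp: X_comp intro: finite_subset)
      also have "real \<dots> \<le> fact (card W) * exp (- (s\<^sup>2 / (64 * real n)))"
        using permutation_block_tail(1)[OF W(1) J TW mult NW W(3) n s refl] by simp
      finally show "real (card {\<tau>. \<tau> permutes W \<and> \<mu> + s \<le> X (\<sigma> \<circ> \<tau>)})
        \<le> fact (card W) * exp (- (s\<^sup>2 / (64 * real n)))" by simp
    qed auto
    then show ?thesis by (simp add: X_def)
  qed
  show "PROP ?low"
  proof -
    assume mu: "\<And>\<sigma>. \<sigma> permutes {0..<n} \<Longrightarrow>
        \<mu> \<le> card J * (real (card (nbhd n k E (\<sigma> ` Q1) \<inter> nbhd n k E (\<sigma> ` Q2)))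
          / real (card ({0..<n} - (Q1 \<union> Q2)) choose t))"
    have "real (card {\<sigma>. \<sigma> permutes {0..<n} \<and> X \<sigma> \<le> \<mu> - s})
      \<le> fact (card {0..<n}) * exp (- (s\<^sup>2 / (64 * real n)))"
    proof (rule card_permutations_le_by_translates[OF _ W(2)])
      fix \<sigma> assume \<sigma>: "\<sigma> permutes {0..<n}"
      have le: "\<mu> \<le> card J * real (card (\<N> \<sigma>)) / real (card W choose t)"
        using mu[OF \<sigma>] by (simp add: cN[OF \<sigma>] W_def)
      have "card {\<tau>. \<tau> permutes W \<and> X (\<sigma> \<circ> \<tau>) \<le> \<mu> - s}
        \<le> card {\<tau>. \<tau> permutes W \<and> card {j \<in> J. \<tau> ` T j \<in> \<N> \<sigma>}
            \<le> card J * real (card (\<N> \<sigma>)) / real (card W choose t) - s}"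
        using le finite_permutations[OF W(1)]
        by (intro card_mono) (auto simp: X_comp intro: finite_subset)
      also have "real \<dots> \<le> fact (card W) * exp (- (s\<^sup>2 / (64 * real n)))"
        using permutation_block_tail(2)[OF W(1) J TW mult NW W(3) n s refl] by simp
      finally show "real (card {\<tau>. \<tau> permutes W \<and> X (\<sigma> \<circ> \<tau>) \<le> \<mu> - s})
        \<le> fact (card W) * exp (- (s\<^sup>2 / (64 * real n)))" by simp
    qed auto
    then show ?thesis by (simp add: X_def)
  qed
qed

section \<open>Hamilton cycles from orderings and matchings\<close>

text \<open>The cyclic order of \<open>N * l\<close> positions is cut into \<open>N\<close> windows of length \<open>l\<close>; the first \<open>a = k - l\<close>
  positions of a window are shared with the preceding edge, the other \<open>2 * l - k\<close> belong to one
  edge only.\<close>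

definition joint_block :: "nat \<Rightarrow> nat \<Rightarrow> nat \<Rightarrow> nat set" where
  "joint_block l a i = {i * l..<i * l + a}"

definition joint_pair :: "nat \<Rightarrow> nat \<Rightarrow> nat \<Rightarrow> nat \<Rightarrow> nat set" where
  "joint_pair l a N i = joint_block l a i \<union> joint_block l a (Suc i mod N)"

definition inner_block :: "nat \<Rightarrow> nat \<Rightarrow> nat \<Rightarrow> nat set" where
  "inner_block l a j = {j * l + a..<j * l + l}"

definition block_edge :: "nat \<Rightarrow> nat \<Rightarrow> nat \<Rightarrow> (nat \<Rightarrow> nat) \<Rightarrow> nat \<Rightarrow> nat \<Rightarrow> nat set" where
  "block_edge l a N \<sigma> i j = \<sigma> ` (joint_pair l a N i \<union> inner_block l a j)"

definition block_graph :: "nat \<Rightarrow> nat \<Rightarrow> nat \<Rightarrow> nat set set \<Rightarrow> (nat \<Rightarrow> nat) \<Rightarrow> (nat \<times> nat) set" where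
  "block_graph l a N E \<sigma> = {(i, j). i < N \<and> j < N \<and> block_edge l a N \<sigma> i j \<in> E}"

section \<open>Blocks described by quotient and residue modulo \<open>l\<close>\<close>

lemma interval_block_iff:
  assumes "c \<le> d" "d \<le> l"
  shows "x \<in> {i * l + c..<i * l + d} \<longleftrightarrow> x div l = i \<and> c \<le> x mod l \<and> x mod l < (d::nat)"
proof
  assume x: "x \<in> {i * l + c..<i * l + d}"
  then have "x = i * l + (x - i * l)" "x - i * l < l" using assms by auto
  then have "x div l = i" "x mod l = x - i * l"
    by (metis add.commute div_mult_self3 div_less add.right_neutral less_nat_zero_code,
        metis mod_mult_self3 mod_less)
  then show "x div l = i \<and> c \<le> x mod l \<and> x mod l < d" using x by auto
next
  assume x: "x div l = i \<and> c \<le> x mod l \<and> x mod l < d"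
  then have "x = i * l + x mod l" using div_mult_mod_eq[of x l] by simp
  then show "x \<in> {i * l + c..<i * l + d}" using x by (metis atLeastLessThan_iff add_le_cancel_left add_less_cancel_left)
qed

lemma joint_block_iff: "a \<le> l \<Longrightarrow> x \<in> joint_block l a i \<longleftrightarrow> x div l = i \<and> x mod l < a"
  using interval_block_iff[of 0 a l x i] by (simp add: joint_block_def)

lemma inner_block_iff: "a \<le> l \<Longrightarrow> 0 < l \<Longrightarrow> x \<in> inner_block l a j \<longleftrightarrow> x div l = j \<and> a \<le> x mod l"
  using interval_block_iff[of a l l x j] by (simp add: inner_block_def)

lemma joint_pair_iff:
  "a \<le> l \<Longrightarrow> x \<in> joint_pair l a N i \<longleftrightarrow> (x div l = i \<or> x div l = Suc i mod N) \<and> x mod l < a"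
  by (auto simp: joint_pair_def joint_block_iff)

lemma less_mult_iff_div_less: "0 < l \<Longrightarrow> x < N * l \<longleftrightarrow> x div l < (N::nat)"
  by (simp add: less_mult_imp_div_less div_less_iff_less_mult)

lemma Suc_mod_eq: "i < N \<Longrightarrow> Suc i mod N = (if Suc i = N then 0 else Suc i)"
  by auto

text \<open>With \<open>3 \<le> N\<close> distinct joint pairs share at most one joint block; for
  \<open>N = 2\<close> the two joint pairs would coincide.\<close>

locale block_layout =
  fixes l a N n :: nat
  assumes a: "0 < a" "a < l" and N: "3 \<le> N" and n: "n = N * l"
begin

abbreviation "L \<equiv> joint_pair l a N"
abbreviation "B \<equiv> inner_block l a"

lemma l_pos: "0 < l" and a_le: "a \<le> l" and n_pos: "0 < n"
  using a N n by auto

lemmas block_iffs = joint_block_iff[OF a_le] inner_block_iff[OF a_le l_pos] joint_pair_iff[OF a_le]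

lemma lt_n_iff: "x < n \<longleftrightarrow> x div l < N"
  using less_mult_iff_div_less[OF l_pos] by (simp add: n)

lemma joint_pair_subset: "i < N \<Longrightarrow> L i \<subseteq> {0..<n}"
  by (auto simp: block_iffs lt_n_iff)

lemma inner_block_subset: "j < N \<Longrightarrow> B j \<subseteq> {0..<n}"
  by (auto simp: block_iffs lt_n_iff)

lemma card_joint_pair: "i < N \<Longrightarrow> card (L i) = 2 * a"
proof -
  assume i: "i < N"
  have "joint_block l a i \<inter> joint_block l a (Suc i mod N) = {}"
    using i N by (auto simp: block_iffs Suc_mod_eq split: if_splits)
  then show ?thesis unfolding joint_pair_def
    by (subst card_Un_disjoint) (auto simp: joint_block_def)
qed

lemma card_inner_block: "card (B j) = l - a"
  using a by (simp add: inner_block_def)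

lemma joint_inner_disjoint: "L i \<inter> B j = {}"
  by (auto simp: block_iffs)

lemma inner_blocks_disjoint: "j \<noteq> j' \<Longrightarrow> B j \<inter> B j' = {}"
  by (auto simp: block_iffs)

lemma joint_pair_multiplicity: "card {i \<in> {..<N}. w \<in> L i} \<le> 2"
proof -
  have "{i \<in> {..<N}. w \<in> L i} \<subseteq> {w div l, (if w div l = 0 then N - 1 else w div l - 1)}"
  proof
    fix i assume i: "i \<in> {i \<in> {..<N}. w \<in> L i}"
    then have "w div l = i \<or> w div l = (if Suc i = N then 0 else Suc i)"
      unfolding mem_Collect_eq block_iffs lessThan_iff by (metis Suc_mod_eq)
    then show "i \<in> {w div l, (if w div l = 0 then N - 1 else w div l - 1)}"
      using N by (auto split: if_splits)
  qed
  then have "card {i \<in> {..<N}. w \<in> L i} \<le> card {w div l, (if w div l = 0 then N - 1 else w div l - 1)}"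
    by (intro card_mono) auto
  also have "\<dots> \<le> 2" by (simp add: card_insert_if)
  finally show ?thesis .
qed

lemma inner_block_multiplicity: "card {j \<in> {..<N}. w \<in> B j} \<le> 2"
proof -
  have "{j \<in> {..<N}. w \<in> B j} \<subseteq> {w div l}" by (auto simp: block_iffs)
  then have "card {j \<in> {..<N}. w \<in> B j} \<le> card {w div l}" by (intro card_mono) auto
  then show ?thesis by simp
qed

text \<open>These are exactly the intersection sizes, 0 and \<open>k - l\<close>, for which the
  theorem bounds common neighbourhoods of sets of size \<open>2 * (k - l)\<close>.\<close>

lemma card_joint_pair_Int:
  assumes "i < N" "i' < N" "i \<noteq> i'"
  shows "card (L i \<inter> L i') \<in> {0, a}"
proof -
  have "L i \<inter> L i' = {} \<or> L i \<inter> L i' = joint_block l a i \<or> L i \<inter> L i' = joint_block l a i'"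
  proof (cases "Suc i mod N = i'"; cases "Suc i' mod N = i")
    assume "Suc i mod N = i'" "Suc i' mod N = i"
    then have False using assms N by (auto simp: Suc_mod_eq split: if_splits)
    then show ?thesis ..
  next
    assume h: "Suc i mod N = i'" "Suc i' mod N \<noteq> i"
    have "L i \<inter> L i' = joint_block l a i'"
      using h assms by (auto simp: block_iffs)
    then show ?thesis by blast
  next
    assume h: "Suc i mod N \<noteq> i'" "Suc i' mod N = i"
    have "L i \<inter> L i' = joint_block l a i"
      using h assms by (auto simp: block_iffs)
    then show ?thesis by blast
  next
    assume h: "Suc i mod N \<noteq> i'" "Suc i' mod N \<noteq> i"
    moreover have "Suc i mod N \<noteq> Suc i' mod N"
      using assms by (auto simp: Suc_mod_eq split: if_splits)
    ultimately have "L i \<inter> L i' = {}" using assms by (auto simp: block_iffs)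
    then show ?thesis by blast
  qed
  then show ?thesis by (auto simp: joint_block_def)
qed

text \<open>Residues below \<open>a\<close> recover the joint pair and the others the inner block.
  Distinct pairs of indices thus carry distinct hyperedges, which makes their random colours
  independent within one ordering.\<close>

lemma block_edge_inject:
  assumes "inj \<sigma>" and ij: "i < N" "i' < N" and eq: "block_edge l a N \<sigma> i j = block_edge l a N \<sigma> i' j'"
  shows "i = i' \<and> j = j'"
proof -
  have eq': "L i \<union> B j = L i' \<union> B j'"
    using eq assms(1) by (simp add: block_edge_def inj_image_eq_iff)
  have LL: "L i = L i'" and BB: "B j = B j'"
    using eq' joint_inner_disjoint[of i j] joint_inner_disjoint[of i j'] joint_inner_disjoint[of i' j]
      joint_inner_disjoint[of i' j'] by blast+
  have "j * l + a \<in> B j" using a by (simp add: inner_block_def)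
  then have "j = j'" using BB inner_blocks_disjoint[of j j'] by auto
  moreover have "i = i'"
  proof (rule ccontr)
    assume "i \<noteq> i'"
    then have "card (L i) \<in> {0, a}" using card_joint_pair_Int[OF ij] LL by simp
    then show False using card_joint_pair[OF ij(1)] a by simp
  qed
  ultimately show ?thesis by blast
qed

lemma card_block_edge:
  assumes "inj \<sigma>" "i < N"
  shows "card (block_edge l a N \<sigma> i j) = l + a"
proof -
  have "card (L i \<union> B j) = 2 * a + (l - a)"
    using card_joint_pair[OF assms(2)] card_inner_block joint_inner_disjoint
    by (subst card_Un_disjoint) (auto simp: joint_pair_def joint_block_def inner_block_def)
  then show ?thesis
    using a assms(1) by (simp add: block_edge_def card_image inj_on_subset)
qed

lemma window_eq:
  assumes "i < N"
  shows "{(i * l + j) mod n | j. j < l + a} = L i \<union> B i"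
proof -
  \<comment> \<open>Since \<open>n = N * l\<close>, reduction modulo \<open>n\<close> acts on the
    window index only and keeps the residue modulo \<open>l\<close>; this handles the wrap-around of
    the last window.\<close>
  have md: "(i * l + j) mod n = l * ((i * l + j) div l mod N) + j mod l" for j
    unfolding n mult.commute[of N l] mod_mult2_eq by simp
  show ?thesis
  proof (intro equalityI subsetI)
  fix x assume "x \<in> {(i * l + j) mod n | j. j < l + a}"
  then obtain j where j: "x = (i * l + j) mod n" "j < l + a" by auto
  show "x \<in> L i \<union> B i"
  proof (cases "j < l")
    case True
    then have "x = i * l + j" using j assms md[of j] l_pos by (simp add: mult.commute)
    then have "x div l = i" "x mod l = j" using True by auto
    then show ?thesis by (auto simp: block_iffs)
  next
    case False
    define r where "r = j - l"
    have r: "j = l + r" "r < l" "r < a" using False j a by (auto simp: r_def)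
    have "(i * l + j) div l = Suc i" using r l_pos by (simp add: div_add1_eq)
    then have "x = (Suc i mod N) * l + r" using j md[of j] r by (simp add: mult.commute)
    then have "x div l = Suc i mod N" "x mod l = r" using r by auto
    then show ?thesis using r by (auto simp: block_iffs)
  qed
next
  fix x assume "x \<in> L i \<union> B i"
  then consider "x div l = i" | "x div l = Suc i mod N" "x mod l < a" by (auto simp: block_iffs)
  then show "x \<in> {(i * l + j) mod n | j. j < l + a}"
  proof cases
    case 1
    have "x = i * l + x mod l" using 1 div_mult_mod_eq[of x l] by simp
    moreover have "x < n" using 1 assms by (simp add: lt_n_iff)
    moreover have "x mod l < l + a" using l_pos by (simp add: trans_less_add1)
    ultimately show ?thesis by (intro CollectI exI[of _ "x mod l"]) (metis mod_less)
  next
    case 2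
    have "(i * l + (l + x mod l)) div l = Suc i" using l_pos by (simp add: div_add1_eq)
    then have "(i * l + (l + x mod l)) mod n = x"
      using md[of "l + x mod l"] 2(1) mult_div_mod_eq[of l x] by (simp del: mult_div_mod_eq)
    then show ?thesis using 2 by (intro CollectI exI[of _ "l + x mod l"]) auto
  qed
qed
qed

text \<open>The cyclic order witnessing the cycle is \<open>\<sigma> \<circ> \<psi>\<close>, where
  \<psi> permutes the inner blocks as whole blocks according to the matching and fixes the joint
  blocks. The edge with index \<open>i\<close> is then the image of the window starting at
  \<open>i * l\<close>.\<close>

lemma hamilton_cycle_of_matching:
  assumes \<sigma>: "\<sigma> permutes {0..<n}" and \<phi>: "bij_betw \<phi> {..<N} {..<N}"
    and E: "\<And>i. i < N \<Longrightarrow> block_edge l a N \<sigma> i (\<phi> i) \<in> E"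
  shows "ham_cycle n (l + a) l E ((\<lambda>i. block_edge l a N \<sigma> i (\<phi> i)) ` {0..<N})"
proof -
  have inj\<sigma>: "inj \<sigma>" using \<sigma> by (rule permutes_inj)
  have Nl: "n div l = N" using n l_pos by simp
  define \<psi> where "\<psi> x = (if x mod l < a then x else \<phi> (x div l) * l + x mod l)" for x
  have \<psi>_div: "\<psi> x div l = (if x mod l < a then x div l else \<phi> (x div l))"
    and \<psi>_mod: "\<psi> x mod l = x mod l" for x
    using l_pos by (auto simp: \<psi>_def)
  have \<phi>N: "\<phi> i < N" if "i < N" for i using \<phi> that by (auto simp: bij_betw_def)
  have inj\<phi>: "\<phi> i = \<phi> i' \<Longrightarrow> i = i'" if "i < N" "i' < N" for i i'
    using \<phi> that by (auto simp: bij_betw_def inj_on_def)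
  have \<psi>_lt: "\<psi> x < n" if "x < n" for x
    using that \<phi>N by (auto simp: lt_n_iff \<psi>_div)
  have inj\<psi>: "inj_on \<psi> {0..<n}"
  proof (rule inj_onI)
    fix x y assume xy: "x \<in> {0..<n}" "y \<in> {0..<n}" "\<psi> x = \<psi> y"
    have m: "x mod l = y mod l" using \<psi>_mod[of x] \<psi>_mod[of y] xy by simp
    have "x div l = y div l"
      using \<psi>_div[of x] \<psi>_div[of y] xy m inj\<phi>[of "x div l" "y div l"]
      by (auto simp: lt_n_iff split: if_splits)
    then show "x = y" using m by (metis div_mult_mod_eq)
  qed
  have "\<psi> ` {0..<n} \<subseteq> {0..<n}" using \<psi>_lt by auto
  then have bij\<psi>: "bij_betw \<psi> {0..<n} {0..<n}"
    using inj\<psi> endo_inj_surj[of "{0..<n}" \<psi>] by (simp add: bij_betw_def)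
  have img: "\<psi> ` (L i \<union> B i) = L i \<union> B (\<phi> i)" if i: "i < N" for i
  proof -
    have "\<psi> ` L i = L i" by (auto simp: \<psi>_def block_iffs image_iff)
    moreover have "\<psi> ` B i = B (\<phi> i)"
    proof (rule card_subset_eq)
      show "finite (B (\<phi> i))" by (simp add: inner_block_def)
      show "\<psi> ` B i \<subseteq> B (\<phi> i)" using \<psi>_div \<psi>_mod by (auto simp: block_iffs)
      show "card (\<psi> ` B i) = card (B (\<phi> i))"
        using inner_block_subset[OF i] by (simp add: card_image inj_on_subset[OF inj\<psi>] card_inner_block)
    qed
    ultimately show ?thesis by (simp add: image_Un)
  qed
  define f where "f i = block_edge l a N \<sigma> i (\<phi> i)" for i
  have f_eq: "f i = (\<sigma> \<circ> \<psi>) ` {(i * l + j) mod n | j. j < l + a}" if "i < N" for i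
    unfolding window_eq[OF that] image_comp[symmetric] img[OF that] by (simp add: f_def block_edge_def)
  show ?thesis
    unfolding ham_cycle_def Nl
  proof (intro conjI exI[of _ "\<sigma> \<circ> \<psi>"] exI[of _ f])
    show "l dvd n" by (simp add: n)
    show "(\<lambda>i. block_edge l a N \<sigma> i (\<phi> i)) ` {0..<N} \<subseteq> E" using E by auto
    show "bij_betw (\<sigma> \<circ> \<psi>) {0..<n} {0..<n}"
      using bij\<psi> permutes_imp_bij[OF \<sigma>] by (rule bij_betw_trans)
    show "inj_on f {0..<N}"
      unfolding f_def by (rule inj_onI) (use block_edge_inject[OF inj\<sigma>] in auto)
    show "(\<lambda>i. block_edge l a N \<sigma> i (\<phi> i)) ` {0..<N} = f ` {0..<N}" by (simp add: f_def)
    show "\<forall>i<N. \<exists>s<n. f i = (\<sigma> \<circ> \<psi>) ` {(s + j) mod n | j. j < l + a}"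
    proof (intro allI impI)
      fix i assume i: "i < N"
      then have "i * l < n" using l_pos by (simp add: n)
      then show "\<exists>s<n. f i = (\<sigma> \<circ> \<psi>) ` {(s + j) mod n | j. j < l + a}" using f_eq[OF i] by blast
    qed
    show "\<forall>i<N. card (f ((i + N - 1) mod N) - f i) = l"
    proof (intro allI impI)
      fix i assume i: "i < N"
      define h where "h = (i + N - 1) mod N"
      have hN: "h < N" using N by (simp add: h_def)
      have h: "h = (if i = 0 then N - 1 else i - 1)"
      proof (cases i)
        case (Suc i')
        then have "h = (i' + N) mod N" by (simp add: h_def)
        then show ?thesis using Suc i by simp
      qed (use N in \<open>simp add: h_def\<close>)
      have hi: "Suc h mod N = i" using h i N by auto
      have ne: "h \<noteq> i" "h \<noteq> Suc i mod N" using h i N by (auto simp: Suc_mod_eq split: if_splits)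
      have "\<phi> h \<noteq> \<phi> i" using ne inj\<phi>[OF hN i] by blast
      \<comment> \<open>Of its predecessor's two joint blocks, edge \<open>i\<close> meets only the
        second, because \<open>h\<close> differs from \<open>Suc i mod N\<close>. What remains is
        one joint and one inner block, \<open>a + (l - a) = l\<close> vertices.\<close>
      then have "(L h \<union> B (\<phi> h)) - (L i \<union> B (\<phi> i)) = joint_block l a h \<union> B (\<phi> h)"
        using hi ne by (auto simp: block_iffs)
      then have "f h - f i = \<sigma> ` (joint_block l a h \<union> B (\<phi> h))"
        unfolding f_def block_edge_def using inj\<sigma> by (simp add: image_set_diff[symmetric])
      also have "card \<dots> = card (joint_block l a h \<union> B (\<phi> h))"
        using inj\<sigma> by (intro card_image inj_on_subset[OF inj\<sigma>]) auto
      also have "\<dots> = a + (l - a)"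
        by (subst card_Un_disjoint) (auto simp: card_inner_block block_iffs, auto simp: joint_block_def inner_block_def)
      finally show "card (f ((i + N - 1) mod N) - f i) = l" using a by (simp add: h_def)
    qed
  qed
qed

section \<open>Degrees and codegrees for a random ordering\<close>

text \<open>A union bound over the rows, the columns and the pairs of each. The correction \<kappa>
  is forced by joint pairs: their codegree hypothesis is normalised by
  \<open>n choose (l - a)\<close>, whereas the inner blocks are placed among the vertices outside
  both pairs. For inner blocks the hypothesis already has the exact binomial.\<close>

lemma few_bad_permutations:
  fixes e p s \<kappa> :: real
  assumes H: "uniform_hypergraph n (l + a) E"
    and s: "0 \<le> s" and e: "0 \<le> e" and big: "4 * a + (l - a) \<le> n"
    and \<kappa>: "real (n choose (l - a)) \<le> (1 + \<kappa>) * real (n - 4 * a choose (l - a))" "0 \<le> \<kappa>"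
    and degL: "\<And>S. S \<subseteq> {0..<n} \<Longrightarrow> card S = 2 * a \<Longrightarrow>
      (1 - e) * real (n - 2 * a choose (l - a)) * p \<le> deg n (l + a) E S"
    and degR: "\<And>S. S \<subseteq> {0..<n} \<Longrightarrow> card S = l - a \<Longrightarrow>
      (1 - e) * real (n - (l - a) choose (2 * a)) * p \<le> deg n (l + a) E S"
    and codegL: "\<And>S S'. S \<subseteq> {0..<n} \<Longrightarrow> S' \<subseteq> {0..<n} \<Longrightarrow> card S = 2 * a \<Longrightarrow> card S' = 2 * a \<Longrightarrow>
      card (S \<inter> S') \<in> {0, a} \<Longrightarrow>
      card (nbhd n (l + a) E S \<inter> nbhd n (l + a) E S') \<le> (1 + e) * real (n choose (l - a)) * p\<^sup>2"
    and codegR: "\<And>S S'. S \<subseteq> {0..<n} \<Longrightarrow> S' \<subseteq> {0..<n} \<Longrightarrow> card S = l - a \<Longrightarrow> card S' = l - a \<Longrightarrow>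
      S \<inter> S' = {} \<Longrightarrow>
      card (nbhd n (l + a) E S \<inter> nbhd n (l + a) E S') \<le> (1 + e) * real (n - 2 * (l - a) choose (2 * a)) * p\<^sup>2"
  shows "real (card {\<sigma>. \<sigma> permutes {0..<n} \<and> \<not> degree_bounds N (N * ((1 - e) * p) - s)
        (N * ((1 + e) * (1 + \<kappa>) * p\<^sup>2) + s) (block_graph l a N E \<sigma>)})
    \<le> 4 * (real N)\<^sup>2 * (fact n * exp (- (s\<^sup>2 / (64 * real n))))"
proof -
  define \<Gamma> where "\<Gamma> = block_graph l a N E"
  define good where "good \<sigma> \<longleftrightarrow>
    degree_bounds N (N * ((1 - e) * p) - s) (N * ((1 + e) * (1 + \<kappa>) * p\<^sup>2) + s) (\<Gamma> \<sigma>)" for \<sigma>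
  define \<delta> where "\<delta> = fact n * exp (- (s\<^sup>2 / (64 * real n)))"
  have \<delta>0: "0 \<le> \<delta>" by (simp add: \<delta>_def)
  let ?V = "{0..<n}" and ?k = "l + a"
  have k: "card (L i) = ?k - (l - a)" "card (B j) = ?k - 2 * a" if "i < N" for i j
    using a that by (simp_all add: card_joint_pair card_inner_block)
  have perm_img: "\<sigma> ` S \<subseteq> ?V" "card (\<sigma> ` S) = card S" "\<sigma> ` S \<inter> \<sigma> ` S' = \<sigma> ` (S \<inter> S')"
    if "\<sigma> permutes ?V" "S \<subseteq> ?V" for \<sigma> S S'
    using that permutes_image[OF that(1)] permutes_inj[OF that(1)]
    by (auto simp: card_image inj_on_subset image_Int)
  have LB: "B j \<subseteq> ?V - (L i \<union> L i') \<and> card (B j) = l - a" if "j \<in> {..<N}" for i i' j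
    using joint_inner_disjoint[of i j] joint_inner_disjoint[of i' j] inner_block_subset[of j] that
    by (auto simp: card_inner_block)
  have BL: "L i \<subseteq> ?V - (B j \<union> B j') \<and> card (L i) = 2 * a" if "i \<in> {..<N}" for i j j'
    using joint_inner_disjoint[of i j] joint_inner_disjoint[of i j'] joint_pair_subset[of i] that
    by (auto simp: card_joint_pair)
  have eqL: "{j. (i, j) \<in> \<Gamma> \<sigma> \<and> (i', j) \<in> \<Gamma> \<sigma>} =
      {j \<in> {..<N}. \<sigma> ` (L i \<union> B j) \<in> E \<and> \<sigma> ` (L i' \<union> B j) \<in> E}" if "i < N" "i' < N" for i i' \<sigma>
    using that by (auto simp: \<Gamma>_def block_graph_def block_edge_def)
  have eqR: "{i. (i, j) \<in> \<Gamma> \<sigma> \<and> (i, j') \<in> \<Gamma> \<sigma>} =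
      {i \<in> {..<N}. \<sigma> ` (B j \<union> L i) \<in> E \<and> \<sigma> ` (B j' \<union> L i) \<in> E}" if "j < N" "j' < N" for j j' \<sigma>
    using that by (auto simp: \<Gamma>_def block_graph_def block_edge_def Un_commute)
  have b1: "real (card {\<sigma>. \<sigma> permutes ?V \<and> card {j. (i, j) \<in> \<Gamma> \<sigma>} \<le> N * ((1 - e) * p) - s}) \<le> \<delta>"
    if i: "i < N" for i
  proof -
    have "real (card {\<sigma>. \<sigma> permutes ?V \<and>
        card {j \<in> {..<N}. \<sigma> ` (L i \<union> B j) \<in> E \<and> \<sigma> ` (L i \<union> B j) \<in> E} \<le> N * ((1 - e) * p) - s})
      \<le> fact n * exp (- (s\<^sup>2 / (64 * real n)))"
    proof (rule codegree_lower_tail[OF H _ _ _ _ _ _ LB inner_block_multiplicity n_pos s])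
      fix \<sigma> assume \<sigma>: "\<sigma> permutes ?V"
      have c: "card (?V - (L i \<union> L i)) = n - 2 * a"
        using joint_pair_subset[OF i] card_joint_pair[OF i] by (simp add: card_Diff_subset finite_subset)
      have "(1 - e) * real (n - 2 * a choose (l - a)) * p \<le> deg n ?k E (\<sigma> ` L i)"
        by (rule degL) (simp_all add: perm_img[OF \<sigma> joint_pair_subset[OF i]] card_joint_pair[OF i])
      moreover have "0 < real (n - 2 * a choose (l - a))" using big by (simp add: zero_less_binomial_iff)
      ultimately have "(1 - e) * p \<le> deg n ?k E (\<sigma> ` L i) / real (n - 2 * a choose (l - a))"
        by (simp add: pos_le_divide_eq mult.assoc mult.commute mult.left_commute)
      then show "N * ((1 - e) * p) \<le> card {..<N} * (real (card (nbhd n ?k E (\<sigma> ` L i) \<inter> nbhd n ?k E (\<sigma> ` L i)))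
          / real (card (?V - (L i \<union> L i)) choose (l - a)))"
        unfolding c deg_def card_lessThan Int_absorb by (rule mult_left_mono) simp
    qed (use joint_pair_subset[OF i] k[OF i] in auto)
    then show ?thesis using eqL[OF i i] by (simp add: \<delta>_def)
  qed
  have b2: "real (card {\<sigma>. \<sigma> permutes ?V \<and> card {i. (i, j) \<in> \<Gamma> \<sigma>} \<le> N * ((1 - e) * p) - s}) \<le> \<delta>"
    if j: "j < N" for j
  proof -
    have "real (card {\<sigma>. \<sigma> permutes ?V \<and>
        card {i \<in> {..<N}. \<sigma> ` (B j \<union> L i) \<in> E \<and> \<sigma> ` (B j \<union> L i) \<in> E} \<le> N * ((1 - e) * p) - s})
      \<le> fact n * exp (- (s\<^sup>2 / (64 * real n)))"
    proof (rule codegree_lower_tail[OF H _ _ _ _ _ _ BL joint_pair_multiplicity n_pos s])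
      fix \<sigma> assume \<sigma>: "\<sigma> permutes ?V"
      have c: "card (?V - (B j \<union> B j)) = n - (l - a)"
        using inner_block_subset[OF j] card_inner_block[of j] by (simp add: card_Diff_subset finite_subset)
      have "(1 - e) * real (n - (l - a) choose (2 * a)) * p \<le> deg n ?k E (\<sigma> ` B j)"
        by (rule degR) (simp_all add: perm_img[OF \<sigma> inner_block_subset[OF j]] card_inner_block)
      moreover have "0 < real (n - (l - a) choose (2 * a))" using big by (simp add: zero_less_binomial_iff)
      ultimately have "(1 - e) * p \<le> deg n ?k E (\<sigma> ` B j) / real (n - (l - a) choose (2 * a))"
        by (simp add: pos_le_divide_eq mult.assoc mult.commute mult.left_commute)
      then show "N * ((1 - e) * p) \<le> card {..<N} * (real (card (nbhd n ?k E (\<sigma> ` B j) \<inter> nbhd n ?k E (\<sigma> ` B j)))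
          / real (card (?V - (B j \<union> B j)) choose (2 * a)))"
        unfolding c deg_def card_lessThan Int_absorb by (rule mult_left_mono) simp
    qed (use inner_block_subset[OF j] k[OF j] a in auto)
    then show ?thesis using eqR[OF j j] by (simp add: \<delta>_def)
  qed
  have b3: "real (card {\<sigma>. \<sigma> permutes ?V \<and>
      N * ((1 + e) * (1 + \<kappa>) * p\<^sup>2) + s \<le> card {j. (i, j) \<in> \<Gamma> \<sigma> \<and> (i', j) \<in> \<Gamma> \<sigma>}}) \<le> \<delta>"
    if i: "i < N" "i' < N" "i \<noteq> i'" for i i'
  proof -
    have "real (card {\<sigma>. \<sigma> permutes ?V \<and> N * ((1 + e) * (1 + \<kappa>) * p\<^sup>2) + s \<le>
        card {j \<in> {..<N}. \<sigma> ` (L i \<union> B j) \<in> E \<and> \<sigma> ` (L i' \<union> B j) \<in> E}})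
      \<le> fact n * exp (- (s\<^sup>2 / (64 * real n)))"
    proof (rule codegree_upper_tail[OF H _ _ _ _ _ _ LB inner_block_multiplicity n_pos s])
      fix \<sigma> assume \<sigma>: "\<sigma> permutes ?V"
      let ?m = "card (?V - (L i \<union> L i'))"
      have "card (L i \<union> L i') \<le> 4 * a"
        using card_Un_le[of "L i" "L i'"] i by (simp add: card_joint_pair)
      \<comment> \<open>Two joint pairs may or may not share a block; the common lower bound for the
        number of free vertices covers both cases.\<close>
      then have "n - 4 * a \<le> ?m"
        using joint_pair_subset[OF i(1)] joint_pair_subset[OF i(2)]
        by (simp add: card_Diff_subset finite_subset)
      then have m: "n - 4 * a choose (l - a) \<le> ?m choose (l - a)" by (rule binomial_right_mono)
      have pos: "0 < n - 4 * a choose (l - a)" using big by (simp add: zero_less_binomial_iff)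
      have "card (\<sigma> ` L i \<inter> \<sigma> ` L i') = card (L i \<inter> L i')"
        using permutes_inj[OF \<sigma>] by (simp add: image_Int[symmetric] card_image inj_on_subset)
      then have "card (nbhd n ?k E (\<sigma> ` L i) \<inter> nbhd n ?k E (\<sigma> ` L i')) \<le> (1 + e) * real (n choose (l - a)) * p\<^sup>2"
        using card_joint_pair_Int[OF i] i
        by (intro codegL) (simp_all add: perm_img[OF \<sigma> joint_pair_subset] card_joint_pair)
      also have "\<dots> \<le> (1 + e) * ((1 + \<kappa>) * real (?m choose (l - a))) * p\<^sup>2"
      proof -
        have "(1 + \<kappa>) * real (n - 4 * a choose (l - a)) \<le> (1 + \<kappa>) * real (?m choose (l - a))"
          using \<kappa>(2) m by (intro mult_left_mono) auto
        then have "real (n choose (l - a)) \<le> (1 + \<kappa>) * real (?m choose (l - a))"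
          using \<kappa>(1) by linarith
        then show ?thesis using e by (intro mult_right_mono mult_left_mono) auto
      qed
      finally have "card (nbhd n ?k E (\<sigma> ` L i) \<inter> nbhd n ?k E (\<sigma> ` L i')) / real (?m choose (l - a))
          \<le> (1 + e) * (1 + \<kappa>) * p\<^sup>2"
        using pos m by (subst pos_divide_le_eq) (linarith, simp only: mult_ac)
      then show "card {..<N} * (real (card (nbhd n ?k E (\<sigma> ` L i) \<inter> nbhd n ?k E (\<sigma> ` L i')))
          / real (?m choose (l - a))) \<le> N * ((1 + e) * (1 + \<kappa>) * p\<^sup>2)"
        unfolding card_lessThan by (rule mult_left_mono) simp
    qed (use joint_pair_subset i k in auto)
    then show ?thesis using eqL[OF i(1,2)] by (simp add: \<delta>_def)
  qed
  have b4: "real (card {\<sigma>. \<sigma> permutes ?V \<and>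
      N * ((1 + e) * (1 + \<kappa>) * p\<^sup>2) + s \<le> card {i. (i, j) \<in> \<Gamma> \<sigma> \<and> (i, j') \<in> \<Gamma> \<sigma>}}) \<le> \<delta>"
    if j: "j < N" "j' < N" "j \<noteq> j'" for j j'
  proof -
    have "real (card {\<sigma>. \<sigma> permutes ?V \<and> N * ((1 + e) * (1 + \<kappa>) * p\<^sup>2) + s \<le>
        card {i \<in> {..<N}. \<sigma> ` (B j \<union> L i) \<in> E \<and> \<sigma> ` (B j' \<union> L i) \<in> E}})
      \<le> fact n * exp (- (s\<^sup>2 / (64 * real n)))"
    proof (rule codegree_upper_tail[OF H _ _ _ _ _ _ BL joint_pair_multiplicity n_pos s])
      fix \<sigma> assume \<sigma>: "\<sigma> permutes ?V"
      let ?m = "card (?V - (B j \<union> B j'))"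
      have "card (B j \<union> B j') = 2 * (l - a)"
        using inner_blocks_disjoint[OF j(3)]
        by (subst card_Un_disjoint) (auto simp: card_inner_block, simp_all add: inner_block_def)
      then have m: "?m = n - 2 * (l - a)"
        using inner_block_subset[OF j(1)] inner_block_subset[OF j(2)]
        by (simp add: card_Diff_subset finite_subset)
      have "3 * l \<le> n" using N by (simp add: n)
      then have pos: "0 < ?m choose (2 * a)" using m a by (simp add: zero_less_binomial_iff)
      have "\<sigma> ` B j \<inter> \<sigma> ` B j' = {}"
        using permutes_inj[OF \<sigma>] inner_blocks_disjoint[OF j(3)] by (simp add: image_Int[symmetric])
      then have "card (nbhd n ?k E (\<sigma> ` B j) \<inter> nbhd n ?k E (\<sigma> ` B j')) \<le> (1 + e) * real (?m choose (2 * a)) * p\<^sup>2"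
        unfolding m using j
        by (intro codegR) (simp_all add: perm_img[OF \<sigma> inner_block_subset] card_inner_block)
      also have "\<dots> \<le> (1 + e) * (1 + \<kappa>) * real (?m choose (2 * a)) * p\<^sup>2"
        using \<kappa>(2) e by (intro mult_right_mono) auto
      finally have "card (nbhd n ?k E (\<sigma> ` B j) \<inter> nbhd n ?k E (\<sigma> ` B j')) / real (?m choose (2 * a))
          \<le> (1 + e) * (1 + \<kappa>) * p\<^sup>2"
        using pos by (subst pos_divide_le_eq) (auto simp: algebra_simps)
      then show "card {..<N} * (real (card (nbhd n ?k E (\<sigma> ` B j) \<inter> nbhd n ?k E (\<sigma> ` B j')))
          / real (?m choose (2 * a))) \<le> N * ((1 + e) * (1 + \<kappa>) * p\<^sup>2)"
        unfolding card_lessThan by (rule mult_left_mono) simp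
    qed (use inner_block_subset j k a in auto)
    then show ?thesis using eqR[OF j(1,2)] by (simp add: \<delta>_def)
  qed
  define F1 where "F1 i = {\<sigma>. \<sigma> permutes ?V \<and> card {j. (i, j) \<in> \<Gamma> \<sigma>} \<le> N * ((1 - e) * p) - s}" for i
  define F2 where "F2 j = {\<sigma>. \<sigma> permutes ?V \<and> card {i. (i, j) \<in> \<Gamma> \<sigma>} \<le> N * ((1 - e) * p) - s}" for j
  \<comment> \<open>The empty set on the diagonal allows the union to run over all pairs of
    indices.\<close>
  define F3 where "F3 i i' = (if i = i' then {} else {\<sigma>. \<sigma> permutes ?V \<and>
      N * ((1 + e) * (1 + \<kappa>) * p\<^sup>2) + s \<le> card {j. (i, j) \<in> \<Gamma> \<sigma> \<and> (i', j) \<in> \<Gamma> \<sigma>}})" for i i'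
  define F4 where "F4 j j' = (if j = j' then {} else {\<sigma>. \<sigma> permutes ?V \<and>
      N * ((1 + e) * (1 + \<kappa>) * p\<^sup>2) + s \<le> card {i. (i, j) \<in> \<Gamma> \<sigma> \<and> (i, j') \<in> \<Gamma> \<sigma>}})" for j j'
  have finP: "finite {\<sigma>. \<sigma> permutes ?V}" by (simp add: finite_permutations)
  have finF: "finite (F1 i)" "finite (F2 i)" "finite (F3 i j)" "finite (F4 i j)" for i j
    using finP by (auto simp: F1_def F2_def F3_def F4_def intro: finite_subset)
  have F: "card (F1 i) \<le> \<delta>" "card (F2 i) \<le> \<delta>" "card (F3 i j) \<le> \<delta>" "card (F4 i j) \<le> \<delta>"
    if "i < N" "j < N" for i j
    using that b1 b2 b3 b4 \<delta>0 by (auto simp: F1_def F2_def F3_def F4_def)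
  let ?U1 = "\<Union>i<N. F1 i" and ?U2 = "\<Union>i<N. F2 i"
    and ?U3 = "\<Union>i<N. \<Union>j<N. F3 i j" and ?U4 = "\<Union>i<N. \<Union>j<N. F4 i j"
  have un1: "real (card (\<Union>i<N. F i)) \<le> N * c" if "\<And>i. i < N \<Longrightarrow> card (F i) \<le> c"
    for F :: "nat \<Rightarrow> (nat \<Rightarrow> nat) set" and c :: real
  proof -
    have "real (card (\<Union>i<N. F i)) \<le> real (\<Sum>i<N. card (F i))"
      by (rule of_nat_mono, rule card_UN_le) simp
    also have "\<dots> \<le> (\<Sum>i<N. c)" unfolding of_nat_sum using that by (intro sum_mono) auto
    finally show ?thesis by simp
  qed
  have "{\<sigma>. \<sigma> permutes ?V \<and> \<not> good \<sigma>} \<subseteq> ?U1 \<union> ?U2 \<union> ?U3 \<union> ?U4"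
  proof
    fix \<sigma> assume "\<sigma> \<in> {\<sigma>. \<sigma> permutes ?V \<and> \<not> good \<sigma>}"
    then have \<sigma>: "\<sigma> permutes ?V" and ng: "\<not> good \<sigma>" by auto
    from ng consider i where "i < N" "\<sigma> \<in> F1 i" | j where "j < N" "\<sigma> \<in> F2 j"
      | i i' where "i < N" "i' < N" "\<sigma> \<in> F3 i i'" | j j' where "j < N" "j' < N" "\<sigma> \<in> F4 j j'"
      using \<sigma> unfolding good_def degree_bounds_def F1_def F2_def F3_def F4_def
      by (auto simp: not_le intro: less_imp_le)
    then show "\<sigma> \<in> ?U1 \<union> ?U2 \<union> ?U3 \<union> ?U4"
    proof cases
      case 1
      then have "\<sigma> \<in> ?U1" by blast
      then show ?thesis by (intro UnI1)
    next
      case 2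
      then have "\<sigma> \<in> ?U2" by blast
      then show ?thesis by (rule UnI2[THEN UnI1, THEN UnI1])
    next
      case 3
      then have "\<sigma> \<in> ?U3" by blast
      then show ?thesis by (rule UnI2[THEN UnI1])
    next
      case 4
      then have "\<sigma> \<in> ?U4" by blast
      then show ?thesis by (rule UnI2)
    qed
  qed
  then have "card {\<sigma>. \<sigma> permutes ?V \<and> \<not> good \<sigma>} \<le> card (?U1 \<union> ?U2 \<union> ?U3 \<union> ?U4)"
    using finF by (intro card_mono) auto
  also have "\<dots> \<le> card ?U1 + card ?U2 + card ?U3 + card ?U4"
    using card_Un_le[of "?U1 \<union> ?U2 \<union> ?U3" ?U4] card_Un_le[of "?U1 \<union> ?U2" ?U3] card_Un_le[of ?U1 ?U2]
    by linarith
  finally have "real (card {\<sigma>. \<sigma> permutes ?V \<and> \<not> good \<sigma>})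
      \<le> real (card ?U1) + real (card ?U2) + real (card ?U3) + real (card ?U4)" by linarith
  moreover have "real (card ?U1) \<le> N * \<delta>" "real (card ?U2) \<le> N * \<delta>"
    by (intro un1; use F in blast)+
  moreover have "real (card ?U3) \<le> N * (N * \<delta>)" "real (card ?U4) \<le> N * (N * \<delta>)"
    by (intro un1; use F in blast)+
  \<comment> \<open>Each family of \<open>N\<close> degree events is charged as if it had
    \<open>N * N\<close> members, which gives the factor 4.\<close>
  moreover have "N * \<delta> \<le> N * (N * \<delta>)" 
    using mult_right_mono[of 1 "real N" \<delta>] \<delta>0 N by (intro mult_left_mono) auto
  ultimately have "real (card {\<sigma>. \<sigma> permutes ?V \<and> \<not> good \<sigma>}) \<le> 4 * (N * (N * \<delta>))" by linarith
  then show ?thesis by (simp add: \<delta>_def power2_eq_square good_def \<Gamma>_def)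
qed

text \<open>Each of the \<open>N * N\<close> slots receives a uniformly random set of
  \<open>l + a\<close> vertices. The union bound is not wasteful: by injectivity of block edges an
  ordering covers \<open>e\<close> through at most one slot, so the final packing count can be
  asymptotically sharp.\<close>

lemma card_permutations_covering:
  assumes e: "card e = l + a"
  shows "real (card {\<sigma>. \<sigma> permutes {0..<n} \<and> (\<exists>i<N. \<exists>j<N. block_edge l a N \<sigma> i j = e)})
    \<le> (real N)\<^sup>2 * (fact n / real (n choose (l + a)))"
proof -
  let ?A = "\<lambda>i j. {\<sigma>. \<sigma> permutes {0..<n} \<and> block_edge l a N \<sigma> i j = e}"
  have A: "real (card (?A i j)) \<le> fact n / real (n choose (l + a))" if ij: "i < N" "j < N" for i j
  proof (cases "e \<subseteq> {0..<n}")
    case True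
    have c: "card (L i \<union> B j) = l + a" using card_block_edge[of id i j] ij by (simp add: block_edge_def)
    have "L i \<union> B j \<subseteq> {0..<n}" using joint_pair_subset inner_block_subset ij by auto
    from card_permutations_image_eq[OF _ this True] show ?thesis
      using e by (simp add: block_edge_def c)
  next
    case False
    have "?A i j = {}"
    proof -
      have "block_edge l a N \<sigma> i j \<subseteq> {0..<n}" if "\<sigma> permutes {0..<n}" for \<sigma>
        using permutes_image[OF that] joint_pair_subset inner_block_subset ij
        unfolding block_edge_def by blast
      then show ?thesis using False by blast
    qed
    then show ?thesis by (metis card.empty of_nat_0 divide_nonneg_nonneg fact_ge_zero of_nat_0_le_iff)
  qed
  have "{\<sigma>. \<sigma> permutes {0..<n} \<and> (\<exists>i<N. \<exists>j<N. block_edge l a N \<sigma> i j = e)} = (\<Union>z\<in>{..<N} \<times> {..<N}. ?A (fst z) (snd z))"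
    by force
  then have "real (card {\<sigma>. \<sigma> permutes {0..<n} \<and> (\<exists>i<N. \<exists>j<N. block_edge l a N \<sigma> i j = e)})
    \<le> real (\<Sum>z\<in>{..<N} \<times> {..<N}. card (?A (fst z) (snd z)))"
    by (simp only:) (rule of_nat_mono, rule card_UN_le, simp)
  also have "\<dots> \<le> (\<Sum>z\<in>{..<N} \<times> {..<N}. fact n / real (n choose (l + a)))"
    unfolding of_nat_sum using A by (intro sum_mono) auto
  finally show ?thesis by (simp add: power2_eq_square)
qed

end

section \<open>Distributing the edges among many orderings\<close>

text \<open>\<open>D j\<close> holds the one hyperedge (degree) or two hyperedges (codegree) that
  must all receive their target colour \<open>t\<close>. Disjointness makes each colour influence at
  most one index, and at most \<open>2 * N\<close> colours are involved; hence the variance proxy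
  \<open>2 * N\<close> and the denominator \<open>8 * N\<close>.\<close>

lemma
  fixes D :: "'j \<Rightarrow> 'e set" and t :: "'e \<Rightarrow> nat" and K N :: nat and s :: real
  assumes E: "finite E" and K: "0 < K" and J: "finite J" "card J \<le> N" and N: "0 < N"
    and D: "\<And>j. j \<in> J \<Longrightarrow> D j \<subseteq> E \<and> card (D j) = g" and g: "g \<le> 2"
    and disj: "disjoint_family_on D J"
    and t: "\<And>j e. j \<in> J \<Longrightarrow> e \<in> D j \<Longrightarrow> t e < K" and s: "0 \<le> s"
  shows colouring_upper_tail:
      "card {c \<in> PiE E (\<lambda>_. {..<K}). real (card J) / K ^ g + s \<le> card {j \<in> J. \<forall>e\<in>D j. c e = t e}}
        \<le> K ^ card E * exp (- (s\<^sup>2 / (8 * real N)))"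
    and colouring_lower_tail:
      "card {c \<in> PiE E (\<lambda>_. {..<K}). card {j \<in> J. \<forall>e\<in>D j. c e = t e} \<le> real (card J) / K ^ g - s}
        \<le> K ^ card E * exp (- (s\<^sup>2 / (8 * real N)))"
proof -
  let ?\<Omega> = "PiE E (\<lambda>_. {..<K})"
  define f where "f c = real (card {j \<in> J. \<forall>e\<in>D j. c e = t e})" for c :: "'e \<Rightarrow> nat"
  define U where "U = \<Union>(D ` J)"
  define C :: "'e \<Rightarrow> real" where "C x = (if x \<in> U then 1 else 0)" for x
  have finD: "finite (D j)" if "j \<in> J" for j using D[OF that] E finite_subset by blast
  have U: "U \<subseteq> E" "card U \<le> 2 * N"
  proof -
    show "U \<subseteq> E" using D by (auto simp: U_def)
    have "card U = (\<Sum>j\<in>J. card (D j))"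
      unfolding U_def using J finD disj by (intro card_UN_disjoint) (auto simp: disjoint_family_on_def)
    also have "\<dots> = card J * g" using D by simp
    also have "\<dots> \<le> N * 2" using J g by (intro mult_le_mono)
    finally show "card U \<le> 2 * N" by simp
  qed
  have sumC: "(\<Sum>x\<in>E. (C x)\<^sup>2) \<le> 2 * real N"
  proof -
    have "(\<Sum>x\<in>E. (C x)\<^sup>2) = (\<Sum>x\<in>E. if x \<in> U then 1 else 0)" by (intro sum.cong) (auto simp: C_def)
    also have "\<dots> = card U" using E U by (simp add: sum.If_cases Int_absorb1)
    finally show ?thesis using U by linarith
  qed
  have lip: "\<bar>f (c(x := v)) - f c\<bar> \<le> C x" for c x v
  proof (cases "x \<in> U")
    case False
    then have "{j \<in> J. \<forall>e\<in>D j. (c(x := v)) e = t e} = {j \<in> J. \<forall>e\<in>D j. c e = t e}" by (auto simp: U_def)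
    then show ?thesis by (simp add: f_def C_def False del: fun_upd_apply)
  next
    case True
    then obtain j0 where j0: "j0 \<in> J" "x \<in> D j0" by (auto simp: U_def)
    have other: "x \<notin> D j" if "j \<in> J - {j0}" for j
      using disj that j0 by (auto simp: disjoint_family_on_def)
    have "f (c(x := v)) - f c \<le> card {j0}" "f c - f (c(x := v)) \<le> card {j0}"
      unfolding f_def by (intro card_Collect_diff_le; use J j0 other in auto)+
    then show ?thesis using True by (simp add: C_def del: fun_upd_apply)
  qed
  have cO: "card {c \<in> ?\<Omega>. \<forall>e\<in>D j. c e = t e} = K ^ (card E - g)" if j: "j \<in> J" for j
  proof -
    have eq: "{c \<in> ?\<Omega>. \<forall>e\<in>D j. c e = t e} = PiE E (\<lambda>e. if e \<in> D j then {t e} else {..<K})"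
      using t[OF j] D[OF j] by (auto simp: PiE_iff extensional_def split: if_splits)
    have "card (PiE E (\<lambda>e. if e \<in> D j then {t e} else {..<K})) = (\<Prod>e\<in>E. if e \<in> D j then 1 else K)"
      using E by (subst card_PiE) (auto intro: prod.cong)
    also have "\<dots> = K ^ card (E - D j)"
      using E by (simp add: prod.If_cases Diff_eq)
    also have "card (E - D j) = card E - g" using D[OF j] finD[OF j] by (simp add: card_Diff_subset)
    finally show ?thesis using eq by simp
  qed
  have fin: "finite ?\<Omega>" using E by (simp add: finite_PiE)
  have mean: "(\<Sum>c\<in>?\<Omega>. f c) / real (card {..<K} ^ card E) = real (card J) / K ^ g"
  proof (cases "J = {}")
    case False
    then obtain j where j: "j \<in> J" by blast
    have gE: "g \<le> card E" using D[OF j] card_mono[OF E, of "D j"] by simp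
    have "(\<Sum>c\<in>?\<Omega>. f c) = (\<Sum>c\<in>?\<Omega>. \<Sum>j\<in>J. if \<forall>e\<in>D j. c e = t e then 1 else 0)"
      using J by (intro sum.cong) (simp_all add: f_def sum.If_cases Collect_conj_eq)
    also have "\<dots> = (\<Sum>j\<in>J. \<Sum>c\<in>?\<Omega>. if \<forall>e\<in>D j. c e = t e then 1 else 0)" by (rule sum.swap)
    also have "\<dots> = (\<Sum>j\<in>J. real (K ^ (card E - g)))"
    proof (rule sum.cong[OF refl])
      fix j assume j: "j \<in> J"
      have "(\<Sum>c\<in>?\<Omega>. if \<forall>e\<in>D j. c e = t e then 1 else (0::real)) = card {c \<in> ?\<Omega>. \<forall>e\<in>D j. c e = t e}"
        using fin by (simp add: sum.If_cases Int_def)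
      then show "(\<Sum>c\<in>?\<Omega>. if \<forall>e\<in>D j. c e = t e then 1 else (0::real)) = real (K ^ (card E - g))"
        by (simp only: cO[OF j])
    qed
    also have "\<dots> = card J * real (K ^ (card E - g))" by simp
    also have "real (K ^ (card E - g)) = real K ^ card E / real K ^ g"
      unfolding of_nat_power using K gE by (simp add: power_diff)
    finally show ?thesis using K by simp
  qed (simp add: f_def)
  have mgf: "(\<Sum>c\<in>?\<Omega>. exp (\<theta> * (f c - real (card J) / K ^ g))) \<le> K ^ card E * exp (\<theta>\<^sup>2 * (2 * real N))" for \<theta>
  proof -
    have "(\<Sum>c\<in>?\<Omega>. exp (\<theta> * (f c - real (card J) / K ^ g))) \<le> real (card {..<K} ^ card E) * exp (\<theta>\<^sup>2 * (\<Sum>x\<in>E. (C x)\<^sup>2))"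
      using bounded_differences_mgf[OF E _ _ lip, of "{..<K}" \<theta>] K unfolding mean by auto
    also have "\<dots> \<le> real (card {..<K} ^ card E) * exp (\<theta>\<^sup>2 * (2 * real N))"
      using sumC by (intro mult_left_mono) (auto intro: mult_left_mono)
    finally show ?thesis by simp
  qed
  have pos: "0 < 2 * real N" using N by simp
  show "card {c \<in> ?\<Omega>. real (card J) / K ^ g + s \<le> card {j \<in> J. \<forall>e\<in>D j. c e = t e}}
        \<le> K ^ card E * exp (- (s\<^sup>2 / (8 * real N)))"
    using subgaussian_tail(1)[OF fin pos s mgf] by (simp add: f_def)
  show "card {c \<in> ?\<Omega>. card {j \<in> J. \<forall>e\<in>D j. c e = t e} \<le> real (card J) / K ^ g - s}
        \<le> K ^ card E * exp (- (s\<^sup>2 / (8 * real N)))"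
    using subgaussian_tail(2)[OF fin pos s mgf] by (simp add: f_def)
qed

text \<open>Here \<open>u\<close> and \<open>v\<close> list the block edges along two rows or two
  columns of one ordering, members of \<open>E\<close> or not. Different lines share no block edge,
  so the pairs \<open>{u j, v j}\<close> are disjoint and the preceding bounds apply with one or two
  prescribed colours.\<close>

lemma
  fixes u v :: "nat \<Rightarrow> 'e" and t :: "'e \<Rightarrow> nat" and K N :: nat and s :: real
  assumes E: "finite E" and K: "0 < K" and N: "0 < N" and s: "0 \<le> s"
    and u: "inj_on u {..<N}" and t: "\<And>j. j < N \<Longrightarrow> u j \<in> E \<Longrightarrow> t (u j) < K"
  shows colouring_degree_tail:
      "card {c \<in> PiE E (\<lambda>_. {..<K}). card {j. j < N \<and> u j \<in> E \<and> c (u j) = t (u j)}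
          \<le> real (card {j. j < N \<and> u j \<in> E}) / K - s}
        \<le> K ^ card E * exp (- (s\<^sup>2 / (8 * real N)))"
    and colouring_codegree_tail:
      "inj_on v {..<N} \<Longrightarrow> (\<And>j. j < N \<Longrightarrow> v j \<in> E \<Longrightarrow> t (v j) < K) \<Longrightarrow> u ` {..<N} \<inter> v ` {..<N} = {} \<Longrightarrow>
       card {c \<in> PiE E (\<lambda>_. {..<K}). real (card {j. j < N \<and> u j \<in> E \<and> v j \<in> E}) / K\<^sup>2 + s
          \<le> card {j. j < N \<and> (u j \<in> E \<and> c (u j) = t (u j)) \<and> (v j \<in> E \<and> c (v j) = t (v j))}}
        \<le> K ^ card E * exp (- (s\<^sup>2 / (8 * real N)))"
proof -
  have cJ: "card {j. j < N \<and> P j} \<le> N" for P using card_mono[of "{..<N}" "{j. j < N \<and> P j}"] by auto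
  show "card {c \<in> PiE E (\<lambda>_. {..<K}). card {j. j < N \<and> u j \<in> E \<and> c (u j) = t (u j)}
          \<le> real (card {j. j < N \<and> u j \<in> E}) / K - s} \<le> K ^ card E * exp (- (s\<^sup>2 / (8 * real N)))"
  proof -
    have eq: "{j \<in> {j. j < N \<and> u j \<in> E}. \<forall>e\<in>{u j}. c e = t e} = {j. j < N \<and> u j \<in> E \<and> c (u j) = t (u j)}" for c
      by auto
    show ?thesis
      using colouring_lower_tail[OF E K _ cJ N, of "\<lambda>j. u j \<in> E" "\<lambda>j. {u j}" 1 t s] u t s
      unfolding eq by (auto simp: disjoint_family_on_def inj_on_def)
  qed
  assume v: "inj_on v {..<N}" "\<And>j. j < N \<Longrightarrow> v j \<in> E \<Longrightarrow> t (v j) < K"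
    and disj: "u ` {..<N} \<inter> v ` {..<N} = {}"
  have ne: "u j \<noteq> v j'" if "j < N" "j' < N" for j j' using disj that by (auto simp: disjoint_iff)
  have eq: "{j \<in> {j. j < N \<and> u j \<in> E \<and> v j \<in> E}. \<forall>e\<in>{u j, v j}. c e = t e}
    = {j. j < N \<and> (u j \<in> E \<and> c (u j) = t (u j)) \<and> (v j \<in> E \<and> c (v j) = t (v j))}" for c
    by auto
  have d: "disjoint_family_on (\<lambda>j. {u j, v j}) {j. j < N \<and> u j \<in> E \<and> v j \<in> E}"
    unfolding disjoint_family_on_def
  proof (intro ballI impI)
    fix j j' assume "j \<in> {j. j < N \<and> u j \<in> E \<and> v j \<in> E}" "j' \<in> {j. j < N \<and> u j \<in> E \<and> v j \<in> E}" "j \<noteq> j'"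
    then show "{u j, v j} \<inter> {u j', v j'} = {}"
      using ne[of j j'] ne[of j' j] u v(1) by (auto simp: inj_on_def)
  qed
  show "card {c \<in> PiE E (\<lambda>_. {..<K}). real (card {j. j < N \<and> u j \<in> E \<and> v j \<in> E}) / K\<^sup>2 + s
          \<le> card {j. j < N \<and> (u j \<in> E \<and> c (u j) = t (u j)) \<and> (v j \<in> E \<and> c (v j) = t (v j))}}
        \<le> K ^ card E * exp (- (s\<^sup>2 / (8 * real N)))"
    using colouring_upper_tail[OF E K _ cJ N, of "\<lambda>j. u j \<in> E \<and> v j \<in> E" "\<lambda>j. {u j, v j}" 2 t s] d t v(2) s ne
    unfolding eq by (auto simp: card_insert_if)
qed

text \<open>The colour of an edge \<open>e\<close> selects the graph in which \<open>e\<close> is covered for the \<open>c e\<close>-th time, so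
  each of the fewer than \<open>K\<close> graphs containing \<open>e\<close> receives it with probability exactly \<open>1/K\<close>,
  whatever the number of these graphs.\<close>

lemma random_edge_split:
  fixes h :: "nat \<Rightarrow> nat \<Rightarrow> nat \<Rightarrow> 'e" and R K N :: nat and s :: real
  assumes E: "finite E" and N: "0 < N" and s: "0 \<le> s" and K: "0 < K"
    and inj_h: "\<forall>r<R. inj_on (\<lambda>(i, j). h r i j) ({..<N} \<times> {..<N})"
    and cover: "\<forall>e\<in>E. card {r. r < R \<and> (\<exists>i<N. \<exists>j<N. h r i j = e)} < K"
    and small: "2 * real R * (real N)\<^sup>2 * exp (- (s\<^sup>2 / (8 * real N))) < 1"
  defines "\<Gamma> \<equiv> \<lambda>r. {(i, j). i < N \<and> j < N \<and> h r i j \<in> E}"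
  shows "\<exists>G. (\<forall>r<R. G r \<subseteq> \<Gamma> r) \<and>
    (\<forall>r<R. \<forall>r'<R. \<forall>(i, j)\<in>G r. \<forall>(i', j')\<in>G r'. h r i j = h r' i' j' \<longrightarrow> r = r') \<and>
    (\<forall>r<R. \<forall>c C. degree_bounds N c C (\<Gamma> r) \<longrightarrow> degree_bounds N (c / K - s) (C / real (K\<^sup>2) + s) (G r))"
proof -
  have inj: "i = i' \<and> j = j'"
    if "r < R" "i < N" "j < N" "i' < N" "j' < N" "h r i j = h r i' j'" for r i j i' j'
    using inj_onD[OF inj_h[rule_format, OF that(1)], of "(i, j)" "(i', j')"] that by simp
  let ?\<Omega> = "PiE E (\<lambda>_. {..<K})"
  define \<delta> where "\<delta> = K ^ card E * exp (- (s\<^sup>2 / (8 * real N)))"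
  have \<delta>0: "0 \<le> \<delta>" by (simp add: \<delta>_def)
  define cov where "cov r = {e. \<exists>i<N. \<exists>j<N. h r i j = e}" for r
  define rank where "rank r e = card {r'. r' < r \<and> e \<in> cov r'}" for r e
  have rankK: "rank r e < K" if "r < R" "e \<in> E" for r e
  proof -
    have "rank r e \<le> card {r. r < R \<and> (\<exists>i<N. \<exists>j<N. h r i j = e)}"
      unfolding rank_def using that by (intro card_mono) (auto simp: cov_def)
    then show ?thesis using cover that(2) by fastforce
  qed
  \<comment> \<open>Strict growth of the rank along the orderings covering \<open>e\<close> means
    that the colour of \<open>e\<close> selects at most one of them.\<close>
  have rank_less: "rank r e < rank r' e" if "r < r'" "e \<in> cov r" for r r' e
    unfolding rank_def using that by (intro psubset_card_mono) auto
  define G where "G c r = {(i, j). i < N \<and> j < N \<and> h r i j \<in> E \<and> c (h r i j) = rank r (h r i j)}" for c r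
  have fin: "finite ?\<Omega>" using E by (simp add: finite_PiE)
  \<comment> \<open>Degree failures occupy the diagonal of the codegree failures, so rows and
    columns together need only \<open>2 * R * N^2\<close> events.\<close>
  define B1 where "B1 r i i' = (if i = i'
      then {c \<in> ?\<Omega>. card {j. (i, j) \<in> G c r} \<le> card {j. (i, j) \<in> \<Gamma> r} / K - s}
      else {c \<in> ?\<Omega>. card {j. (i, j) \<in> \<Gamma> r \<and> (i', j) \<in> \<Gamma> r} / K\<^sup>2 + s \<le> card {j. (i, j) \<in> G c r \<and> (i', j) \<in> G c r}})" for r i i'
  define B2 where "B2 r j j' = (if j = j'
      then {c \<in> ?\<Omega>. card {i. (i, j) \<in> G c r} \<le> card {i. (i, j) \<in> \<Gamma> r} / K - s}
      else {c \<in> ?\<Omega>. card {i. (i, j) \<in> \<Gamma> r \<and> (i, j') \<in> \<Gamma> r} / K\<^sup>2 + s \<le> card {i. (i, j) \<in> G c r \<and> (i, j') \<in> G c r}})" for r j j'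
  have bB1: "real (card (B1 r i i')) \<le> \<delta>" if r: "r < R" and i: "i < N" "i' < N" for r i i'
  proof (cases "i = i'")
    case True
    have "inj_on (h r i) {..<N}" using inj[OF r] i by (auto simp: inj_on_def)
    from colouring_degree_tail[OF E K N s this, of "rank r"] rankK[OF r] True i show ?thesis
      by (auto simp: B1_def \<delta>_def G_def \<Gamma>_def)
  next
    case False
    have "inj_on (h r i) {..<N}" "inj_on (h r i') {..<N}" "h r i ` {..<N} \<inter> h r i' ` {..<N} = {}"
      using inj[OF r] i False by (auto simp: inj_on_def)
    with colouring_codegree_tail[OF E K N s this(1), of "rank r" "h r i'"] rankK[OF r] False i show ?thesis
      by (auto simp: B1_def \<delta>_def G_def \<Gamma>_def conj_ac)
  qed
  have bB2: "real (card (B2 r j j')) \<le> \<delta>" if r: "r < R" and j: "j < N" "j' < N" for r j j'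
  proof (cases "j = j'")
    case True
    have "inj_on (\<lambda>i. h r i j) {..<N}" using inj[OF r] j by (auto simp: inj_on_def)
    from colouring_degree_tail[OF E K N s this, of "rank r"] rankK[OF r] True j show ?thesis
      by (auto simp: B2_def \<delta>_def G_def \<Gamma>_def)
  next
    case False
    have "inj_on (\<lambda>i. h r i j) {..<N}" "inj_on (\<lambda>i. h r i j') {..<N}"
        "(\<lambda>i. h r i j) ` {..<N} \<inter> (\<lambda>i. h r i j') ` {..<N} = {}"
      using inj[OF r] j False by (auto simp: inj_on_def)
    with colouring_codegree_tail[OF E K N s this(1), of "rank r" "\<lambda>i. h r i j'"] rankK[OF r] False j show ?thesis
      by (auto simp: B2_def \<delta>_def G_def \<Gamma>_def conj_ac)
  qed
  define I where "I = {..<R} \<times> {..<N} \<times> {..<N}"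
  have finI: "finite I" by (simp add: I_def)
  define Bad where "Bad = (\<Union>(r, i, i')\<in>I. B1 r i i' \<union> B2 r i i')"
  have "real (card Bad) \<le> real (\<Sum>(r, i, i')\<in>I. card (B1 r i i' \<union> B2 r i i'))"
    unfolding Bad_def case_prod_beta by (rule of_nat_mono, rule card_UN_le[OF finI])
  also have "\<dots> \<le> (\<Sum>z\<in>I. 2 * \<delta>)"
    unfolding of_nat_sum case_prod_beta
  proof (intro sum_mono)
    fix z assume "z \<in> I"
    then obtain r i i' where z: "z = (r, i, i')" "r < R" "i < N" "i' < N" by (auto simp: I_def)
    have "real (card (B1 r i i' \<union> B2 r i i')) \<le> real (card (B1 r i i')) + real (card (B2 r i i'))"
      using card_Un_le[of "B1 r i i'" "B2 r i i'"] by linarith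
    then show "real (card (B1 (fst z) (fst (snd z)) (snd (snd z)) \<union> B2 (fst z) (fst (snd z)) (snd (snd z)))) \<le> 2 * \<delta>"
      using bB1[OF z(2-)] bB2[OF z(2-)] z(1) by simp
  qed
  also have "\<dots> = (2 * real R * (real N)\<^sup>2 * exp (- (s\<^sup>2 / (8 * real N)))) * K ^ card E"
    by (simp add: I_def \<delta>_def power2_eq_square)
  also have "\<dots> < 1 * real (K ^ card E)" using small K by (intro mult_strict_right_mono) auto
  also have "\<dots> = real (card ?\<Omega>)" using E by (simp add: card_PiE)
  finally have "card Bad < card ?\<Omega>" by simp
  moreover have "B1 r i i' \<union> B2 r i i' \<subseteq> ?\<Omega>" for r i i' by (auto simp: B1_def B2_def)
  then have "Bad \<subseteq> ?\<Omega>" unfolding Bad_def by blast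
  ultimately have "\<not> ?\<Omega> \<subseteq> Bad" by auto
  then obtain c where c: "c \<in> ?\<Omega>" "c \<notin> Bad" by blast
  have nB: "c \<notin> B1 r i i'" "c \<notin> B2 r i i'" if "r < R" "i < N" "i' < N" for r i i'
    using c(2) that by (auto simp: Bad_def I_def)
  show ?thesis
  proof (intro exI[of _ "G c"] conjI allI impI)
    fix r assume r: "r < R"
    show "G c r \<subseteq> \<Gamma> r" by (auto simp: G_def \<Gamma>_def)
    show "degree_bounds N (b / K - s) (C / real (K\<^sup>2) + s) (G c r)" if deg: "degree_bounds N b C (\<Gamma> r)" for b C
    proof -
      have low: "b / K - s \<le> y" if "b \<le> z" "z / K - s \<le> y" for y z :: real
        using that divide_right_mono[OF that(1), of "real K"] by linarith
      have up: "y \<le> C / real (K\<^sup>2) + s" if "z \<le> C" "y \<le> z / real (K\<^sup>2) + s" for y z :: real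
        using that divide_right_mono[OF that(1), of "real (K\<^sup>2)"] by linarith
      show ?thesis
        unfolding degree_bounds_def
      proof (intro conjI allI impI)
        show "b / K - s \<le> card {j. (i, j) \<in> G c r}" if "i < N" for i
          using nB(1)[OF r that that] c(1) deg that
          by (intro low[of "card {j. (i, j) \<in> \<Gamma> r}"]) (simp_all add: B1_def degree_bounds_def)
        show "b / K - s \<le> card {i. (i, j) \<in> G c r}" if "j < N" for j
          using nB(2)[OF r that that] c(1) deg that
          by (intro low[of "card {i. (i, j) \<in> \<Gamma> r}"]) (simp_all add: B2_def degree_bounds_def)
        show "card {j. (i, j) \<in> G c r \<and> (i', j) \<in> G c r} \<le> C / real (K\<^sup>2) + s"
          if "i < N" "i' < N" "i \<noteq> i'" for i i'
          using nB(1)[OF r that(1,2)] c(1) deg that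
          by (intro up[of "card {j. (i, j) \<in> \<Gamma> r \<and> (i', j) \<in> \<Gamma> r}"])
             (simp_all add: B1_def degree_bounds_def)
        show "card {i. (i, j) \<in> G c r \<and> (i, j') \<in> G c r} \<le> C / real (K\<^sup>2) + s"
          if "j < N" "j' < N" "j \<noteq> j'" for j j'
          using nB(2)[OF r that(1,2)] c(1) deg that
          by (intro up[of "card {i. (i, j) \<in> \<Gamma> r \<and> (i, j') \<in> \<Gamma> r}"])
             (simp_all add: B2_def degree_bounds_def)
      qed
    qed
    fix r' assume r': "r' < R"
    show "\<forall>(i, j)\<in>G c r. \<forall>(i', j')\<in>G c r'. h r i j = h r' i' j' \<longrightarrow> r = r'"
    proof clarify
      fix i j i' j' assume ij: "(i, j) \<in> G c r" "(i', j') \<in> G c r'" and eq: "h r i j = h r' i' j'"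
      define e where "e = h r i j"
      have "rank r e = rank r' e" using ij eq by (auto simp: G_def e_def)
      moreover have "e \<in> cov r" using ij by (auto simp: cov_def G_def e_def)
      moreover have "e \<in> cov r'" using ij unfolding e_def eq by (auto simp: cov_def G_def)
      ultimately show "r = r'" using rank_less[of r r' e] rank_less[of r' r e] by (cases r r' rule: linorder_cases) auto
    qed
  qed
qed

section \<open>Covering each hyperedge a controlled number of times\<close>

text \<open>Chernoff's bound for \<open>R\<close> independent uniform choices from
  \<open>Good\<close>, repetitions allowed, followed by a union bound over the hyperedges. The
  coverage has to be below \<open>K\<close> because every rank must be one of the colours
  \<open>0, ..., K - 1\<close>.\<close>

lemma exists_sequence_low_coverage:
  fixes P :: "'e \<Rightarrow> 'g \<Rightarrow> bool" and q \<theta> :: real and R K :: nat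
  assumes Good: "finite Good" and E: "finite E" and \<theta>: "0 \<le> \<theta>" and q: "0 \<le> q"
    and cov: "\<And>e. e \<in> E \<Longrightarrow> card {\<sigma> \<in> Good. P e \<sigma>} \<le> q * card Good" and ne: "Good \<noteq> {}"
    and small: "card E * exp ((exp \<theta> - 1) * q * R - \<theta> * K) < 1"
  shows "\<exists>f. (\<forall>r<R. f r \<in> Good) \<and> (\<forall>e\<in>E. card {r. r < R \<and> P e (f r)} < K)"
proof -
  let ?\<Omega> = "PiE {..<R} (\<lambda>_. Good)"
  have fin: "finite ?\<Omega>" using Good by (simp add: finite_PiE)
  define X where "X e f = card {r. r < R \<and> P e (f r)}" for e f
  define Bad where "Bad e = {f \<in> ?\<Omega>. K \<le> X e f}" for e
  have cO: "card ?\<Omega> = card Good ^ R" by (simp add: card_PiE)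
  have bad: "real (card (Bad e)) \<le> card ?\<Omega> * exp ((exp \<theta> - 1) * q * R - \<theta> * K)" if e: "e \<in> E" for e
  proof -
    have expX: "exp (\<theta> * X e f) = (\<Prod>r<R. if P e (f r) then exp \<theta> else 1)" for f
    proof -
      have "{..<R} \<inter> {r. P e (f r)} = {r. r < R \<and> P e (f r)}" by auto
      then show ?thesis by (simp add: prod.If_cases X_def exp_of_nat2_mult)
    qed
    have "real (card (Bad e)) * exp (\<theta> * K) = (\<Sum>f\<in>Bad e. exp (\<theta> * K))" by simp
    also have "\<dots> \<le> (\<Sum>f\<in>Bad e. exp (\<theta> * X e f))"
    proof (intro sum_mono)
      fix f assume "f \<in> Bad e"
      then have "real K \<le> real (X e f)" by (simp add: Bad_def)
      from mult_left_mono[OF this \<theta>] show "exp (\<theta> * K) \<le> exp (\<theta> * X e f)" by simp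
    qed
    also have "\<dots> \<le> (\<Sum>f\<in>?\<Omega>. exp (\<theta> * X e f))" using fin by (intro sum_mono2) (auto simp: Bad_def)
    \<comment> \<open>Independence: the sum over sequences of a product of factors, one for each
      choice, is the product of the sums.\<close>
    also have "\<dots> = (\<Prod>r<R. \<Sum>\<sigma>\<in>Good. if P e \<sigma> then exp \<theta> else 1)"
      unfolding expX using Good
      by (subst prod_sum_PiE[of "{..<R}" "\<lambda>_. Good" "\<lambda>_ \<sigma>. if P e \<sigma> then exp \<theta> else 1"]) auto
    also have "\<dots> \<le> (\<Prod>r<R. card Good * exp ((exp \<theta> - 1) * q))"
    proof (intro prod_mono conjI)
      show "0 \<le> (\<Sum>\<sigma>\<in>Good. if P e \<sigma> then exp \<theta> else 1)" by (intro sum_nonneg) auto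
      have "(\<Sum>\<sigma>\<in>Good. if P e \<sigma> then exp \<theta> else 1) = (\<Sum>\<sigma>\<in>Good. 1 + (if P e \<sigma> then exp \<theta> - 1 else 0))"
        by (intro sum.cong) auto
      also have "\<dots> = card Good + (exp \<theta> - 1) * card {\<sigma> \<in> Good. P e \<sigma>}"
        using Good by (simp add: sum.distrib sum.If_cases Int_def mult.commute)
      also have "\<dots> \<le> card Good + (exp \<theta> - 1) * (q * card Good)"
        using cov[OF e] \<theta> by (intro add_left_mono mult_left_mono) auto
      also have "\<dots> = card Good * (1 + (exp \<theta> - 1) * q)" by (simp add: algebra_simps)
      also have "\<dots> \<le> card Good * exp ((exp \<theta> - 1) * q)"
        by (intro mult_left_mono exp_ge_add_one_self) auto
      finally show "(\<Sum>\<sigma>\<in>Good. if P e \<sigma> then exp \<theta> else 1) \<le> card Good * exp ((exp \<theta> - 1) * q)" .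
    qed
    also have "\<dots> = card ?\<Omega> * exp ((exp \<theta> - 1) * q * R)"
      by (simp add: cO power_mult_distrib exp_of_nat_mult[symmetric] mult_ac)
    finally show ?thesis by (simp only: exp_diff times_divide_eq_right pos_le_divide_eq exp_gt_zero)
  qed
  have O0: "0 < real (card ?\<Omega>)" using ne Good by (simp add: cO card_gt_0_iff)
  have "real (card (\<Union>e\<in>E. Bad e)) \<le> real (\<Sum>e\<in>E. card (Bad e))"
    by (rule of_nat_mono, rule card_UN_le[OF E])
  also have "\<dots> \<le> (\<Sum>e\<in>E. card ?\<Omega> * exp ((exp \<theta> - 1) * q * R - \<theta> * K))"
    unfolding of_nat_sum using bad by (intro sum_mono) auto
  also have "\<dots> = card ?\<Omega> * (card E * exp ((exp \<theta> - 1) * q * R - \<theta> * K))" by simp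
  also have "\<dots> < real (card ?\<Omega>) * 1" using small O0 by (intro mult_strict_left_mono) auto
  finally have "card (\<Union>e\<in>E. Bad e) < card ?\<Omega>" by simp
  moreover have "(\<Union>e\<in>E. Bad e) \<subseteq> ?\<Omega>" by (auto simp: Bad_def)
  ultimately have "\<not> ?\<Omega> \<subseteq> (\<Union>e\<in>E. Bad e)" by (metis less_irrefl subset_antisym)
  then obtain f where "f \<in> ?\<Omega>" "\<And>e. e \<in> E \<Longrightarrow> f \<notin> Bad e" by blast
  then show ?thesis by (intro exI[of _ f]) (auto simp: Bad_def X_def not_le)
qed

section \<open>Assembling the cycles from given numerical parameters\<close>

context block_layout
begin

text \<open>All asymptotic relations enter as explicit inequalities. \<open>s1\<close> and
  \<open>s2\<close> are the deviations allowed for the random ordering and for the random colouring,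
  \<beta> the proportion of bad orderings, \<open>q\<close> the chance that a good ordering covers a
  fixed hyperedge, and \<open>d\<close> the density after the split.\<close>

lemma packing_from_parameters:
  fixes x p s1 s2 \<kappa> \<beta> q \<theta> d :: real and R K r :: nat
  assumes H: "uniform_hypergraph n (l + a) E" and finE: "finite E"
    and x: "0 < x" "x \<le> 1 / 2" and p: "0 < p"
    and s: "0 \<le> s1" "0 \<le> s2" and big: "4 * a + (l - a) \<le> n"
    and \<kappa>: "real (n choose (l - a)) \<le> (1 + \<kappa>) * real (n - 4 * a choose (l - a))" "0 \<le> \<kappa>"
    and degL: "\<And>S. S \<subseteq> {0..<n} \<Longrightarrow> card S = 2 * a \<Longrightarrow>
      (1 - x ^ 3) * real (n - 2 * a choose (l - a)) * p \<le> deg n (l + a) E S"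
    and degR: "\<And>S. S \<subseteq> {0..<n} \<Longrightarrow> card S = l - a \<Longrightarrow>
      (1 - x ^ 3) * real (n - (l - a) choose (2 * a)) * p \<le> deg n (l + a) E S"
    and codegL: "\<And>S S'. S \<subseteq> {0..<n} \<Longrightarrow> S' \<subseteq> {0..<n} \<Longrightarrow> card S = 2 * a \<Longrightarrow> card S' = 2 * a \<Longrightarrow>
      card (S \<inter> S') \<in> {0, a} \<Longrightarrow>
      card (nbhd n (l + a) E S \<inter> nbhd n (l + a) E S') \<le> (1 + x ^ 3) * real (n choose (l - a)) * p\<^sup>2"
    and codegR: "\<And>S S'. S \<subseteq> {0..<n} \<Longrightarrow> S' \<subseteq> {0..<n} \<Longrightarrow> card S = l - a \<Longrightarrow> card S' = l - a \<Longrightarrow>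
      S \<inter> S' = {} \<Longrightarrow>
      card (nbhd n (l + a) E S \<inter> nbhd n (l + a) E S') \<le> (1 + x ^ 3) * real (n - 2 * (l - a) choose (2 * a)) * p\<^sup>2"
    and n1: "4 * (real N)\<^sup>2 * exp (- (s1\<^sup>2 / (64 * real n))) \<le> \<beta>" "\<beta> < 1"
    and q: "(real N)\<^sup>2 / real (n choose (l + a)) \<le> q * (1 - \<beta>)" "0 \<le> q"
    and n2: "card E * exp ((exp \<theta> - 1) * q * R - \<theta> * K) < 1" "0 \<le> \<theta>"
    and n3: "2 * real R * (real N)\<^sup>2 * exp (- (s2\<^sup>2 / (8 * real N))) < 1"
    and K: "0 < K" and d: "d = p / K"
    and n4: "(1 - 26/25 * x ^ 3) * d * N \<le> (N * ((1 - x ^ 3) * p) - s1) / K - s2"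
    and n5: "(N * ((1 + x ^ 3) * (1 + \<kappa>) * p\<^sup>2) + s1) / K\<^sup>2 + s2 \<le> (1 + 26/25 * x ^ 3) * d\<^sup>2 * N"
    and n6: "100 \<le> x ^ 4 * d ^ 3 * N"
    and n7: "real r \<le> (1 - 19/10 * x) * d * N"
  shows "\<exists>CC. (\<forall>C\<in>CC. ham_cycle n (l + a) l E C) \<and>
             (\<forall>C1\<in>CC. \<forall>C2\<in>CC. C1 \<noteq> C2 \<longrightarrow> C1 \<inter> C2 = {}) \<and> finite CC \<and> card CC = R * r"
proof -
  let ?e = "x ^ 3"
  have e0: "0 \<le> ?e" using x by simp
  have d0: "0 < d" using p K by (simp add: d)
  define \<Gamma> where "\<Gamma> = block_graph l a N E"
  define good where "good \<sigma> \<longleftrightarrow>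
    degree_bounds N (N * ((1 - ?e) * p) - s1) (N * ((1 + ?e) * (1 + \<kappa>) * p\<^sup>2) + s1) (\<Gamma> \<sigma>)" for \<sigma>
  define Good where "Good = {\<sigma>. \<sigma> permutes {0..<n} \<and> good \<sigma>}"
  let ?P = "{\<sigma>. \<sigma> permutes {0..<n}}"
  have finP: "finite ?P" by (simp add: finite_permutations)
  have finGood: "finite Good" using finP by (auto simp: Good_def intro: finite_subset)
  have "real (card {\<sigma>. \<sigma> permutes {0..<n} \<and> \<not> good \<sigma>})
      \<le> 4 * (real N)\<^sup>2 * (fact n * exp (- (s1\<^sup>2 / (64 * real n))))"
    unfolding good_def \<Gamma>_def
    by (rule few_bad_permutations[OF H s(1) e0 big \<kappa> degL degR codegL codegR])
  also have "\<dots> = fact n * (4 * (real N)\<^sup>2 * exp (- (s1\<^sup>2 / (64 * real n))))" by simp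
  also have "\<dots> \<le> fact n * \<beta>" using n1(1) by (intro mult_left_mono) auto
  finally have bad: "real (card {\<sigma>. \<sigma> permutes {0..<n} \<and> \<not> good \<sigma>}) \<le> fact n * \<beta>" .
  have "?P = Good \<union> {\<sigma>. \<sigma> permutes {0..<n} \<and> \<not> good \<sigma>}" by (auto simp: Good_def)
  then have "card ?P \<le> card Good + card {\<sigma>. \<sigma> permutes {0..<n} \<and> \<not> good \<sigma>}"
    by (metis card_Un_le)
  moreover have "card ?P = fact n" by (simp add: card_permutations)
  ultimately have "fact n \<le> real (card Good) + real (card {\<sigma>. \<sigma> permutes {0..<n} \<and> \<not> good \<sigma>})"
    by (metis of_nat_add of_nat_fact of_nat_le_iff)
  \<comment> \<open>Conditioning on good orderings raises any covering probability by a factor of at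
    most \<open>1 / (1 - \<beta>)\<close>, which the hypothesis on \<open>q\<close> absorbs.\<close>
  then have cGood: "fact n * (1 - \<beta>) \<le> real (card Good)" using bad by (simp add: algebra_simps)
  have "0 < fact n * (1 - \<beta>)" using n1 by simp
  then have "0 < card Good" using cGood by linarith
  then have ne: "Good \<noteq> {}" by auto
  have "\<exists>f. (\<forall>r<R. f r \<in> Good) \<and>
      (\<forall>e\<in>E. card {r. r < R \<and> (\<exists>i<N. \<exists>j<N. block_edge l a N (f r) i j = e)} < K)"
  proof (rule exists_sequence_low_coverage[OF finGood finE n2(2) q(2) _ ne n2(1)])
    fix e assume e: "e \<in> E"
    have "real (card {\<sigma> \<in> Good. \<exists>i<N. \<exists>j<N. block_edge l a N \<sigma> i j = e})
      \<le> real (card {\<sigma>. \<sigma> permutes {0..<n} \<and> (\<exists>i<N. \<exists>j<N. block_edge l a N \<sigma> i j = e)})"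
      by (intro of_nat_mono card_mono) (auto simp: Good_def intro: finite_subset[OF _ finP])
    also have "\<dots> \<le> (real N)\<^sup>2 * (fact n / real (n choose (l + a)))"
      using H e by (intro card_permutations_covering) (auto simp: uniform_hypergraph_def)
    also have "\<dots> = (real N)\<^sup>2 / real (n choose (l + a)) * fact n" by simp
    also have "\<dots> \<le> q * (1 - \<beta>) * fact n" using q(1) by (intro mult_right_mono) auto
    also have "\<dots> = q * (fact n * (1 - \<beta>))" by simp
    also have "\<dots> \<le> q * card Good" using cGood q by (intro mult_left_mono) auto
    finally show "real (card {\<sigma> \<in> Good. \<exists>i<N. \<exists>j<N. block_edge l a N \<sigma> i j = e}) \<le> q * card Good" .
  qed
  then obtain f where f: "\<And>r. r < R \<Longrightarrow> f r \<in> Good"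
    and cov: "\<And>e. e \<in> E \<Longrightarrow> card {r. r < R \<and> (\<exists>i<N. \<exists>j<N. block_edge l a N (f r) i j = e)} < K" by blast
  have perm: "f r permutes {0..<n}" if "r < R" for r using f[OF that] by (simp add: Good_def)
  have gd: "good (f r)" if "r < R" for r using f[OF that] by (simp add: Good_def)
  define h where "h r = block_edge l a N (f r)" for r
  have inj: "i = i' \<and> j = j'" if "r < R" "i < N" "j < N" "i' < N" "j' < N" "h r i j = h r i' j'" for r i j i' j'
    using block_edge_inject[OF permutes_inj[OF perm[OF that(1)]] that(2,4)] that(6) by (simp add: h_def)
  have \<Gamma>_eq: "\<Gamma> (f r) = {(i, j). i < N \<and> j < N \<and> h r i j \<in> E}" for r
    by (simp add: \<Gamma>_def block_graph_def h_def)
  have Npos: "0 < N" using N by simp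
  have "\<forall>r<R. inj_on (\<lambda>(i, j). h r i j) ({..<N} \<times> {..<N})" using inj by (auto simp: inj_on_def)
  moreover have "\<forall>e\<in>E. card {r. r < R \<and> (\<exists>i<N. \<exists>j<N. h r i j = e)} < K"
    using cov by (simp add: h_def)
  ultimately have split: "\<exists>G. (\<forall>r<R. G r \<subseteq> \<Gamma> (f r)) \<and>
    (\<forall>r<R. \<forall>r'<R. \<forall>(i, j)\<in>G r. \<forall>(i', j')\<in>G r'. h r i j = h r' i' j' \<longrightarrow> r = r') \<and>
    (\<forall>r<R. \<forall>c C. degree_bounds N c C (\<Gamma> (f r)) \<longrightarrow> degree_bounds N (c / K - s2) (C / real (K\<^sup>2) + s2) (G r))"
    unfolding \<Gamma>_eq by (rule random_edge_split[OF finE Npos s(2) K _ _ n3])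
  from split
  obtain G where G': "\<forall>r<R. G r \<subseteq> \<Gamma> (f r)"
    and Gdisj': "\<forall>r<R. \<forall>r'<R. \<forall>(i, j)\<in>G r. \<forall>(i', j')\<in>G r'. h r i j = h r' i' j' \<longrightarrow> r = r'"
    and Gdeg: "\<forall>r<R. \<forall>c C. degree_bounds N c C (\<Gamma> (f r)) \<longrightarrow>
      degree_bounds N (c / K - s2) (C / real (K\<^sup>2) + s2) (G r)"
    by (elim exE conjE) (rule that)
  have G: "G r \<subseteq> \<Gamma> (f r)" if "r < R" for r using G' that by blast
  have Gdisj: "r = r'" if "r < R" "r' < R" "(i, j) \<in> G r" "(i', j') \<in> G r'" "h r i j = h r' i' j'" for r r' i j i' j'
    using Gdisj'[rule_format, OF that(1,2,3)] that(4,5) by auto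
  have "\<exists>\<phi>. (\<forall>t<r. bij_betw (\<phi> t) {..<N} {..<N} \<and> (\<forall>i<N. (i, \<phi> t i) \<in> G b)) \<and>
     (\<forall>t<r. \<forall>t'<r. \<forall>i<N. t \<noteq> t' \<longrightarrow> \<phi> t i \<noteq> \<phi> t' i)" if b: "b < R" for b
  proof (rule pseudorandom_perfect_matchings[OF _ d0 x _ n6 n7])
    show "G b \<subseteq> {..<N} \<times> {..<N}" using G[OF b] by (auto simp: \<Gamma>_eq)
    show "degree_bounds N ((1 - 26/25 * ?e) * d * N) ((1 + 26/25 * ?e) * d\<^sup>2 * N) (G b)"
      by (rule degree_bounds_mono[OF Gdeg[rule_format, OF b gd[OF b, unfolded good_def]] n4 n5])
  qed
  then have "\<forall>b. \<exists>\<phi>. b < R \<longrightarrow> (\<forall>t<r. bij_betw (\<phi> t) {..<N} {..<N} \<and> (\<forall>i<N. (i, \<phi> t i) \<in> G b)) \<and>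
     (\<forall>t<r. \<forall>t'<r. \<forall>i<N. t \<noteq> t' \<longrightarrow> \<phi> t i \<noteq> \<phi> t' i)" by blast
  from choice[OF this] obtain \<phi> where
    \<phi>': "\<forall>b. b < R \<longrightarrow> (\<forall>t<r. bij_betw (\<phi> b t) {..<N} {..<N} \<and> (\<forall>i<N. (i, \<phi> b t i) \<in> G b)) \<and>
     (\<forall>t<r. \<forall>t'<r. \<forall>i<N. t \<noteq> t' \<longrightarrow> \<phi> b t i \<noteq> \<phi> b t' i)" by (elim exE) (rule that)
  have \<phi>: "b < R \<Longrightarrow> t < r \<Longrightarrow> bij_betw (\<phi> b t) {..<N} {..<N}"
      "b < R \<Longrightarrow> t < r \<Longrightarrow> i < N \<Longrightarrow> (i, \<phi> b t i) \<in> G b"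
      "b < R \<Longrightarrow> t < r \<Longrightarrow> t' < r \<Longrightarrow> i < N \<Longrightarrow> t \<noteq> t' \<Longrightarrow> \<phi> b t i \<noteq> \<phi> b t' i" for b t t' i
    using \<phi>' by simp_all
  define cyc where "cyc z = (\<lambda>i. h (fst z) i (\<phi> (fst z) (snd z) i)) ` {0..<N}" for z
  let ?I = "{..<R} \<times> {..<r}"
  have disj: "cyc z \<inter> cyc z' = {}" if z: "z \<in> ?I" "z' \<in> ?I" "z \<noteq> z'" for z z'
  proof (rule ccontr)
    obtain b t b' t' where zz: "z = (b, t)" "z' = (b', t')" by (metis surj_pair)
    then have bt: "b < R" "b' < R" "t < r" "t' < r" using z by auto
    assume "cyc z \<inter> cyc z' \<noteq> {}"
    then obtain i i' where i: "i < N" "i' < N" "h b i (\<phi> b t i) = h b' i' (\<phi> b' t' i')"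
      by (auto simp: cyc_def zz)
    \<comment> \<open>A shared hyperedge is excluded in three stages: the split identifies the
      orderings, injectivity of block edges identifies the slots, and disjointness of the matchings
      identifies the matchings.\<close>
    have bb: "b = b'"
      using Gdisj[OF bt(1,2) \<phi>(2)[OF bt(1,3) i(1)] \<phi>(2)[OF bt(2,4) i(2)]] i(3) by simp
    have lt: "\<phi> b t i < N" "\<phi> b t' i' < N"
      using \<phi>(2)[OF bt(1,3) i(1)] \<phi>(2)[OF bt(1,4) i(2)] G[OF bt(1)] by (auto simp: \<Gamma>_eq)
    have "h b i (\<phi> b t i) = h b i' (\<phi> b t' i')" using i(3) bb by simp
    then have "i = i' \<and> \<phi> b t i = \<phi> b t' i'" by (rule inj[OF bt(1) i(1) lt(1) i(2) lt(2)])
    then show False using \<phi>(3)[OF bt(1,3,4) i(1)] z(3) zz bb by auto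
  qed
  \<comment> \<open>Disjoint cycles are distinct only because they are nonempty; the cardinality of
    the collection rests on this.\<close>
  have nonempty: "cyc z \<noteq> {}" for z using Npos by (auto simp: cyc_def)
  have inj_cyc: "inj_on cyc ?I"
  proof (rule inj_onI)
    fix z z' assume "z \<in> ?I" "z' \<in> ?I" "cyc z = cyc z'"
    then show "z = z'" using disj[of z z'] nonempty[of z] by auto
  qed
  have ham: "ham_cycle n (l + a) l E (cyc z)" if "z \<in> ?I" for z
  proof -
    have b: "fst z < R" "snd z < r" using that by auto
    have "block_edge l a N (f (fst z)) i (\<phi> (fst z) (snd z) i) \<in> E" if "i < N" for i
      using \<phi>(2)[OF b that] G[OF b(1)] by (auto simp: \<Gamma>_eq h_def)
    from hamilton_cycle_of_matching[OF perm[OF b(1)] \<phi>(1)[OF b] this]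
    show ?thesis by (simp add: cyc_def h_def)
  qed
  show ?thesis
  proof (intro exI[of _ "cyc ` ?I"] conjI)
    show "\<forall>C\<in>cyc ` ?I. ham_cycle n (l + a) l E C" using ham by blast
    show "\<forall>C1\<in>cyc ` ?I. \<forall>C2\<in>cyc ` ?I. C1 \<noteq> C2 \<longrightarrow> C1 \<inter> C2 = {}"
    proof (intro ballI impI)
      fix C1 C2 assume "C1 \<in> cyc ` ?I" "C2 \<in> cyc ` ?I" "C1 \<noteq> C2"
      then obtain z z' where "z \<in> ?I" "z' \<in> ?I" "C1 = cyc z" "C2 = cyc z'" "z \<noteq> z'" by blast
      then show "C1 \<inter> C2 = {}" using disj by simp
    qed
    show "finite (cyc ` ?I)" by simp
    show "card (cyc ` ?I) = R * r" using inj_cyc by (simp add: card_image card_cartesian_product)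
  qed
qed

end

section \<open>Choice of parameters\<close>

text \<open>Lowering the upper index from \<open>m\<close> to \<open>m - 1\<close> multiplies the
  binomial by \<open>1 - b / m\<close>. The bound \<open>n - c\<close> on all the denominators makes
  the factors uniform, and Bernoulli's inequality combines them.\<close>

lemma binomial_shift_ge:
  assumes "c < n" "b \<le> n - c" "j \<le> c"
  shows "(1 - real j * (real b / real (n - c))) * real (n choose b) \<le> real (n - j choose b)"
  using assms(3)
proof (induction j)
  case 0
  then show ?case by simp
next
  case (Suc j)
  define m where "m = n - j"
  define \<beta> where "\<beta> = real b / real (n - c)"
  have m: "0 < m" "b \<le> m" "n - c \<le> m" using Suc.prems assms by (auto simp: m_def)
  have \<beta>: "0 \<le> \<beta>" "\<beta> \<le> 1" using assms by (auto simp: \<beta>_def)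
  have "real b / real m \<le> \<beta>" unfolding \<beta>_def using m assms by (intro divide_left_mono) auto
  have "real ((m - b) * (m choose b)) = real (m * (m - 1 choose b))" by (simp only: binomial_absorb_comp)
  then have eq: "real (m - 1 choose b) = (1 - real b / real m) * real (m choose b)"
    using m by (simp add: of_nat_diff field_simps)
  have "(1 - real (Suc j) * \<beta>) * real (n choose b) \<le> (1 - \<beta>) * (1 - real j * \<beta>) * real (n choose b)"
    using \<beta> by (intro mult_right_mono) (auto simp: algebra_simps)
  also have "\<dots> = (1 - \<beta>) * ((1 - real j * \<beta>) * real (n choose b))" by simp
  also have "\<dots> \<le> (1 - \<beta>) * real (m choose b)"
    using Suc \<beta> by (intro mult_left_mono) (auto simp: m_def \<beta>_def)
  also have "\<dots> \<le> (1 - real b / real m) * real (m choose b)"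
    using \<open>real b / real m \<le> \<beta>\<close> by (intro mult_right_mono) auto
  finally show ?case using eq by (simp add: m_def \<beta>_def)
qed

lemma exp_minus_mult_ln: "0 < n \<Longrightarrow> exp (- (real m * ln (real n))) = 1 / real n ^ m"
  by (simp add: exp_minus exp_of_nat_mult inverse_eq_divide)

text \<open>Every lower bound demanded of \<open>M\<close> is the constant that one of the
  inequalities produces; they are kept separate so that a single \<open>M\<close> can later dominate
  them all. Throughout, \<open>e = x ^ 3\<close> stands for \<epsilon>.\<close>

lemma parameter_choice:
  fixes l a N n :: nat and x p M m :: real
  assumes a: "0 < a" "a < l" and N: "3 \<le> N" and n: "n = N * l"
    and x: "0 < x" "x \<le> 1 / 2" and p: "0 < p" "p \<le> 1"
    and m: "m = p * real (n choose (l + a))"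
    and lg: "1 \<le> ln (real n)"
    and W: "M * ln (real n) ^ 6 \<le> (x ^ 3) ^ 10 * p ^ 4 * n"
    and W2: "M \<le> x ^ 3 * sqrt n" "M \<le> (x ^ 3)\<^sup>2 * n"
    and C1: "C1 = 80000 * (real (l + a) + 1)"
    and M: "1 \<le> M" "2560000 * (real l)\<^sup>2 \<le> M" "1280000 * C1 ^ 4 * (real (l + a) + 4) * real l \<le> M"
      "2 * C1 \<le> M" "800 * C1 ^ 3 * real l \<le> M" "1600 * real a * real (l - a) \<le> M"
    and n_large: "800 \<le> n" "8 * a \<le> n" "4 * a + (l - a) \<le> n" "200 * real (l + a) ^ 3 \<le> sqrt n"
  shows "\<exists>s1 s2 \<kappa> \<beta> q \<theta> d. \<exists>R K r :: nat.
     0 \<le> s1 \<and> 0 \<le> s2 \<and> 0 \<le> \<kappa> \<and>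
     real (n choose (l - a)) \<le> (1 + \<kappa>) * real (n - 4 * a choose (l - a)) \<and>
     4 * (real N)\<^sup>2 * exp (- (s1\<^sup>2 / (64 * real n))) \<le> \<beta> \<and> \<beta> < 1 \<and>
     (real N)\<^sup>2 / real (n choose (l + a)) \<le> q * (1 - \<beta>) \<and> 0 \<le> q \<and>
     m * exp ((exp \<theta> - 1) * q * R - \<theta> * K) < 1 \<and> 0 \<le> \<theta> \<and>
     2 * real R * (real N)\<^sup>2 * exp (- (s2\<^sup>2 / (8 * real N))) < 1 \<and>
     0 < K \<and> d = p / K \<and>
     (1 - 26/25 * x ^ 3) * d * N \<le> (N * ((1 - x ^ 3) * p) - s1) / K - s2 \<and>
     (N * ((1 + x ^ 3) * (1 + \<kappa>) * p\<^sup>2) + s1) / real (K\<^sup>2) + s2 \<le> (1 + 26/25 * x ^ 3) * d\<^sup>2 * N \<and>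
     100 \<le> x ^ 4 * d ^ 3 * N \<and>
     real r \<le> (1 - 19/10 * x) * d * N \<and>
     (1 - 2 * x) * m / N \<le> real (R * r)"
proof -
  define e where "e = x ^ 3"
  define L where "L = ln (real n)"
  define k where "k = l + a"
  define C where "C = real (n choose k)"
  have l0: "0 < real l" using a by simp
  have N0: "0 < real N" using N by simp
  have n0: "0 < real n" using n_large by simp
  have nN: "real n = real N * real l" using n by simp
  have Nn: "real N \<le> real n" using nN l0 a by (simp add: mult_le_cancel_left1)
  have L1: "1 \<le> L" using lg by (simp add: L_def)
  have Lpow: "L ^ i \<le> L ^ j" if "i \<le> j" for i j using L1 that by (rule power_increasing[rotated])
  have "2 * l \<le> N * l" using N by (intro mult_le_mono1) auto
  then have kn: "k \<le> n" using a unfolding k_def n by linarith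
  have k3: "3 \<le> k" using a by (simp add: k_def)
  have C0: "0 < C" using kn by (simp add: C_def zero_less_binomial_iff)
  have Cn: "C \<le> real n ^ k" unfolding C_def using binomial_le_pow[OF kn] by (metis of_nat_le_iff of_nat_power)
  have e0: "0 < e" using x by (simp add: e_def)
  have ex: "e \<le> x / 4"
  proof -
    have "e = x * (x * x)" by (simp add: e_def power3_eq_cube)
    also have "\<dots> \<le> x * (1/2 * (1/2))" using x by (intro mult_left_mono mult_mono) auto
    finally show ?thesis by simp
  qed
  have e1: "e \<le> 1 / 8" using ex x by simp
  have C1_1: "1 \<le> C1" using C1 by simp
  have en: "1 \<le> e * sqrt n" using W2(1) M(1) by (simp add: e_def)
  have en1: "1 \<le> e * n"
  proof -
    have "sqrt n \<le> n" using n_large by (intro real_le_lsqrt) (auto simp: power2_eq_square)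
    then have "e * sqrt n \<le> e * n" using e0 by (intro mult_left_mono) auto
    then show ?thesis using en by linarith
  qed
  have Ln: "L \<le> n" unfolding L_def using ln_le_minus_one[OF n0] by linarith
  \<comment> \<open>The order \<open>L / e^2\<close> is the least mean for which a relative
    deviation of order \<open>e\<close> has probability below \<open>n^(-k)\<close>.\<close>
  define K where "K = nat \<lceil>C1 * L / e\<^sup>2\<rceil>"
  have y0: "1 \<le> C1 * L / e\<^sup>2"
  proof -
    have "e\<^sup>2 \<le> 1" using e0 e1 by (simp add: power_le_one)
    moreover have "1 \<le> C1 * L" using C1_1 L1 mult_mono[of 1 C1 1 L] by simp
    ultimately show ?thesis using e0 by (simp add: le_divide_eq)
  qed
  have K1: "C1 * L / e\<^sup>2 \<le> K" unfolding K_def by (rule real_nat_ceiling_ge)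
  have K2: "K \<le> 2 * (C1 * L / e\<^sup>2)"
    using y0 ceiling_correct[of "C1 * L / e\<^sup>2"] unfolding K_def by linarith
  have Kge1: "1 \<le> real K" using K1 y0 by linarith
  have K0: "0 < K" using Kge1 by simp
  have K1': "C1 * L \<le> e\<^sup>2 * K" using K1 e0 by (simp add: divide_le_eq mult.commute)
  have K2': "e\<^sup>2 * K \<le> 2 * C1 * L" using K2 e0 by (simp add: le_divide_eq mult_ac)
  \<comment> \<open>One hundredth of \<open>e\<close> times the expected codegree, at density
    \<open>p\<close> here and at density \<open>d = p / K\<close> for \<open>s2\<close>. As
    \<open>p\<close> and \<open>d\<close> are at most 1, the same deviations are small compared with
    the degrees.\<close>
  define s1 where "s1 = e * N * p\<^sup>2 / 100"
  define s2 where "s2 = e * N * p\<^sup>2 / (100 * (real K)\<^sup>2)"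
  define \<kappa> where "\<kappa> = e / 100"
  define \<beta> where "\<beta> = e / 200"
  \<comment> \<open>The factor \<open>1 + e / 100\<close> outweighs the restriction to good
    orderings, as \<open>(1 + e / 100) * (1 - e / 200) \<ge> 1\<close>.\<close>
  define q where "q = (real N)\<^sup>2 / C * (1 + e / 100)"
  \<comment> \<open>Half of the relative margin \<open>e / 100\<close> between \<open>K\<close> and
    the mean coverage \<open>q * R\<close>. The resulting exponent
    \<open>\<theta>^2 * K / 2 = e^2 * K / 80000\<close> explains the 80000 in
    \<open>C1\<close>.\<close>
  define \<theta> where "\<theta> = e / 200"
  define d where "d = p / real K"
  \<comment> \<open>The number of orderings before rounding: their mean coverage exceeds
    \<open>K\<close> divided by \<open>1 + e / 100\<close> in no case.\<close>
  define \<rho> where "\<rho> = K / (q * (1 + e / 100))"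
  define R where "R = nat \<lfloor>\<rho>\<rfloor>"
  define y where "y = d * N"
  define r where "r = nat \<lfloor>(1 - 19/10 * x) * y\<rfloor>"
  have q0: "0 < q" using N0 C0 e0 by (simp add: q_def)
  have d0: "0 < d" using p K0 by (simp add: d_def)
  have d1: "d \<le> 1" using p Kge1 by (simp add: d_def divide_le_eq)
  have \<rho>0: "0 < \<rho>" using q0 e0 K0 by (simp add: \<rho>_def)

  have big: "M * L ^ 6 \<le> e ^ 10 * p ^ 4 * n" using W by (simp add: e_def L_def)
  have bigN: "M * L ^ 6 \<le> e ^ 10 * p ^ 4 * N * l" using big by (simp add: nN)

  have c1: "real (n choose (l - a)) \<le> (1 + \<kappa>) * real (n - 4 * a choose (l - a))"
  proof -
    define b where "b = l - a"
    \<comment> \<open>The relative loss in passing from \<open>n\<close> to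
      \<open>n - 4 * a\<close>. Since \<open>n - 4 * a \<ge> n / 2\<close>, it is at most
      \<open>8 * a * b / n\<close>, which is written with 1600 to compare with
      \<open>e / 200\<close>.\<close>
    define g where "g = real (4 * a) * (real b / real (n - 4 * a))"
    have an: "4 * a < n" "b \<le> n - 4 * a" using n_large a by (auto simp: b_def)
    have g1: "(1 - g) * real (n choose b) \<le> real (n - 4 * a choose b)"
      unfolding g_def by (rule binomial_shift_ge[OF an order_refl])
    have "g \<le> e / 200"
    proof -
      have "real n / 2 \<le> real (n - 4 * a)" using n_large by (simp add: of_nat_diff)
      then have "g \<le> real (4 * a) * (real b / (real n / 2))"
        unfolding g_def using n0 by (intro mult_left_mono divide_left_mono) auto
      also have "\<dots> = (1600 * real a * real b) / (200 * real n)" by simp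
      also have "\<dots> \<le> M / (200 * real n)" using M(6) n0 by (intro divide_right_mono) (auto simp: b_def)
      also have "\<dots> \<le> (e\<^sup>2 * n) / (200 * real n)" using W2(2) n0 by (intro divide_right_mono) (auto simp: e_def)
      also have "\<dots> = e\<^sup>2 / 200" using n0 by simp
      also have "\<dots> \<le> e / 200" using e0 e1 by (simp add: power2_eq_square)
      finally show ?thesis .
    qed
    then have "1 \<le> (1 + e / 100) * (1 - g)"
    proof -
      have "1 \<le> (1 + e / 100) * (1 - e / 200)" using e0 e1 by (simp add: algebra_simps)
      also have "\<dots> \<le> (1 + e / 100) * (1 - g)" using \<open>g \<le> e / 200\<close> e0 by (intro mult_left_mono) auto
      finally show ?thesis .
    qed
    then have "real (n choose b) \<le> (1 + e / 100) * (1 - g) * real (n choose b)"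
      using mult_right_mono[of 1 "(1 + e / 100) * (1 - g)" "real (n choose b)"] by simp
    also have "\<dots> \<le> (1 + e / 100) * real (n - 4 * a choose b)"
      using mult_left_mono[OF g1, of "1 + e / 100"] e0 by (simp add: mult.assoc)
    finally show ?thesis by (simp add: b_def \<kappa>_def)
  qed

  have c2: "4 * (real N)\<^sup>2 * exp (- (s1\<^sup>2 / (64 * real n))) \<le> \<beta>"
  proof -
    have "2560000 * (real l)\<^sup>2 * L \<le> M * L ^ 6"
      using M(2) Lpow[of 1 6] L1 M(1) by (intro mult_mono) auto
    also have "\<dots> \<le> e ^ 10 * p ^ 4 * n" by (rule big)
    also have "\<dots> \<le> e\<^sup>2 * p ^ 4 * n"
      using e0 e1 p by (intro mult_right_mono power_decreasing) auto
    \<comment> \<open>Four logarithms give \<open>exp (- 4 * L) = 1 / n^4\<close>, which beats the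
      \<open>4 * N^2\<close> events; 640000 is \<open>64 * 100^2\<close>.\<close>
    finally have "4 * L \<le> (e\<^sup>2 * p ^ 4 * n) / (640000 * (real l)\<^sup>2)"
      using l0 by (simp add: le_divide_eq mult_ac)
    also have "\<dots> = s1\<^sup>2 / (64 * real n)"
      using l0 N0 unfolding s1_def nN by (simp add: field_simps power2_eq_square power4_eq_xxxx)
    finally have "exp (- (s1\<^sup>2 / (64 * real n))) \<le> exp (- (real 4 * ln (real n)))"
      by (simp add: L_def)
    also have "\<dots> = 1 / real n ^ 4" using n_large by (intro exp_minus_mult_ln) auto
    finally have "4 * (real N)\<^sup>2 * exp (- (s1\<^sup>2 / (64 * real n))) \<le> 4 * (real n)\<^sup>2 * (1 / real n ^ 4)"
      using Nn by (intro mult_mono) auto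
    also have "\<dots> = 4 / (real n)\<^sup>2" using n0 by (simp add: field_simps power2_eq_square power4_eq_xxxx)
    also have "\<dots> \<le> \<beta>"
    proof -
      have "800 * 1 \<le> real n * (e * n)" using n_large en1 by (intro mult_mono) auto
      then show ?thesis using n0 by (simp add: \<beta>_def divide_le_eq power2_eq_square mult_ac)
    qed
    finally show ?thesis .
  qed

  have c3: "(real N)\<^sup>2 / real (n choose (l + a)) \<le> q * (1 - \<beta>)"
  proof -
    have "1 \<le> (1 + e / 100) * (1 - e / 200)" using e0 e1 by (simp add: algebra_simps)
    then have "(real N)\<^sup>2 / C * 1 \<le> (real N)\<^sup>2 / C * ((1 + e / 100) * (1 - e / 200))"
      using C0 by (intro mult_left_mono) auto
    then show ?thesis by (simp add: q_def \<beta>_def C_def k_def mult.assoc)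
  qed

  have Rle: "real R * (q * (1 + e / 100)) \<le> K"
  proof -
    have "real R \<le> \<rho>" using \<rho>0 by (simp add: R_def)
    then show ?thesis using q0 e0 by (simp add: \<rho>_def pos_le_divide_eq)
  qed

  have c4: "m * exp ((exp \<theta> - 1) * q * R - \<theta> * K) < 1"
  proof -
    define z where "z = q * real R"
    have z0: "0 \<le> z" using q0 by (simp add: z_def)
    have \<theta>: "0 \<le> \<theta>" "\<theta> \<le> 1 / 2" using e0 e1 by (auto simp: \<theta>_def)
    have zK: "(1 + 2 * \<theta>) * z \<le> K" using Rle by (simp add: z_def \<theta>_def mult_ac)
    \<comment> \<open>The product \<open>(1 - \<theta> / 2) * (1 + 2 * \<theta>)\<close> is
      \<open>1 + 3/2 * \<theta> - \<theta>^2\<close>, so \<open>\<theta> \<le> 1/2\<close>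
      suffices.\<close>
    have "(1 + \<theta>) * z \<le> ((1 - \<theta> / 2) * (1 + 2 * \<theta>)) * z"
      using \<theta> z0 mult_mono[of \<theta> "1/2" \<theta> \<theta>] by (intro mult_right_mono) (auto simp: algebra_simps)
    also have "\<dots> \<le> (1 - \<theta> / 2) * K" using zK \<theta> by (simp only: mult.assoc) (intro mult_left_mono, auto)
    finally have z2: "(1 + \<theta>) * z \<le> (1 - \<theta> / 2) * K" .
    have "exp \<theta> - 1 \<le> \<theta> * (1 + \<theta>)"
      using exp_bound[of \<theta>] \<theta> by (simp add: algebra_simps power2_eq_square)
    then have "(exp \<theta> - 1) * z \<le> \<theta> * ((1 + \<theta>) * z)" using z0 mult_right_mono by fastforce
    also have "\<dots> \<le> \<theta> * ((1 - \<theta> / 2) * K)" using z2 \<theta> by (intro mult_left_mono) auto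
    finally have "(exp \<theta> - 1) * z - \<theta> * K \<le> - (\<theta>\<^sup>2 / 2 * K)"
      by (simp add: algebra_simps power2_eq_square)
    also have "\<theta>\<^sup>2 / 2 * K = e\<^sup>2 * K / 80000" by (simp add: \<theta>_def power2_eq_square)
    also have "- (e\<^sup>2 * K / 80000) \<le> - (real (k + 1) * L)"
      using K1' by (simp add: C1 k_def algebra_simps)
    finally have "exp ((exp \<theta> - 1) * q * R - \<theta> * K) \<le> exp (- (real (k + 1) * ln (real n)))"
      by (simp add: z_def L_def mult.assoc)
    also have "\<dots> = 1 / real n ^ (k + 1)" using n_large by (intro exp_minus_mult_ln) auto
    finally have "m * exp ((exp \<theta> - 1) * q * R - \<theta> * K) \<le> real n ^ k * (1 / real n ^ (k + 1))"
    proof (intro mult_mono)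
      have "m \<le> 1 * C" unfolding m C_def k_def using p by (intro mult_right_mono) auto
      then show "m \<le> real n ^ k" using Cn by linarith
    qed auto
    also have "\<dots> = 1 / real n" using n0 by simp
    also have "\<dots> < 1" using n_large by simp
    finally show ?thesis .
  qed

  have c5: "2 * real R * (real N)\<^sup>2 * exp (- (s2\<^sup>2 / (8 * real N))) < 1"
  proof -
    \<comment> \<open>The tightest use of the growth hypothesis. The exponent
      \<open>s2^2 / (8 * N)\<close> contains \<open>K^4\<close>, of order \<open>L^4 / e^8\<close>,
      and must exceed \<open>(k + 4) * L\<close>; this consumes \<open>e^10\<close> and
      \<open>L^5\<close>. The constant is \<open>1280000 = 8 * 100^2 * 2^4\<close>.\<close>
    have "real (k + 4) * L * (1280000 * C1 ^ 4 * L ^ 4) * real l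
        = (1280000 * C1 ^ 4 * (real (l + a) + 4) * real l) * L ^ 5"
      by (simp add: k_def power_Suc[symmetric] algebra_simps numeral_eq_Suc)
    also have "\<dots> \<le> M * L ^ 6" using M(1,3) Lpow[of 5 6] L1 by (intro mult_mono) auto
    also have "\<dots> \<le> e ^ 10 * p ^ 4 * N * l" by (rule bigN)
    finally have i1: "real (k + 4) * L * (1280000 * C1 ^ 4 * L ^ 4) \<le> e ^ 10 * p ^ 4 * N"
      using l0 by simp
    have "(e\<^sup>2 * K) ^ 4 \<le> (2 * C1 * L) ^ 4" using K2' by (intro power_mono) auto
    then have "e ^ 8 * real K ^ 4 \<le> 16 * C1 ^ 4 * L ^ 4"
      by (simp add: power_mult_distrib power_mult[symmetric])
    then have "real (k + 4) * L * (80000 * (e ^ 8 * real K ^ 4)) \<le> real (k + 4) * L * (80000 * (16 * C1 ^ 4 * L ^ 4))"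
      using L1 by (intro mult_left_mono) auto
    also have "\<dots> \<le> e ^ 10 * p ^ 4 * N" using i1 by simp
    also have "e ^ 10 = e ^ 8 * e\<^sup>2" by (simp add: power_add[symmetric])
    finally have "e ^ 8 * (real (k + 4) * L * (80000 * real K ^ 4)) \<le> e ^ 8 * (e\<^sup>2 * p ^ 4 * N)"
      by (simp only: mult_ac)
    then have "real (k + 4) * L * (80000 * real K ^ 4) \<le> e\<^sup>2 * p ^ 4 * N" using e0 by simp
    then have "real (k + 4) * L \<le> e\<^sup>2 * p ^ 4 * N / (80000 * real K ^ 4)"
      using K0 by (simp add: le_divide_eq)
    also have "\<dots> = s2\<^sup>2 / (8 * real N)"
      using N0 K0 by (simp add: s2_def field_simps power2_eq_square power4_eq_xxxx)
    finally have "exp (- (s2\<^sup>2 / (8 * real N))) \<le> exp (- (real (k + 4) * ln (real n)))"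
      by (simp add: L_def)
    also have "\<dots> = 1 / real n ^ (k + 4)" using n_large by (intro exp_minus_mult_ln) auto
    finally have ex4: "exp (- (s2\<^sup>2 / (8 * real N))) \<le> 1 / real n ^ (k + 4)" .
    have "(real N)\<^sup>2 / C \<le> q * (1 + e / 100)"
    proof -
      have "1 \<le> (1 + e / 100) * (1 + e / 100)" using e0 by (simp add: algebra_simps)
      then have "(real N)\<^sup>2 / C * 1 \<le> (real N)\<^sup>2 / C * ((1 + e / 100) * (1 + e / 100))"
        using C0 by (intro mult_left_mono) auto
      then show ?thesis by (simp add: q_def mult.assoc)
    qed
    then have "real R * ((real N)\<^sup>2 / C) \<le> real R * (q * (1 + e / 100))" by (intro mult_left_mono) auto
    then have "real R * ((real N)\<^sup>2 / C) \<le> K" using Rle by linarith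
    \<comment> \<open>Coverage counted twice: \<open>R * N^2\<close> slots against fewer than a
      multiple \<open>K\<close> of the \<open>C\<close> possible edges. This bounds the number of
      events by a power of \<open>n\<close> below \<open>n^(k + 4)\<close>.\<close>
    then have RN: "real R * (real N)\<^sup>2 \<le> K * C" using C0 by (simp add: divide_le_eq)
    have "K \<le> real n ^ 2"
    proof -
      have "2 * C1 \<le> e\<^sup>2 * n" using M(4) W2(2) unfolding e_def by linarith
      then have "2 * C1 * L \<le> (e\<^sup>2 * n) * n" using Ln by (rule mult_mono) (use L1 in auto)
      then have "2 * (C1 * L / e\<^sup>2) \<le> real n * n" using e0 by (simp add: divide_le_eq mult_ac)
      then show ?thesis using K2 by (simp add: power2_eq_square)
    qed
    then have "real R * (real N)\<^sup>2 \<le> real n ^ 2 * real n ^ k"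
      using RN Cn C0 mult_mono[of "real K" "real n ^ 2" C "real n ^ k"] by simp
    then have "2 * real R * (real N)\<^sup>2 \<le> 2 * (real n ^ 2 * real n ^ k)" by simp
    then have "2 * real R * (real N)\<^sup>2 * exp (- (s2\<^sup>2 / (8 * real N)))
        \<le> (2 * (real n ^ 2 * real n ^ k)) * (1 / real n ^ (k + 4))"
      using ex4 by (rule mult_mono) auto
    also have "\<dots> = 2 / real n ^ 2" using n0 by (simp add: field_simps power_add power2_eq_square power4_eq_xxxx)
    also have "\<dots> < 1"
    proof -
      have "800 * 800 \<le> real n * n" using n_large by (intro mult_mono) auto
      then show ?thesis by (simp add: divide_less_eq power2_eq_square)
    qed
    finally show ?thesis .
  qed

  have c6: "(1 - 26/25 * e) * d * N \<le> (N * ((1 - e) * p) - s1) / K - s2"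
  proof -
    define u where "u = N * p / K"
    have u0: "0 \<le> u" using p by (simp add: u_def)
    have f1: "s1 / K = u * (e * p / 100)" and f2: "s2 = u * (e * d / 100)"
      and f3: "N * ((1 - e) * p) / K = u * (1 - e)"
      using K0 by (simp_all add: s1_def s2_def u_def d_def power2_eq_square mult_ac)
    have rhs: "(N * ((1 - e) * p) - s1) / K - s2 = u * ((1 - e) - e * p / 100 - e * d / 100)"
      unfolding diff_divide_distrib f1 f2 f3 by (simp only: right_diff_distrib)
    have "e * p \<le> e * 1" "e * d \<le> e * 1" using e0 p d1 by (intro mult_left_mono; simp)+
    then have "1 - 26/25 * e \<le> (1 - e) - e * p / 100 - e * d / 100" using e0 by linarith
    then have "u * (1 - 26/25 * e) \<le> u * ((1 - e) - e * p / 100 - e * d / 100)"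
      using u0 by (rule mult_left_mono)
    then show ?thesis unfolding rhs by (simp add: u_def d_def mult_ac)
  qed

  have c7: "(N * ((1 + e) * (1 + \<kappa>) * p\<^sup>2) + s1) / real (K\<^sup>2) + s2 \<le> (1 + 26/25 * e) * d\<^sup>2 * N"
  proof -
    define v where "v = N * p\<^sup>2 / (real K)\<^sup>2"
    have v0: "0 \<le> v" by (simp add: v_def)
    have "s1 / (real K)\<^sup>2 = v * (e / 100)" "s2 = v * (e / 100)"
      using K0 by (simp_all add: s1_def s2_def v_def mult_ac)
    then have lhs: "(N * ((1 + e) * (1 + \<kappa>) * p\<^sup>2) + s1) / real (K\<^sup>2) + s2 = v * ((1 + e) * (1 + \<kappa>) + e / 100 + e / 100)"
      by (simp add: add_divide_distrib v_def algebra_simps)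
    \<comment> \<open>The constant 26/25 is fixed here: besides \<open>e\<close> itself, \<kappa>,
      \<open>s1\<close> and \<open>s2\<close> cost one hundredth of \<open>e\<close> each, and the
      product \<open>e * \<kappa>\<close> at most another.\<close>
    have "e * e \<le> e * 1" using e0 e1 by (intro mult_left_mono) auto
    moreover have "(1 + e) * (1 + \<kappa>) + e / 100 + e / 100 = 1 + e + 3 * (e / 100) + e * e / 100"
      by (simp add: \<kappa>_def field_simps)
    ultimately have "(1 + e) * (1 + \<kappa>) + e / 100 + e / 100 \<le> 1 + 26/25 * e" by linarith
    then have "v * ((1 + e) * (1 + \<kappa>) + e / 100 + e / 100) \<le> v * (1 + 26/25 * e)"
      using v0 by (rule mult_left_mono)
    also have "\<dots> = (1 + 26/25 * e) * d\<^sup>2 * N" by (simp add: v_def d_def power_divide)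
    finally show ?thesis unfolding lhs .
  qed

  have c8: "100 \<le> x ^ 4 * d ^ 3 * N"
  proof -
    \<comment> \<open>The factor 800 is 100 times the 8 from
      \<open>K^3 \<le> (2 * C1 * L / e^2)^3\<close>; finally
      \<open>e^2 = x^6 \<le> x^4\<close>.\<close>
    have "(800 * C1 ^ 3 * real l) * L ^ 3 \<le> M * L ^ 6" using M(1,5) Lpow[of 3 6] L1 by (intro mult_mono) auto
    also have "\<dots> \<le> e ^ 10 * p ^ 4 * N * l" by (rule bigN)
    also have "\<dots> \<le> e ^ 8 * p ^ 3 * N * l"
      using e0 e1 p by (intro mult_right_mono mult_mono power_decreasing) auto
    finally have "(800 * C1 ^ 3 * L ^ 3) * real l \<le> (e ^ 8 * p ^ 3 * N) * real l" by (simp add: mult_ac)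
    then have i1: "800 * C1 ^ 3 * L ^ 3 \<le> e ^ 8 * p ^ 3 * N" using l0 by simp
    have "(e\<^sup>2 * K) ^ 3 \<le> (2 * C1 * L) ^ 3" using K2' by (intro power_mono) auto
    then have "e ^ 6 * real K ^ 3 \<le> 8 * C1 ^ 3 * L ^ 3"
      by (simp add: power_mult_distrib power_mult[symmetric])
    then have "100 * (e ^ 6 * real K ^ 3) \<le> e ^ 8 * p ^ 3 * N" using i1 by linarith
    also have "\<dots> = e ^ 6 * (e\<^sup>2 * p ^ 3 * N)" by (simp add: power_add[symmetric])
    finally have "e ^ 6 * (100 * real K ^ 3) \<le> e ^ 6 * (e\<^sup>2 * p ^ 3 * N)" by (simp add: mult_ac)
    then have "100 * real K ^ 3 \<le> e\<^sup>2 * p ^ 3 * N" using e0 by simp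
    then have "100 \<le> e\<^sup>2 * p ^ 3 * N / real K ^ 3" using K0 by (simp add: le_divide_eq)
    also have "\<dots> = e\<^sup>2 * d ^ 3 * N" by (simp add: d_def power_divide)
    also have "\<dots> \<le> x ^ 4 * d ^ 3 * N"
      using x d0 by (intro mult_right_mono) (auto simp: e_def power_mult[symmetric] intro: power_decreasing)
    finally show ?thesis .
  qed

  have rbd: "real r \<le> (1 - 19/10 * x) * y" "(1 - 19/10 * x) * y - 1 \<le> real r"
  proof -
    have "0 \<le> (1 - 19/10 * x) * y" using x d0 by (simp add: y_def)
    then show "real r \<le> (1 - 19/10 * x) * y" by (simp add: r_def)
    show "(1 - 19/10 * x) * y - 1 \<le> real r" unfolding r_def by linarith
  qed

  have c9: "(1 - 2 * x) * m / N \<le> real (R * r)"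
  proof -
    have y0: "0 < y" using d0 N0 by (simp add: y_def)
    have xy: "100 \<le> x * y"
    proof -
      have "x ^ 4 * d ^ 3 * N \<le> x ^ 1 * d ^ 1 * N"
        using x d0 d1 by (intro mult_right_mono mult_mono power_decreasing) auto
      then show ?thesis using c8 by (simp add: y_def)
    qed
    have sq: "(1 + e / 100) * (1 + e / 100) \<le> 1 + x / 100"
    proof -
      have "e * e \<le> e * 1" using e0 e1 by (intro mult_left_mono) auto
      then have "(1 + e / 100) * (1 + e / 100) \<le> 1 + 3 * e / 100" using e0 by (simp add: algebra_simps)
      then show ?thesis using ex e0 by simp
    qed
    have \<rho>_eq: "\<rho> * ((1 + e / 100) * (1 + e / 100)) = K * C / (real N)\<^sup>2"
      using e0 N0 C0 by (simp add: \<rho>_def q_def)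
    have x\<rho>: "100 \<le> x * \<rho>"
    proof -
      \<comment> \<open>Because \<open>k \<ge> 3\<close>, the binomial has at least cubic growth, so
        \<open>C / N^2\<close> is at least linear in \<open>n\<close> and rounding \<rho> down costs
        a factor of at worst \<open>1 - x / 100\<close>.\<close>
      have "(real n / real k) ^ 3 \<le> (real n / real k) ^ k"
        using kn k3 by (intro power_increasing) auto
      also have "\<dots> \<le> C" unfolding C_def by (rule binomial_ge_n_over_k_pow_k[OF kn])
      finally have Cl: "real n ^ 3 / real k ^ 3 \<le> C" by (simp add: power_divide)
      have "real n / real k ^ 3 = (real n ^ 3 / real k ^ 3) / (real n)\<^sup>2"
        using n0 by (simp add: power2_eq_square power3_eq_cube)
      also have "\<dots> \<le> C / (real N)\<^sup>2"
        using Cl Nn N0 C0 by (intro frac_le) auto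
      also have "\<dots> \<le> K * C / (real N)\<^sup>2"
        using Kge1 C0 by (intro divide_right_mono) auto
      also have "\<dots> = \<rho> * ((1 + e / 100) * (1 + e / 100))" by (rule \<rho>_eq[symmetric])
      also have "\<dots> \<le> \<rho> * 2" using sq x \<rho>0 by (intro mult_left_mono) auto
      finally have r1: "real n / real k ^ 3 \<le> 2 * \<rho>" by simp
      have k0: "0 < real k ^ 3" using k3 by simp
      have "200 * real k ^ 3 \<le> sqrt n" using n_large(4) by (simp add: k_def)
      also have "\<dots> \<le> e * sqrt n * sqrt n" using mult_right_mono[OF en, of "sqrt n"] by simp
      also have "\<dots> = e * n" by simp
      finally have "200 \<le> e * (real n / real k ^ 3)" using k0 by (simp add: le_divide_eq)
      also have "\<dots> \<le> x * (2 * \<rho>)"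
        using r1 ex e0 x n0 by (intro mult_mono) auto
      finally show ?thesis by (simp add: mult_ac)
    qed
    have "\<rho> - 1 \<le> real R" unfolding R_def by linarith
    then have R1: "\<rho> * (1 - x / 100) \<le> real R" using x\<rho> by (simp add: algebra_simps)
    \<comment> \<open>Rounding down costs 1, at most \<open>x * y / 100\<close>, so 1.9 grows to
      1.91 and is stated as 1.92.\<close>
    have r1: "y * (1 - 48/25 * x) \<le> real r" using rbd(2) xy by (simp add: algebra_simps)
    have m\<rho>: "\<rho> * y * ((1 + e / 100) * (1 + e / 100)) = m / N"
    proof -
      have "\<rho> * y * ((1 + e / 100) * (1 + e / 100)) = (\<rho> * ((1 + e / 100) * (1 + e / 100))) * y"
        by (simp only: mult_ac)
      also have "\<dots> = (K * C / (real N)\<^sup>2) * y" by (simp only: \<rho>_eq)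
      also have "\<dots> = m / N"
        using K0 N0 by (simp add: y_def d_def m C_def k_def power2_eq_square)
      finally show ?thesis .
    qed
    \<comment> \<open>The final budget: the two roundings and the surplus factor
      \<open>(1 + e / 100)^2\<close> in \<rho> fit between 1.92 and 2.\<close>
    have fac: "(1 - 2 * x) * ((1 + e / 100) * (1 + e / 100)) \<le> (1 - x / 100) * (1 - 48/25 * x)"
    proof -
      have "(1 - 2 * x) * ((1 + e / 100) * (1 + e / 100)) \<le> (1 - 2 * x) * (1 + x / 100)"
        using sq x by (intro mult_left_mono) auto
      also have "\<dots> = 1 - 199/100 * x - x * x / 50" by (simp add: field_simps)
      also have "\<dots> \<le> 1 - 193/100 * x + 12/625 * (x * x)" using x zero_le_square[of x] by linarith
      also have "\<dots> = (1 - x / 100) * (1 - 48/25 * x)" by (simp add: field_simps)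
      finally show ?thesis .
    qed
    have "(1 - 2 * x) * m / N = (1 - 2 * x) * (m / N)" by simp
    also have "\<dots> = (\<rho> * y) * ((1 - 2 * x) * ((1 + e / 100) * (1 + e / 100)))"
      unfolding m\<rho>[symmetric] by (simp only: mult_ac)
    also have "\<dots> \<le> (\<rho> * y) * ((1 - x / 100) * (1 - 48/25 * x))"
      using fac \<rho>0 y0 by (intro mult_left_mono) auto
    also have "\<dots> = (\<rho> * (1 - x / 100)) * (y * (1 - 48/25 * x))" by simp
    also have "\<dots> \<le> real R * real r" using R1 r1 x y0 by (intro mult_mono) auto
    finally show ?thesis by simp
  qed

  show ?thesis
  proof (intro exI conjI)
    show "0 \<le> s1" "0 \<le> s2" "0 \<le> \<kappa>" using e0 by (auto simp: s1_def s2_def \<kappa>_def)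
    show "\<beta> < 1" using e1 by (simp add: \<beta>_def)
    show "0 \<le> q" using q0 by simp
    show "0 \<le> \<theta>" using e0 by (simp add: \<theta>_def)
    show "d = p / real K" by (simp add: d_def)
    show "real r \<le> (1 - 19/10 * x) * d * N" using rbd(1) by (simp add: y_def mult.assoc)
    show "(1 - 26/25 * x ^ 3) * d * N \<le> (N * ((1 - x ^ 3) * p) - s1) / K - s2"
      using c6 by (simp only: e_def)
    show "(N * ((1 + x ^ 3) * (1 + \<kappa>) * p\<^sup>2) + s1) / real (K\<^sup>2) + s2 \<le> (1 + 26/25 * x ^ 3) * d\<^sup>2 * N"
      using c7 by (simp only: e_def)
  qed (fact c1 c2 c3 c4 c5 K0 c8 c9)+
qed

section \<open>Thresholds and the final deduction\<close>

theorem theorem3: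
  fixes k l :: nat and p \<epsilon> :: "nat \<Rightarrow> real"
  assumes kl: "k < 2 * l" "l < k"
    and p_range: "\<And>n. l dvd n \<Longrightarrow> 0 < p n \<and> p n \<le> 1"
    and eps_lt: "\<And>n. l dvd n \<Longrightarrow> \<epsilon> n < 1"
    and growth: "\<forall>M::real. \<exists>N. \<forall>n\<ge>N. l dvd n \<longrightarrow>
                    \<epsilon> n ^ 5 * sqrt (real n) * p n ^ 2 / ln (real n) ^ 3 \<ge> M"
  shows "\<exists>N. \<forall>n\<ge>N. l dvd n \<longrightarrow> (\<forall>E.
     uniform_hypergraph n k E \<and>
     p n = real (card E) / real (n choose k) \<and>
     (\<forall>S. S \<subseteq> {0..<n} \<and> card S = 2*(k-l) \<longrightarrow>
        int (deg n k E S) \<ge> \<lceil>(1 - \<epsilon> n) * real (n - 2*(k-l) choose (2*l-k)) * p n\<rceil>) \<and>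
     (\<forall>S. S \<subseteq> {0..<n} \<and> card S = 2*l-k \<longrightarrow>
        int (deg n k E S) \<ge> \<lceil>(1 - \<epsilon> n) * real (n - (2*l-k) choose (2*(k-l))) * p n\<rceil>) \<and>
     (\<forall>S. S \<subseteq> {0..<n} \<and> card S = 2*(k-l)+1 \<longrightarrow>
        int (deg n k E S) \<le> \<lfloor>(1 + \<epsilon> n) * real (n - (2*(k-l)+1) choose (2*l-k-1)) * p n\<rfloor>) \<and>
     (\<forall>S. S \<subseteq> {0..<n} \<and> card S = 2*l-k+1 \<longrightarrow>
        int (deg n k E S) \<le> \<lfloor>(1 + \<epsilon> n) * real (n - (2*l-k+1) choose (2*(k-l)-1)) * p n\<rfloor>) \<and>
     (\<forall>S1 S2. S1 \<subseteq> {0..<n} \<and> S2 \<subseteq> {0..<n} \<and> card S1 = 2*l-k \<and> card S2 = 2*l-k \<and>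
        S1 \<inter> S2 = {} \<longrightarrow>
        int (card (nbhd n k E S1 \<inter> nbhd n k E S2))
          \<le> \<lfloor>(1 + \<epsilon> n) * real (n - 2*(2*l-k) choose (2*(k-l))) * p n ^ 2\<rfloor>) \<and>
     (\<forall>S1 S2. S1 \<subseteq> {0..<n} \<and> S2 \<subseteq> {0..<n} \<and> card S1 = 2*(k-l) \<and> card S2 = 2*(k-l) \<and>
        card (S1 \<inter> S2) \<in> {0, k-l} \<longrightarrow>
        int (card (nbhd n k E S1 \<inter> nbhd n k E S2))
          \<le> \<lfloor>(1 + \<epsilon> n) * real (n choose (2*l-k)) * p n ^ 2\<rfloor>)
     \<longrightarrow> (\<exists>CC. (\<forall>C\<in>CC. ham_cycle n k l E C) \<and>
             (\<forall>C1\<in>CC. \<forall>C2\<in>CC. C1 \<noteq> C2 \<longrightarrow> C1 \<inter> C2 = {}) \<and>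
             finite CC \<and>
             real (card CC) \<ge> (1 - 2 * root 3 (\<epsilon> n)) * real (card E) / (real n / real l)))"
proof -
  define a where "a = k - l"
  have a: "0 < a" "a < l" and k: "k = l + a" using kl by (auto simp: a_def)
  have ka: "k - l = a" "2 * l - k = l - a" using kl by (auto simp: a_def)
  define C1 where "C1 = 80000 * (real (l + a) + 1)"
  \<comment> \<open>The sum of all the required lower bounds, each of which it dominates because
    every summand is nonnegative.\<close>
  define M where "M = 1 + 2560000 * (real l)\<^sup>2 + 1280000 * C1 ^ 4 * (real (l + a) + 4) * real l
    + 2 * C1 + 800 * C1 ^ 3 * real l + 1600 * real a * real (l - a)"
  have C1_0: "0 \<le> C1" by (simp add: C1_def)
  have pos: "0 \<le> 2560000 * (real l)\<^sup>2" "0 \<le> 1280000 * C1 ^ 4 * (real (l + a) + 4) * real l"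
    "0 \<le> 800 * C1 ^ 3 * real l" "0 \<le> 1600 * real a * real (l - a)"
    using C1_0 by simp_all
  have M: "1 \<le> M" "2560000 * (real l)\<^sup>2 \<le> M" "1280000 * C1 ^ 4 * (real (l + a) + 4) * real l \<le> M"
      "2 * C1 \<le> M" "800 * C1 ^ 3 * real l \<le> M" "1600 * real a * real (l - a) \<le> M"
    unfolding M_def using pos C1_0 by linarith+
  obtain N1 where N1: "\<And>n. N1 \<le> n \<Longrightarrow> l dvd n \<Longrightarrow>
      M \<le> \<epsilon> n ^ 5 * sqrt (real n) * p n ^ 2 / ln (real n) ^ 3"
    using growth by meson
  \<comment> \<open>The sixth power yields \<open>200 * (l + a)^3 \<le> sqrt n\<close>, and
    \<open>3 * l\<close> yields at least three windows; the other summands cover the remaining size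
    conditions.\<close>
  define N0 where "N0 = N1 + 800 + 8 * a + 3 * l + 40000 * (l + a) ^ 6"
  show ?thesis
  proof (intro exI[of _ N0] allI impI, elim conjE)
    fix n E
    assume n_ge: "N0 \<le> n" and ln: "l dvd n" and H: "uniform_hypergraph n k E"
      and pE: "p n = real (card E) / real (n choose k)"
      and Pa: "\<forall>S. S \<subseteq> {0..<n} \<and> card S = 2*(k-l) \<longrightarrow>
        \<lceil>(1 - \<epsilon> n) * real (n - 2*(k-l) choose (2*l-k)) * p n\<rceil> \<le> int (deg n k E S)"
      and Pb: "\<forall>S. S \<subseteq> {0..<n} \<and> card S = 2*l-k \<longrightarrow>
        \<lceil>(1 - \<epsilon> n) * real (n - (2*l-k) choose (2*(k-l))) * p n\<rceil> \<le> int (deg n k E S)"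
      and Pe: "\<forall>S1 S2. S1 \<subseteq> {0..<n} \<and> S2 \<subseteq> {0..<n} \<and> card S1 = 2*l-k \<and> card S2 = 2*l-k \<and>
        S1 \<inter> S2 = {} \<longrightarrow>
        int (card (nbhd n k E S1 \<inter> nbhd n k E S2))
          \<le> \<lfloor>(1 + \<epsilon> n) * real (n - 2*(2*l-k) choose (2*(k-l))) * p n ^ 2\<rfloor>"
      and Pf: "\<forall>S1 S2. S1 \<subseteq> {0..<n} \<and> S2 \<subseteq> {0..<n} \<and> card S1 = 2*(k-l) \<and> card S2 = 2*(k-l) \<and>
        card (S1 \<inter> S2) \<in> {0, k-l} \<longrightarrow>
        int (card (nbhd n k E S1 \<inter> nbhd n k E S2))
          \<le> \<lfloor>(1 + \<epsilon> n) * real (n choose (2*l-k)) * p n ^ 2\<rfloor>"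
    define x where "x = root 3 (\<epsilon> n)"
    show "\<exists>CC. (\<forall>C\<in>CC. ham_cycle n k l E C) \<and>
             (\<forall>C1\<in>CC. \<forall>C2\<in>CC. C1 \<noteq> C2 \<longrightarrow> C1 \<inter> C2 = {}) \<and> finite CC \<and>
             real (card CC) \<ge> (1 - 2 * root 3 (\<epsilon> n)) * real (card E) / (real n / real l)"
    proof (cases "1 / 2 \<le> x")
      case True
      \<comment> \<open>The required number of cycles is not positive, so the empty collection
        does.\<close>
      then have "(1 - 2 * x) * real (card E) / (real n / real l) \<le> 0"
        by (intro divide_nonpos_nonneg mult_nonpos_nonneg) auto
      then show ?thesis by (intro exI[of _ "{}"]) (simp add: x_def)
    next
      case False
      define N where "N = n div l"
      have nN: "n = N * l" using ln by (simp add: N_def)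
      have nl: "3 * l \<le> n" using n_ge by (simp add: N0_def)
      have N3: "3 \<le> N" using nl a by (simp add: N_def less_eq_div_iff_mult_less_eq)
      interpret block_layout l a N n using a N3 nN by unfold_locales
      have n800: "800 \<le> n" and "N1 \<le> n" using n_ge by (auto simp: N0_def)
      have p: "0 < p n" "p n \<le> 1" using p_range[OF ln] by auto
      define L where "L = ln (real n)"
      have L1: "1 \<le> L"
      proof -
        have "exp 1 \<le> real n" using exp_le n800 by linarith
        then show ?thesis unfolding L_def using n800 by (subst ln_ge_iff) auto
      qed
      have sqn: "200 * real (l + a) ^ 3 \<le> sqrt n"
      proof (rule real_le_rsqrt)
        have "(200 * real (l + a) ^ 3)\<^sup>2 = real (40000 * (l + a) ^ 6)"
          by (simp add: power_mult_distrib power_mult[symmetric])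
        also have "\<dots> \<le> real n" using n_ge unfolding N0_def of_nat_le_iff by linarith
        finally show "(200 * real (l + a) ^ 3)\<^sup>2 \<le> real n" .
      qed
      have "M \<le> \<epsilon> n ^ 5 * sqrt (real n) * p n ^ 2 / L ^ 3" using N1[OF \<open>N1 \<le> n\<close> ln] by (simp add: L_def)
      then have growth_n: "M * L ^ 3 \<le> \<epsilon> n ^ 5 * sqrt n * (p n)\<^sup>2" using L1 by (simp add: le_divide_eq)
      have "0 < M * L ^ 3" using M(1) L1 by (intro mult_pos_pos) auto
      \<comment> \<open>Positivity is no assumption: the growth condition with a positive
        \<open>M\<close> forces it, the fifth power being odd.\<close>
      have e0: "0 < \<epsilon> n"
      proof (rule ccontr)
        assume "\<not> 0 < \<epsilon> n"
        then have "\<epsilon> n ^ 5 \<le> 0" by (simp add: power_le_zero_eq)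
        then have "\<epsilon> n ^ 5 * sqrt n * (p n)\<^sup>2 \<le> 0" by (intro mult_nonpos_nonneg) auto
        then show False using growth_n \<open>0 < M * L ^ 3\<close> by linarith
      qed
      have x: "0 < x" "x \<le> 1 / 2" and x3: "x ^ 3 = \<epsilon> n"
        using e0 False by (auto simp: x_def)
      have MM: "M \<le> M\<^sup>2" using M(1) by (simp add: power2_eq_square)
      have W: "M * ln (real n) ^ 6 \<le> (x ^ 3) ^ 10 * p n ^ 4 * n"
      proof -
        \<comment> \<open>Squaring the growth condition removes the square root of \<open>n\<close>;
          \<open>M \<ge> 1\<close> allows \<open>M^2\<close> to be replaced by
          \<open>M\<close>.\<close>
        have "M * L ^ 6 \<le> M\<^sup>2 * L ^ 6" using MM L1 by (intro mult_right_mono) auto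
        also have "\<dots> = (M * L ^ 3)\<^sup>2" by (simp add: power_mult_distrib power_mult[symmetric])
        also have "\<dots> \<le> (\<epsilon> n ^ 5 * sqrt n * (p n)\<^sup>2)\<^sup>2"
          using growth_n \<open>0 < M * L ^ 3\<close> by (intro power_mono) auto
        also have "\<dots> = \<epsilon> n ^ 10 * p n ^ 4 * n"
          by (simp add: power_mult_distrib power_mult[symmetric])
        finally show ?thesis by (simp add: x3 L_def)
      qed
      have W1: "M \<le> x ^ 3 * sqrt n"
      proof -
        have "M * 1 \<le> M * L ^ 3" using M(1) L1 by (intro mult_left_mono) auto
        also have "\<dots> \<le> \<epsilon> n ^ 5 * sqrt n * (p n)\<^sup>2" by (rule growth_n)
        \<comment> \<open>Discarding \<open>p\<close> and four powers of \<epsilon>, all at most 1,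
          leaves the weaker bound that controls the roundings and the binomial quotients.\<close>
        also have "\<dots> \<le> \<epsilon> n ^ 1 * sqrt n * 1"
          using e0 eps_lt[OF ln] p by (intro mult_mono power_decreasing) (auto simp: power_le_one)
        finally show ?thesis by (simp add: x3)
      qed
      have W2: "M \<le> (x ^ 3)\<^sup>2 * n"
      proof -
        have "M\<^sup>2 \<le> (x ^ 3 * sqrt n)\<^sup>2" using W1 M(1) by (intro power_mono) auto
        then show ?thesis using MM by (simp add: power_mult_distrib)
      qed
      have lg: "1 \<le> ln (real n)" using L1 by (simp add: L_def)
      have "k \<le> n" using a nl k by linarith
      then have m: "real (card E) = p n * real (n choose (l + a))"
        unfolding pE k[symmetric] by (simp add: binomial_eq_0_iff)
      have finE: "finite E"
        by (rule finite_subset[of _ "Pow {0..<n}"]) (use H in \<open>auto simp: uniform_hypergraph_def\<close>)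
      have na: "8 * a \<le> n" "4 * a + (l - a) \<le> n" using n_ge a by (auto simp: N0_def)
      from parameter_choice[OF a N3 nN x p m lg W W1 W2 C1_def M n800 na sqn]
      obtain s1 s2 \<kappa> \<beta> q \<theta> d :: real and R K r :: nat where par:
        "0 \<le> s1" "0 \<le> s2" "0 \<le> \<kappa>"
        "real (n choose (l - a)) \<le> (1 + \<kappa>) * real (n - 4 * a choose (l - a))"
        "4 * (real N)\<^sup>2 * exp (- (s1\<^sup>2 / (64 * real n))) \<le> \<beta>" "\<beta> < 1"
        "(real N)\<^sup>2 / real (n choose (l + a)) \<le> q * (1 - \<beta>)" "0 \<le> q"
        "real (card E) * exp ((exp \<theta> - 1) * q * R - \<theta> * K) < 1" "0 \<le> \<theta>"
        "2 * real R * (real N)\<^sup>2 * exp (- (s2\<^sup>2 / (8 * real N))) < 1"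
        "0 < K" "d = p n / K"
        "(1 - 26/25 * x ^ 3) * d * N \<le> (N * ((1 - x ^ 3) * p n) - s1) / K - s2"
        "(N * ((1 + x ^ 3) * (1 + \<kappa>) * (p n)\<^sup>2) + s1) / real (K\<^sup>2) + s2 \<le> (1 + 26/25 * x ^ 3) * d\<^sup>2 * N"
        "100 \<le> x ^ 4 * d ^ 3 * N"
        "real r \<le> (1 - 19/10 * x) * d * N"
        "(1 - 2 * x) * real (card E) / N \<le> real (R * r)"
        by (elim exE conjE) (rule that)
      have "\<exists>CC. (\<forall>C\<in>CC. ham_cycle n (l + a) l E C) \<and>
             (\<forall>C1\<in>CC. \<forall>C2\<in>CC. C1 \<noteq> C2 \<longrightarrow> C1 \<inter> C2 = {}) \<and> finite CC \<and> card CC = R * r"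
      proof (rule packing_from_parameters[OF H[unfolded k] finE x p(1) par(1,2) na(2) par(4,3)
            _ _ _ _ par(5-17)])
        fix S assume "S \<subseteq> {0..<n}" "card S = 2 * a"
        then show "(1 - x ^ 3) * real (n - 2 * a choose (l - a)) * p n \<le> real (deg n (l + a) E S)"
          using Pa[unfolded ka] by (simp add: x3 k ceiling_le_iff)
      next
        fix S assume "S \<subseteq> {0..<n}" "card S = l - a"
        then show "(1 - x ^ 3) * real (n - (l - a) choose (2 * a)) * p n \<le> real (deg n (l + a) E S)"
          using Pb[unfolded ka] by (simp add: x3 k ceiling_le_iff)
      next
        fix S S' assume "S \<subseteq> {0..<n}" "S' \<subseteq> {0..<n}" "card S = 2 * a" "card S' = 2 * a" "card (S \<inter> S') \<in> {0, a}"
        then show "real (card (nbhd n (l + a) E S \<inter> nbhd n (l + a) E S')) \<le> (1 + x ^ 3) * real (n choose (l - a)) * (p n)\<^sup>2"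
          using Pf[unfolded ka, rule_format, of S S'] by (simp add: x3 k le_floor_iff)
      next
        fix S S' assume "S \<subseteq> {0..<n}" "S' \<subseteq> {0..<n}" "card S = l - a" "card S' = l - a" "S \<inter> S' = {}"
        then show "real (card (nbhd n (l + a) E S \<inter> nbhd n (l + a) E S')) \<le> (1 + x ^ 3) * real (n - 2 * (l - a) choose (2 * a)) * (p n)\<^sup>2"
          using Pe[unfolded ka, rule_format, of S S'] by (simp add: x3 k le_floor_iff)
      qed
      then obtain CC where CC: "\<forall>C\<in>CC. ham_cycle n (l + a) l E C"
        "\<forall>C1\<in>CC. \<forall>C2\<in>CC. C1 \<noteq> C2 \<longrightarrow> C1 \<inter> C2 = {}" "finite CC" "card CC = R * r" by blast
      have "real n / real l = real N" using nN a by simp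
      then have "(1 - 2 * root 3 (\<epsilon> n)) * real (card E) / (real n / real l) \<le> real (card CC)"
        using par(18) CC(4) by (simp add: x_def)
      then show ?thesis using CC k by blast
    qed
  qed
qed

end
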